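(* For any extended simple processes $A$ and $B$: $A\sqsubseteq_d^2 B$ if and only if $A\sqsubseteq_d^1 B$, where $\sqsubseteq_d^2$ (resp. $\sqsubseteq_d^1$) is trace inclusion for the reduced symbolic semantics with second-order (resp. first-order) satisfaction of dependency constraints.
   Context: **Terms and processes.** Fix pairwise disjoint infinite sets $\mathcal X$ (first-order variables), $\mathcal W$ (handles), a set $\mathcal N$ of names, a finite signature $\Sigma$ (constants allowed) and an equational theory $\mathsf E$ with induced congruence $=_{\mathsf E}$ on terms. $\mathcal T(S)$ is the set of terms built from $S$ using $\Sigma$; messages are in $\mathcal T(\mathcal N\cup\mathcal X)$, recipes in $\mathcal T(\mathcal W)$; ground means in $\mathcal T(\mathcal N)$. Fix a set $\mathcal C$ of channels. Basic processes on $c\in\mathcal C$: $P,Q::=0\mid \mathtt{if}\ u=v\ \mathtt{then}\ P\ \mathtt{else}\ Q\mid \mathtt{in}(c,x).P\mid \mathtt{out}(c,u).P$ with $u,v$ messages and $x\in\mathcal X$ (bound by the input); all actions are on the same channel $c$. A simple process $\mathcal P$ is a multiset of basic processes on pairwise distinct channels, null processes being removed. A frame $\Phi$ is a substitution with $\mathrm{dom}(\Phi)\subseteq\mathcal W$ and image in $\mathcal T(\mathcal N\cup\mathcal X)$, written $\{w\triangleright u,\dots\}$. An extended simple process is a pair $(\mathcal P;\Phi)$ of a simple process and a frame; all extended simple processes are closed: no free variables in $\mathcal P$, ground image of $\Phi$. Static equivalence $\Phi\sim\Phi'$ of closed frames: $\mathrm{dom}(\Phi)=\mathrm{dom}(\Phi')$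 and for all $M,N\in\mathcal T(\mathrm{dom}(\Phi))$: $M\Phi=_{\mathsf E}N\Phi\Leftrightarrow M\Phi'=_{\mathsf E}N\Phi'$. **Constraint systems.** Fix a set $\mathcal X^2$ of second-order variables (standing for recipes); $\mathrm{fv}^1,\mathrm{fv}^2$ denote free first-order (in $\mathcal X\cup\mathcal W$) and second-order variables. A constraint system $(\Phi;\mathcal S)$ is a frame with a set $\mathcal S$ of constraints of the forms $D\vdash^?_X x$, $u=^?v$, $u\neq^?v$ ($D\subseteq\mathcal W$, $X\in\mathcal X^2$, $x\in\mathcal X$, $u,v$ messages). All constraint systems $\mathcal K=(\Phi;\mathcal S)$ are well-formed: each $x\in\mathrm{fv}^1(\mathcal K)\cap\mathcal X$ and each $X\in\mathrm{fv}^2(\mathcal K)$ occurs in a unique constraint $D\vdash^?_Xx$ of $\mathcal S$ (write $D_{\mathcal K}(X)=D$), and the relation "$x$ depends on $y$ iff $\mathcal S$ contains $D\vdash^?_Xx$ with $y\in\mathrm{fv}^1(\Phi(D))$" is acyclic. A solution is a substitution $\theta$ with $\mathrm{dom}(\theta)=\mathrm{fv}^2(\mathcal K)$ and $X\theta\in\mathcal T(D_{\mathcal K}(X))$ for all $X$, such that there is a ground substitution $\lambda$ with domain $\mathrm{fv}^1(\mathcal K)\cap\mathcal X$ satisfying $(X\theta)(\Phi\lambda)=_{\mathsf E}x\lambda$ for each $D\vdash^?_Xx$, $u\lambda=_{\mathsf E}v\lambda$ for each $u=^?v$, and $u\lambda\neq_{\mathsf E}v\lambda$ for each $u\neq^?v$.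 $\mathrm{Sol}(\mathcal K)$ is the set of solutions; $\lambda$ is unique modulo $\mathsf E$ and denoted $\lambda_\theta$. **Compressed symbolic semantics.** A symbolic process is $(\mathcal P;\Phi;\mathcal S)$ with $(\Phi;\mathcal S)$ a constraint system and $\mathrm{fv}^1(\mathcal P)\subseteq\mathrm{fv}^1(\mathcal S)\cap\mathcal X$. For basic $P$: $(\mathtt{in}(c,y).P;\Phi;\mathcal S)\overset{\mathtt{in}(c,X)}{\longmapsto}(P\{y\mapsto x\};\Phi;\mathcal S\cup\{\mathrm{dom}(\Phi)\vdash^?_Xx\})$, $X,x$ fresh; $(\mathtt{out}(c,u).P;\Phi;\mathcal S)\overset{\mathtt{out}(c,w)}{\longmapsto}(P;\Phi\cup\{w\triangleright u\};\mathcal S)$, $w$ fresh; $(\mathtt{if}\ u=v\ \mathtt{then}\ P\ \mathtt{else}\ Q;\Phi;\mathcal S)\overset{\tau}{\longmapsto}(P;\Phi;\mathcal S\cup\{u=^?v\})$ and $\overset{\tau}{\longmapsto}(Q;\Phi;\mathcal S\cup\{u\neq^?v\})$. Focused relations $\longmapsto_\ell$, $\ell\in\{i^+,i^*,o^*\}$, are the least with ($K,K',K''$ symbolic basic processes): (In) $K\overset{\mathtt{in}(c,X)}{\longmapsto}K'$ and $K'\overset{\mathrm{tr}}{\longmapsto}_{i^*}K''$ give $K\overset{\mathtt{in}(c,X)\cdot\mathrm{tr}}{\longmapsto}_\ell K''$ for $\ell\in\{i^*,i^+\}$; (Out) $K\overset{\mathtt{out}(c,w)}{\longmapsto}K'$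 and $K'\overset{\mathrm{tr}}{\longmapsto}_{o^*}K''$ give $K\overset{\mathtt{out}(c,w)\cdot\mathrm{tr}}{\longmapsto}_\ell K''$ for $\ell\in\{i^*,o^*\}$; (Tau) $K\overset{\tau}{\longmapsto}K'$ and $K'\overset{\mathrm{tr}}{\longmapsto}_\ell K''$ give $K\overset{\mathrm{tr}}{\longmapsto}_\ell K''$ for any $\ell$; (Proper) $(P;\Phi;\mathcal S)\overset{\epsilon}{\longmapsto}_{o^*}(P;\Phi;\mathcal S)$ if $P=0$ or $P=\mathtt{in}(c,x).P'$; (Improper) $(0;\Phi;\mathcal S)\overset{\epsilon}{\longmapsto}_{i^*}(\bot;\Phi;\mathcal S)$, $\bot$ a special symbol. $\longmapsto_{\mathrm c}$ is the least reflexive (label $\epsilon$) transitive (labels concatenate) relation such that if $(Q;\Phi;\mathcal S)\overset{\mathrm{tr}}{\longmapsto}_{i^+}(Q';\Phi';\mathcal S')$ then $(\{Q\}\uplus\mathcal P;\Phi;\mathcal S)\overset{\mathrm{tr}}{\longmapsto}_{\mathrm c}(\{Q'\}\uplus\mathcal P;\Phi';\mathcal S')$ when $Q'\neq\bot$, and $\overset{\mathrm{tr}}{\longmapsto}_{\mathrm c}(\varnothing;\Phi';\mathcal S')$ when $Q'=\bot$. **Dependency constraints and reduced semantics.** A dependency constraint is $\vec X\ltimes\vec w$ with $\vec X$ a vector over $\mathcal X^2$, $\vec w$ a vector over $\mathcal W$. $\theta\models\vec X\ltimes\vec w$ iff $\vec w$ is empty or there are $X_i\in\vec X$, $w_j\in\vec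 w$ with $w_j\in\mathrm{fv}^1(X_i\theta)$. A dependency constraint system $\mathcal K$ is a constraint system possibly also containing dependency constraints; $\mathcal K^\circ$ is $\mathcal K$ without them (required well-formed), and $\lambda_\theta$, $D_{\mathcal K}$ refer to $\mathcal K^\circ$. $\mathrm{Sol}^2(\mathcal K)$ is the set of $\theta\in\mathrm{Sol}(\mathcal K^\circ)$ satisfying ($\models$) every dependency constraint of $\mathcal K$. For $\mathcal K=(\Phi;\mathcal S)$, $\mathrm{Sol}^1(\mathcal K)$ is the set of $\theta\in\mathrm{Sol}(\mathcal K^\circ)$ such that for each $\vec X\ltimes\vec w$ in $\mathcal K$ with $\vec w$ non-empty there is $X_i\in\vec X$ such that every $M\in\mathcal T(D_{\mathcal K}(X_i))$ with $M(\Phi\lambda_\theta)=_{\mathsf E}(X_i\theta)(\Phi\lambda_\theta)$ satisfies $\mathrm{fv}^1(M)\cap\vec w\neq\varnothing$. Write $\mathtt{io}_c(\vec X,\vec w)$ for the block $\mathtt{in}(c,X_1)\cdots\mathtt{in}(c,X_\ell)\cdot\mathtt{out}(c,w_1)\cdots\mathtt{out}(c,w_k)$. Fix a (strict) total order $\prec$ on $\mathcal C$. For $\mathrm{tr}=\mathtt{io}_{c_1}(\vec X_1,\vec w_1)\cdots\mathtt{io}_{c_n}(\vec X_n,\vec w_n)$ and a channel $c$: if there is $k\le n$ with $c\prec c_k$ and $c_i\prec c$ for all $k<i\le n$, then $\mathrm{dep}(\mathrm{tr},c)$ is the set of handles occurring in $\vec w_k,\dots,\vec w_n$; otherwise $\mathrm{dep}(\mathrm{tr},c)=\varnothing$.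 $\longmapsto_d$ is the least reflexive relation such that if $(\mathcal P;\Phi;\varnothing)\overset{\mathrm{tr}}{\longmapsto}_d(\mathcal P';\Phi';\mathcal S')$ and $(\mathcal P';\Phi';\mathcal S')\overset{\mathtt{io}_c(\vec X,\vec w)}{\longmapsto}_{\mathrm c}(\mathcal P'';\Phi'';\mathcal S'')$ (one block, with at least one input) then $(\mathcal P;\Phi;\varnothing)\overset{\mathrm{tr}\cdot\mathtt{io}_c(\vec X,\vec w)}{\longmapsto}_d(\mathcal P'';\Phi'';\mathcal S''\cup\{\vec X\ltimes\mathrm{dep}(\mathrm{tr},c)\})$. **Reduced inclusions.** Let $j\in\{1,2\}$, $A=(\mathcal P;\Phi)$, $B=(\mathcal Q;\Psi)$. $A\sqsubseteq_d^jB$ iff whenever $(\mathcal P;\Phi;\varnothing)\overset{\mathrm{tr}}{\longmapsto}_d(\mathcal P';\Phi';\mathcal S_A)$ and $\theta\in\mathrm{Sol}^j(\Phi';\mathcal S_A)$, there is $(\mathcal Q;\Psi;\varnothing)\overset{\mathrm{tr}}{\longmapsto}_d(\mathcal Q';\Psi';\mathcal S_B)$ with $\theta\in\mathrm{Sol}^j(\Psi';\mathcal S_B)$ and $\Phi'\lambda^A_\theta\sim\Psi'\lambda^B_\theta$, where $\lambda^A_\theta,\lambda^B_\theta$ are the substitutions associated to $\theta$ in the respective systems. *)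

theory Defs
  imports "HOL-Library.Multiset"
begin

text \<open>
  Names, first-order variables and handles are three disjoint kinds of atoms. A signature is a set
  of pairs \<open>(f, n)\<close> of a function symbol and its arity.
\<close>

datatype ('n, 'x, 'w) atom = Name 'n | Var 'x | Handle 'w

datatype ('f, atoms: 'a) trm = At 'a | Fun 'f "('f, 'a) trm list"

type_synonym ('f, 'n, 'x, 'w) msg = "('f, ('n, 'x, 'w) atom) trm"

inductive_set terms :: "('f \<times> nat) set \<Rightarrow> 'a set \<Rightarrow> ('f, 'a) trm set"
  for Sig :: "('f \<times> nat) set" and S :: "'a set" where
  At: "a \<in> S \<Longrightarrow> At a \<in> terms Sig S"
| Fun: "(f, length ts) \<in> Sig \<Longrightarrow> (\<And>t. t \<in> set ts \<Longrightarrow> t \<in> terms Sig S) \<Longrightarrow> Fun f ts \<in> terms Sig S"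

definition messages :: "('f \<times> nat) set \<Rightarrow> ('f, 'n, 'x, 'w) msg set" where
  "messages Sig = terms Sig (range Name \<union> range Var)"

definition ground_terms :: "('f \<times> nat) set \<Rightarrow> ('f, 'n, 'x, 'w) msg set" where
  "ground_terms Sig = terms Sig (range Name)"

definition recipes :: "('f \<times> nat) set \<Rightarrow> 'w set \<Rightarrow> ('f, 'n, 'x, 'w) msg set" where
  "recipes Sig D = terms Sig (Handle ` D)"

definition vars :: "('f, 'n, 'x, 'w) msg \<Rightarrow> 'x set" where
  "vars t = {x. Var x \<in> atoms t}"

definition handles :: "('f, 'n, 'x, 'w) msg \<Rightarrow> 'w set" where
  "handles t = {w. Handle w \<in> atoms t}"

primrec subst :: "('a \<Rightarrow> ('f, 'a) trm) \<Rightarrow> ('f, 'a) trm \<Rightarrow> ('f, 'a) trm" where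
  "subst s (At a) = s a"
| "subst s (Fun f ts) = Fun f (map (subst s) ts)"

definition xsubst ::
  "('x \<rightharpoonup> ('f, 'n, 'x, 'w) msg) \<Rightarrow> ('f, 'n, 'x, 'w) msg \<Rightarrow> ('f, 'n, 'x, 'w) msg" where
  "xsubst l = subst (\<lambda>a. case a of Var x \<Rightarrow> (case l x of Some t \<Rightarrow> t | None \<Rightarrow> At a) | _ \<Rightarrow> At a)"

type_synonym ('f, 'n, 'x, 'w) frame = "'w \<rightharpoonup> ('f, 'n, 'x, 'w) msg"

definition hsubst ::
  "('f, 'n, 'x, 'w) frame \<Rightarrow> ('f, 'n, 'x, 'w) msg \<Rightarrow> ('f, 'n, 'x, 'w) msg" where
  "hsubst F = subst (\<lambda>a. case a of Handle w \<Rightarrow> (case F w of Some t \<Rightarrow> t | None \<Rightarrow> At a) | _ \<Rightarrow> At a)"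

definition inst_frame ::
  "('f, 'n, 'x, 'w) frame \<Rightarrow> ('x \<rightharpoonup> ('f, 'n, 'x, 'w) msg) \<Rightarrow> ('f, 'n, 'x, 'w) frame" where
  "inst_frame F l = (\<lambda>w. map_option (xsubst l) (F w))"

text \<open>
  The equational theory is given by a set \<open>E\<close> of equations; the induced congruence is the least
  congruence that contains all substitution instances of these equations.
\<close>

type_synonym ('f, 'n, 'x, 'w) eqs = "(('f, 'n, 'x, 'w) msg \<times> ('f, 'n, 'x, 'w) msg) set"

inductive eq_E ::
  "('f \<times> nat) set \<Rightarrow> ('f, 'n, 'x, 'w) eqs \<Rightarrow> ('f, 'n, 'x, 'w) msg \<Rightarrow> ('f, 'n, 'x, 'w) msg \<Rightarrow> bool"
  for Sig :: "('f \<times> nat) set" and E :: "('f, 'n, 'x, 'w) eqs" where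
  ax: "(s, t) \<in> E \<Longrightarrow> ran l \<subseteq> terms Sig UNIV \<Longrightarrow> eq_E Sig E (xsubst l s) (xsubst l t)"
| refl: "eq_E Sig E t t"
| sym: "eq_E Sig E s t \<Longrightarrow> eq_E Sig E t s"
| trans: "eq_E Sig E s t \<Longrightarrow> eq_E Sig E t u \<Longrightarrow> eq_E Sig E s u"
| cong: "eq_E Sig E s t \<Longrightarrow> eq_E Sig E (Fun f (us @ s # vs)) (Fun f (us @ t # vs))"

definition static_equiv ::
  "('f \<times> nat) set \<Rightarrow> ('f, 'n, 'x, 'w) eqs \<Rightarrow> ('f, 'n, 'x, 'w) frame \<Rightarrow> ('f, 'n, 'x, 'w) frame \<Rightarrow> bool"
  where
  "static_equiv Sig E F F' \<longleftrightarrow> dom F = dom F' \<and>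
     (\<forall>M \<in> recipes Sig (dom F). \<forall>N \<in> recipes Sig (dom F).
        eq_E Sig E (hsubst F M) (hsubst F N) \<longleftrightarrow> eq_E Sig E (hsubst F' M) (hsubst F' N))"

datatype ('c, 'f, 'n, 'x, 'w) proc =
    Null
  | If "('f, 'n, 'x, 'w) msg" "('f, 'n, 'x, 'w) msg"
       "('c, 'f, 'n, 'x, 'w) proc" "('c, 'f, 'n, 'x, 'w) proc"
  | In 'c 'x "('c, 'f, 'n, 'x, 'w) proc"
  | Out 'c "('f, 'n, 'x, 'w) msg" "('c, 'f, 'n, 'x, 'w) proc"

primrec basic :: "('f \<times> nat) set \<Rightarrow> 'c \<Rightarrow> ('c, 'f, 'n, 'x, 'w) proc \<Rightarrow> bool" where
  "basic Sig c Null \<longleftrightarrow> True"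
| "basic Sig c (If u v P Q) \<longleftrightarrow>
     u \<in> messages Sig \<and> v \<in> messages Sig \<and> basic Sig c P \<and> basic Sig c Q"
| "basic Sig c (In d x P) \<longleftrightarrow> d = c \<and> basic Sig c P"
| "basic Sig c (Out d u P) \<longleftrightarrow> d = c \<and> u \<in> messages Sig \<and> basic Sig c P"

primrec fv_proc :: "('c, 'f, 'n, 'x, 'w) proc \<Rightarrow> 'x set" where
  "fv_proc Null = {}"
| "fv_proc (If u v P Q) = vars u \<union> vars v \<union> fv_proc P \<union> fv_proc Q"
| "fv_proc (In c x P) = fv_proc P - {x}"
| "fv_proc (Out c u P) = vars u \<union> fv_proc P"

primrec allvars_proc :: "('c, 'f, 'n, 'x, 'w) proc \<Rightarrow> 'x set" where
  "allvars_proc Null = {}"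
| "allvars_proc (If u v P Q) = vars u \<union> vars v \<union> allvars_proc P \<union> allvars_proc Q"
| "allvars_proc (In c x P) = insert x (allvars_proc P)"
| "allvars_proc (Out c u P) = vars u \<union> allvars_proc P"

text \<open>
  Replaces the free occurrences of \<open>y\<close> by \<open>x\<close>. It is only used with an \<open>x\<close> that does not occur in
  the process, not even bound, so that no capture can happen.
\<close>

primrec rename_proc :: "'x \<Rightarrow> 'x \<Rightarrow> ('c, 'f, 'n, 'x, 'w) proc \<Rightarrow> ('c, 'f, 'n, 'x, 'w) proc" where
  "rename_proc y x Null = Null"
| "rename_proc y x (If u v P Q) =
     If (xsubst [y \<mapsto> At (Var x)] u) (xsubst [y \<mapsto> At (Var x)] v) (rename_proc y x P) (rename_proc y x Q)"
| "rename_proc y x (In c z P) = In c z (if z = y then P else rename_proc y x P)"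
| "rename_proc y x (Out c u P) = Out c (xsubst [y \<mapsto> At (Var x)] u) (rename_proc y x P)"

text \<open>
  The channel of a process without any input or output is not determined by its syntax, hence the
  assignment \<open>p\<close> of one basic process to each channel of a finite set \<open>C\<close>.
\<close>

definition simple_process :: "('f \<times> nat) set \<Rightarrow> ('c, 'f, 'n, 'x, 'w) proc multiset \<Rightarrow> bool" where
  "simple_process Sig PP \<longleftrightarrow>
     (\<exists>C p. finite C \<and> (\<forall>c \<in> C. basic Sig c (p c) \<and> p c \<noteq> Null) \<and> PP = image_mset p (mset_set C))"

type_synonym ('c, 'f, 'n, 'x, 'w) ext_process =
  "('c, 'f, 'n, 'x, 'w) proc multiset \<times> ('f, 'n, 'x, 'w) frame"

definition ext_simple_process :: "('f \<times> nat) set \<Rightarrow> ('c, 'f, 'n, 'x, 'w) ext_process \<Rightarrow> bool" where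
  "ext_simple_process Sig A \<longleftrightarrow> (case A of (PP, F) \<Rightarrow>
     simple_process Sig PP \<and> (\<forall>P \<in># PP. fv_proc P = {}) \<and>
     finite (dom F) \<and> ran F \<subseteq> ground_terms Sig)"

text \<open>
  The type variable \<open>'v\<close> stands for the second-order variables. In a dependency constraint
  \<open>Dep Xs W\<close>, only the set \<open>W\<close> of the handles of the second vector matters.
\<close>

datatype ('f, 'n, 'x, 'w, 'v) constr =
    Ded "'w set" 'v 'x
  | Eq "('f, 'n, 'x, 'w) msg" "('f, 'n, 'x, 'w) msg"
  | Neq "('f, 'n, 'x, 'w) msg" "('f, 'n, 'x, 'w) msg"
  | Dep "'v list" "'w set"

type_synonym ('f, 'n, 'x, 'w, 'v) csys =
  "('f, 'n, 'x, 'w) frame \<times> ('f, 'n, 'x, 'w, 'v) constr set"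

type_synonym ('f, 'n, 'x, 'w, 'v) soln = "'v \<rightharpoonup> ('f, 'n, 'x, 'w) msg"

primrec vars_constr :: "('f, 'n, 'x, 'w, 'v) constr \<Rightarrow> 'x set" where
  "vars_constr (Ded D X x) = {x}"
| "vars_constr (Eq u v) = vars u \<union> vars v"
| "vars_constr (Neq u v) = vars u \<union> vars v"
| "vars_constr (Dep Xs W) = {}"

primrec handles_constr :: "('f, 'n, 'x, 'w, 'v) constr \<Rightarrow> 'w set" where
  "handles_constr (Ded D X x) = D"
| "handles_constr (Eq u v) = handles u \<union> handles v"
| "handles_constr (Neq u v) = handles u \<union> handles v"
| "handles_constr (Dep Xs W) = W"

primrec vars2_constr :: "('f, 'n, 'x, 'w, 'v) constr \<Rightarrow> 'v set" where
  "vars2_constr (Ded D X x) = {X}"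
| "vars2_constr (Eq u v) = {}"
| "vars2_constr (Neq u v) = {}"
| "vars2_constr (Dep Xs W) = set Xs"

definition fv1_csys :: "('f, 'n, 'x, 'w, 'v) csys \<Rightarrow> 'x set" where
  "fv1_csys K = (\<Union>u \<in> ran (fst K). vars u) \<union> (\<Union>k \<in> snd K. vars_constr k)"

definition fv2_csys :: "('f, 'n, 'x, 'w, 'v) csys \<Rightarrow> 'v set" where
  "fv2_csys K = (\<Union>k \<in> snd K. vars2_constr k)"

definition handles_csys :: "('f, 'n, 'x, 'w, 'v) csys \<Rightarrow> 'w set" where
  "handles_csys K = dom (fst K) \<union> (\<Union>k \<in> snd K. handles_constr k)"

definition without_deps :: "('f, 'n, 'x, 'w, 'v) csys \<Rightarrow> ('f, 'n, 'x, 'w, 'v) csys" where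
  "without_deps K = (fst K, {k \<in> snd K. \<forall>Xs W. k \<noteq> Dep Xs W})"

definition depends_on :: "('f, 'n, 'x, 'w, 'v) csys \<Rightarrow> ('x \<times> 'x) set" where
  "depends_on K = {(x, y). \<exists>D X. Ded D X x \<in> snd K \<and> (\<exists>w \<in> D. \<exists>u. fst K w = Some u \<and> y \<in> vars u)}"

definition well_formed :: "('f, 'n, 'x, 'w, 'v) csys \<Rightarrow> bool" where
  "well_formed K \<longleftrightarrow>
     (\<forall>x \<in> fv1_csys K. \<exists>!(D, X). Ded D X x \<in> snd K) \<and>
     (\<forall>X \<in> fv2_csys K. \<exists>!(D, x). Ded D X x \<in> snd K) \<and>
     acyclic (depends_on K)"

definition ded_dom :: "('f, 'n, 'x, 'w, 'v) csys \<Rightarrow> 'v \<Rightarrow> 'w set" where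
  "ded_dom K X = (THE D. \<exists>x. Ded D X x \<in> snd K)"

text \<open>
  \<open>is_lambda Sig E K \<theta> l\<close>: the ground substitution \<open>l\<close> on the first-order variables of \<open>K\<close>
  satisfies the constraints of \<open>K\<close> under \<open>\<theta>\<close>.
\<close>

definition is_lambda ::
  "('f \<times> nat) set \<Rightarrow> ('f, 'n, 'x, 'w) eqs \<Rightarrow> ('f, 'n, 'x, 'w, 'v) csys \<Rightarrow> ('f, 'n, 'x, 'w, 'v) soln
   \<Rightarrow> ('x \<rightharpoonup> ('f, 'n, 'x, 'w) msg) \<Rightarrow> bool" where
  "is_lambda Sig E K \<theta> l \<longleftrightarrow>
     dom l = fv1_csys K \<and> ran l \<subseteq> ground_terms Sig \<and>
     (\<forall>D X x. Ded D X x \<in> snd K \<longrightarrow>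
        eq_E Sig E (hsubst (inst_frame (fst K) l) (the (\<theta> X))) (the (l x))) \<and>
     (\<forall>u v. Eq u v \<in> snd K \<longrightarrow> eq_E Sig E (xsubst l u) (xsubst l v)) \<and>
     (\<forall>u v. Neq u v \<in> snd K \<longrightarrow> \<not> eq_E Sig E (xsubst l u) (xsubst l v))"

text \<open>
  Every constraint system is required to be well-formed; since this is not part of the type of
  constraint systems, it is required of the systems whose solutions are considered. It holds for all
  systems that are reached from closed processes by the semantics below.
\<close>

definition Sol ::
  "('f \<times> nat) set \<Rightarrow> ('f, 'n, 'x, 'w) eqs \<Rightarrow> ('f, 'n, 'x, 'w, 'v) csys \<Rightarrow> ('f, 'n, 'x, 'w, 'v) soln set"
  where
  "Sol Sig E K = {\<theta>. well_formed K \<and> dom \<theta> = fv2_csys K \<and>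
     (\<forall>X \<in> fv2_csys K. the (\<theta> X) \<in> recipes Sig (ded_dom K X)) \<and> (\<exists>l. is_lambda Sig E K \<theta> l)}"

text \<open>The substitution associated to a solution: it is unique up to the equational theory.\<close>

definition lambda_of ::
  "('f \<times> nat) set \<Rightarrow> ('f, 'n, 'x, 'w) eqs \<Rightarrow> ('f, 'n, 'x, 'w, 'v) csys \<Rightarrow> ('f, 'n, 'x, 'w, 'v) soln
   \<Rightarrow> ('x \<rightharpoonup> ('f, 'n, 'x, 'w) msg)" where
  "lambda_of Sig E K \<theta> = (SOME l. is_lambda Sig E (without_deps K) \<theta> l)"

definition Sol2 ::
  "('f \<times> nat) set \<Rightarrow> ('f, 'n, 'x, 'w) eqs \<Rightarrow> ('f, 'n, 'x, 'w, 'v) csys \<Rightarrow> ('f, 'n, 'x, 'w, 'v) soln set"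
  where
  "Sol2 Sig E K = {\<theta> \<in> Sol Sig E (without_deps K).
     \<forall>Xs W. Dep Xs W \<in> snd K \<longrightarrow>
       W = {} \<or> (\<exists>X \<in> set Xs. \<exists>w \<in> W. w \<in> handles (the (\<theta> X)))}"

definition Sol1 ::
  "('f \<times> nat) set \<Rightarrow> ('f, 'n, 'x, 'w) eqs \<Rightarrow> ('f, 'n, 'x, 'w, 'v) csys \<Rightarrow> ('f, 'n, 'x, 'w, 'v) soln set"
  where
  "Sol1 Sig E K = {\<theta> \<in> Sol Sig E (without_deps K).
     \<forall>Xs W. Dep Xs W \<in> snd K \<and> W \<noteq> {} \<longrightarrow>
       (\<exists>X \<in> set Xs. \<forall>M \<in> recipes Sig (ded_dom (without_deps K) X).
          eq_E Sig E (hsubst (inst_frame (fst K) (lambda_of Sig E K \<theta>)) M)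
                     (hsubst (inst_frame (fst K) (lambda_of Sig E K \<theta>)) (the (\<theta> X)))
          \<longrightarrow> handles M \<inter> W \<noteq> {})}"

datatype ('c, 'w, 'v) act = AIn 'c 'v | AOut 'c 'w | Tau

type_synonym ('c, 'f, 'n, 'x, 'w, 'v) sym_basic =
  "('c, 'f, 'n, 'x, 'w) proc \<times> ('f, 'n, 'x, 'w) frame \<times> ('f, 'n, 'x, 'w, 'v) constr set"

text \<open>
  Freshness is required with respect to the basic process, the frame and the constraints. The free
  variables of the parallel components of a symbolic process occur in the constraints.
\<close>

inductive step ::
  "('c, 'f, 'n, 'x, 'w, 'v) sym_basic \<Rightarrow> ('c, 'w, 'v) act \<Rightarrow> ('c, 'f, 'n, 'x, 'w, 'v) sym_basic \<Rightarrow> bool"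
  where
  In: "x \<notin> allvars_proc (In c y P) \<union> fv1_csys (F, S) \<Longrightarrow> X \<notin> fv2_csys (F, S) \<Longrightarrow>
       step (In c y P, F, S) (AIn c X) (rename_proc y x P, F, insert (Ded (dom F) X x) S)"
| Out: "w \<notin> handles_csys (F, S) \<Longrightarrow> step (Out c u P, F, S) (AOut c w) (P, F(w \<mapsto> u), S)"
| Then: "step (If u v P Q, F, S) Tau (P, F, insert (Eq u v) S)"
| Else: "step (If u v P Q, F, S) Tau (Q, F, insert (Neq u v) S)"

datatype focus = IPlus | IStar | OStar

text \<open>The special symbol of improper blocks is represented by \<^term>\<open>None\<close>.\<close>

type_synonym ('c, 'f, 'n, 'x, 'w, 'v) sym_basic_bot =
  "('c, 'f, 'n, 'x, 'w) proc option \<times> ('f, 'n, 'x, 'w) frame \<times> ('f, 'n, 'x, 'w, 'v) constr set"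

inductive foc ::
  "focus \<Rightarrow> ('c, 'f, 'n, 'x, 'w, 'v) sym_basic \<Rightarrow> ('c, 'w, 'v) act list
   \<Rightarrow> ('c, 'f, 'n, 'x, 'w, 'v) sym_basic_bot \<Rightarrow> bool"
  where
  In: "step K (AIn c X) K' \<Longrightarrow> foc IStar K' tr K'' \<Longrightarrow> \<l> \<in> {IStar, IPlus} \<Longrightarrow>
       foc \<l> K (AIn c X # tr) K''"
| Out: "step K (AOut c w) K' \<Longrightarrow> foc OStar K' tr K'' \<Longrightarrow> \<l> \<in> {IStar, OStar} \<Longrightarrow>
       foc \<l> K (AOut c w # tr) K''"
| Tau: "step K Tau K' \<Longrightarrow> foc \<l> K' tr K'' \<Longrightarrow> foc \<l> K tr K''"
| Proper: "P = Null \<or> (\<exists>c x P'. P = In c x P') \<Longrightarrow> foc OStar (P, F, S) [] (Some P, F, S)"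
| Improper: "foc IStar (Null, F, S) [] (None, F, S)"

type_synonym ('c, 'f, 'n, 'x, 'w, 'v) sym_proc =
  "('c, 'f, 'n, 'x, 'w) proc multiset \<times> ('f, 'n, 'x, 'w) frame \<times> ('f, 'n, 'x, 'w, 'v) constr set"

text \<open>Null processes are removed from simple processes.\<close>

definition singl :: "('c, 'f, 'n, 'x, 'w) proc \<Rightarrow> ('c, 'f, 'n, 'x, 'w) proc multiset" where
  "singl P = (if P = Null then {#} else {#P#})"

inductive csem ::
  "('c, 'f, 'n, 'x, 'w, 'v) sym_proc \<Rightarrow> ('c, 'w, 'v) act list \<Rightarrow> ('c, 'f, 'n, 'x, 'w, 'v) sym_proc \<Rightarrow> bool"
  where
  refl: "csem K [] K"
| trans: "csem K tr K' \<Longrightarrow> csem K' tr' K'' \<Longrightarrow> csem K (tr @ tr') K''"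
| proper: "foc IPlus (Q, F, S) tr (Some Q', F', S') \<Longrightarrow>
     csem ({#Q#} + PP, F, S) tr (singl Q' + PP, F', S')"
| improper: "foc IPlus (Q, F, S) tr (None, F', S') \<Longrightarrow>
     csem ({#Q#} + PP, F, S) tr ({#}, F', S')"

type_synonym ('c, 'w, 'v) block = "'c \<times> 'v list \<times> 'w list"

definition io :: "('c, 'w, 'v) block \<Rightarrow> ('c, 'w, 'v) act list" where
  "io b = (case b of (c, Xs, ws) \<Rightarrow> map (AIn c) Xs @ map (AOut c) ws)"

text \<open>There is at most one position \<open>k\<close> as required by \<open>dep_pos\<close>.\<close>

definition dep_pos :: "('c::linorder, 'w, 'v) block list \<Rightarrow> 'c \<Rightarrow> nat \<Rightarrow> bool" where
  "dep_pos tr c k \<longleftrightarrow> k < length tr \<and> c < fst (tr ! k) \<and>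
     (\<forall>i. k < i \<and> i < length tr \<longrightarrow> fst (tr ! i) < c)"

definition dep :: "('c::linorder, 'w, 'v) block list \<Rightarrow> 'c \<Rightarrow> 'w set" where
  "dep tr c = (if \<exists>k. dep_pos tr c k
     then \<Union>(c', Xs, ws) \<in> set (drop (THE k. dep_pos tr c k) tr). set ws else {})"

text \<open>
  Traces are represented as lists of blocks. A block of an execution has at least one input, and
  only the last one may have no output, hence the sequence of actions determines the blocks.
\<close>

inductive red ::
  "('c::linorder, 'f, 'n, 'x, 'w, 'v) sym_proc \<Rightarrow> ('c, 'w, 'v) block list
   \<Rightarrow> ('c, 'f, 'n, 'x, 'w, 'v) sym_proc \<Rightarrow> bool"
  where
  refl: "red K [] K"
| block: "red (PP, F, {}) tr (PP', F', S') \<Longrightarrow>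
     csem (PP', F', S') (io (c, Xs, ws)) (PP'', F'', S'') \<Longrightarrow> Xs \<noteq> [] \<Longrightarrow>
     red (PP, F, {}) (tr @ [(c, Xs, ws)]) (PP'', F'', insert (Dep Xs (dep tr c)) S'')"

text \<open>
  The type argument fixes the type of second-order variables, which does not occur in the types of
  the processes.
\<close>

definition red_incl2 ::
  "'v itself \<Rightarrow> ('f \<times> nat) set \<Rightarrow> ('f, 'n, 'x, 'w) eqs
   \<Rightarrow> ('c::linorder, 'f, 'n, 'x, 'w) ext_process \<Rightarrow> ('c, 'f, 'n, 'x, 'w) ext_process \<Rightarrow> bool" where
  "red_incl2 V Sig E A B \<longleftrightarrow>
     (\<forall>(tr :: ('c, 'w, 'v) block list) PP' F' SA \<theta>.
        red (fst A, snd A, {}) tr (PP', F', SA) \<and> \<theta> \<in> Sol2 Sig E (F', SA) \<longrightarrow>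
        (\<exists>QQ' G' SB. red (fst B, snd B, {}) tr (QQ', G', SB) \<and> \<theta> \<in> Sol2 Sig E (G', SB) \<and>
           static_equiv Sig E (inst_frame F' (lambda_of Sig E (F', SA) \<theta>))
                              (inst_frame G' (lambda_of Sig E (G', SB) \<theta>))))"

definition red_incl1 ::
  "'v itself \<Rightarrow> ('f \<times> nat) set \<Rightarrow> ('f, 'n, 'x, 'w) eqs
   \<Rightarrow> ('c::linorder, 'f, 'n, 'x, 'w) ext_process \<Rightarrow> ('c, 'f, 'n, 'x, 'w) ext_process \<Rightarrow> bool" where
  "red_incl1 V Sig E A B \<longleftrightarrow>
     (\<forall>(tr :: ('c, 'w, 'v) block list) PP' F' SA \<theta>.
        red (fst A, snd A, {}) tr (PP', F', SA) \<and> \<theta> \<in> Sol1 Sig E (F', SA) \<longrightarrow>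
        (\<exists>QQ' G' SB. red (fst B, snd B, {}) tr (QQ', G', SB) \<and> \<theta> \<in> Sol1 Sig E (G', SB) \<and>
           static_equiv Sig E (inst_frame F' (lambda_of Sig E (F', SA) \<theta>))
                              (inst_frame G' (lambda_of Sig E (G', SB) \<theta>))))"

end

theory Submission
  imports Defs "HOL-Library.Sublist"
begin

text \<open>
  A solved symbolic execution amounts to a concrete one in which every channel process runs
  independently on its own blocks, reading the values of the recipes in the final frame: apart from
  the condition that a recipe only uses earlier handles, this does not depend on how blocks on
  different channels are interleaved. If a block violates its first-order dependency constraint,
  each of its inputs has a recipe that avoids the critical handles and computes the same message,
  so the block can be moved in front of the blocks that output them. This decreases the sequence of
  channels lexicographically. The minimal rearrangement satisfies all first-order constraints, the
  other process can follow it, and by static equivalence its run can be rearranged back and the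
  original recipes put in again. An improper block stays last, so instead of moving it one drops the
  blocks that it should precede; by determinism the run obtained for it fits onto the run obtained
  for the proper part of the trace.
\<close>

section \<open>Terms and substitutions\<close>

text \<open>Both inclusions are turned into one statement about concrete executions,
  \<open>conc_incl\<close>, which differs only in the condition put on the left executions. The
  right process needs no condition: second-order satisfaction depends only on the trace and the
  recipes, and first-order satisfaction is about equalities between recipes in the frame, which
  static equivalence preserves. As the first-order condition implies the second-order one, one
  implication merely restricts the executions to be matched; the work lies in removing the
  first-order condition. There the freedom to exchange recipes of equal value is exactly what that
  condition quantifies over, so a violated constraint hands over the recipes needed for the move.
  The obstacle is the improper block. It discards all parallel components, so no block may be moved
  behind it. Dropping blocks instead loses handles, and static equivalence then compares only
  smaller frames; the full frame has to come from a separate use of the hypothesis, for the trace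
  without the improper block.\<close>

lemma finite_atoms: "finite (atoms t)"
  by (induction t) auto

lemma finite_vars: "finite (vars t)"
proof -
  have "Var ` vars t \<subseteq> atoms t" by (auto simp: vars_def)
  then show ?thesis
    by (metis atom.inject(2) finite_atoms finite_imageD finite_subset inj_onI)
qed

lemma finite_allvars_proc: "finite (allvars_proc P)"
  by (induction P) (auto simp: finite_vars)

lemma subst_cong: "(\<And>a. a \<in> atoms t \<Longrightarrow> s a = s' a) \<Longrightarrow> subst s t = subst s' t"
  by (induction t) auto

lemma subst_subst: "subst s (subst s' t) = subst (\<lambda>a. subst s (s' a)) t"
  by (induction t) auto

lemma terms_subst:
  assumes "t \<in> terms Sig S" "\<And>a. a \<in> atoms t \<Longrightarrow> a \<in> S \<Longrightarrow> s a \<in> terms Sig S'"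
  shows "subst s t \<in> terms Sig S'"
  using assms
proof (induction t rule: terms.induct)
  case (Fun f ts)
  then have "t \<in> set ts \<Longrightarrow> subst s t \<in> terms Sig S'" for t by force
  then show ?case using Fun.hyps(1) by (auto intro!: terms.Fun)
qed auto

lemma terms_atoms: "t \<in> terms Sig S \<Longrightarrow> atoms t \<subseteq> S"
  by (induction t rule: terms.induct) auto

lemma terms_mono_atoms: "t \<in> terms Sig S \<Longrightarrow> atoms t \<subseteq> S' \<Longrightarrow> t \<in> terms Sig S'"
  by (induction t rule: terms.induct) (auto intro!: terms.intros)

lemma recipes_mono: "M \<in> recipes Sig D \<Longrightarrow> D \<subseteq> D' \<Longrightarrow> M \<in> recipes Sig D'"
  unfolding recipes_def using terms_atoms[of M Sig "Handle ` D"] terms_mono_atoms[of M Sig "Handle ` D"]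
  by blast

lemma recipes_handles: "M \<in> recipes Sig D \<Longrightarrow> handles M \<subseteq> D"
  using terms_atoms unfolding recipes_def handles_def by blast

lemma recipes_restrict:
  assumes "M \<in> recipes Sig D" "handles M \<inter> W = {}" "D \<subseteq> D' \<union> W"
  shows "M \<in> recipes Sig D'"
proof -
  have "atoms M \<subseteq> Handle ` D" using assms(1) terms_atoms unfolding recipes_def by blast
  then have "atoms M \<subseteq> Handle ` D'" using assms(2,3) unfolding handles_def by blast
  then show ?thesis using assms(1) terms_mono_atoms unfolding recipes_def by blast
qed

lemma hsubst_eq:
  assumes "\<And>w. w \<in> handles M \<Longrightarrow> F w = F' w"
  shows "hsubst F M = hsubst F' M"
  unfolding hsubst_def
  by (rule subst_cong) (use assms in \<open>auto simp: handles_def split: atom.split\<close>)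

lemma hsubst_ground:
  assumes "M \<in> recipes Sig D" "D \<subseteq> dom F" "ran F \<subseteq> ground_terms Sig"
  shows "hsubst F M \<in> ground_terms Sig"
proof -
  have "subst (\<lambda>a. case a of Handle w \<Rightarrow> (case F w of Some t \<Rightarrow> t | None \<Rightarrow> At a) | _ \<Rightarrow> At a) M
      \<in> terms Sig (range Name)"
  proof (rule terms_subst[OF assms(1)[unfolded recipes_def]])
    fix a :: "('b, 'c, 'd) atom" assume "a \<in> Handle ` D"
    then obtain w t where "a = Handle w" "F w = Some t" using assms(2) by blast
    then show "(case a of Handle w \<Rightarrow> (case F w of Some t \<Rightarrow> t | None \<Rightarrow> At a) | _ \<Rightarrow> At a)
        \<in> terms Sig (range Name)"
      using assms(3) by (auto simp: ground_terms_def ran_def)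
  qed
  then show ?thesis by (simp add: hsubst_def ground_terms_def)
qed

lemma xsubst_eq:
  assumes "\<And>x. x \<in> vars u \<Longrightarrow> l x = l' x"
  shows "xsubst l u = xsubst l' u"
  unfolding xsubst_def
  by (rule subst_cong) (use assms in \<open>auto simp: vars_def split: atom.split\<close>)

lemma xsubst_rename:
  assumes "l x = Some t" "x \<notin> vars u"
  shows "xsubst l (xsubst [y \<mapsto> At (Var x)] u) = xsubst (l(y \<mapsto> t)) u"
  unfolding xsubst_def subst_subst
  by (rule subst_cong) (use assms in \<open>auto simp: vars_def split: atom.split option.split\<close>)

lemma xsubst_ground:
  assumes "u \<in> messages Sig" "vars u \<subseteq> dom l" "ran l \<subseteq> ground_terms Sig"
  shows "xsubst l u \<in> ground_terms Sig"
  unfolding xsubst_def ground_terms_def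
proof (rule terms_subst[OF assms(1)[unfolded messages_def]])
  fix a :: "('b, 'c, 'd) atom" assume a: "a \<in> atoms u" "a \<in> range Name \<union> range Var"
  show "(case a of Var x \<Rightarrow> (case l x of Some t \<Rightarrow> t | None \<Rightarrow> At a) | _ \<Rightarrow> At a)
      \<in> terms Sig (range Name)"
  proof (cases a)
    case (Name n)
    then show ?thesis by (auto intro: terms.At)
  next
    case (Var x)
    then have "x \<in> dom l" using a assms(2) by (auto simp: vars_def)
    then show ?thesis using Var assms(3) by (auto simp: ground_terms_def ran_def)
  qed (use a in auto)
qed

lemma rename_messages:
  assumes "u \<in> messages Sig"
  shows "xsubst [y \<mapsto> At (Var x)] u \<in> messages Sig"
  unfolding xsubst_def messages_def
  by (rule terms_subst[OF assms[unfolded messages_def]])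
    (auto intro!: terms.At split: option.splits)

lemma atoms_subst: "atoms (subst s t) = (\<Union>a \<in> atoms t. atoms (s a))"
  by (induction t) auto

lemma vars_rename:
  fixes u :: "('f, 'n, 'x, 'w) msg"
  shows "vars (xsubst [y \<mapsto> At (Var x)] u) \<subseteq> (vars u - {y}) \<union> {x}"
proof
  fix z assume "z \<in> vars (xsubst [y \<mapsto> At (Var x)] u)"
  then obtain a where a: "a \<in> atoms u"
    "Var z \<in> atoms (case a of Var v \<Rightarrow> (case [y \<mapsto> At (Var x) :: ('f, 'n, 'x, 'w) msg] v of Some t \<Rightarrow> t | None \<Rightarrow> At a) | _ \<Rightarrow> At a)"
    by (auto simp: xsubst_def vars_def atoms_subst)
  show "z \<in> (vars u - {y}) \<union> {x}"
    by (insert a, cases a) (auto simp: vars_def split: if_splits)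
qed

lemma handles_messages: "u \<in> messages Sig \<Longrightarrow> handles u = {}"
  using terms_atoms unfolding messages_def handles_def by blast

lemma fv_rename_proc: "fv_proc (rename_proc y x P) \<subseteq> (fv_proc P - {y}) \<union> {x}"
proof (induction P)
  case (If u v P Q)
  then show ?case using vars_rename[of y x u] vars_rename[of y x v] by simp blast
next
  case (Out c u P)
  then show ?case using vars_rename[of y x u] by simp blast
qed auto

lemma allvars_rename_proc: "allvars_proc (rename_proc y x P) \<subseteq> insert x (allvars_proc P)"
  by (induction P) (auto dest!: vars_rename[THEN subsetD])

lemma basic_rename_proc: "basic Sig c P \<Longrightarrow> basic Sig c (rename_proc y x P)"
  by (induction P) (auto simp: rename_messages)

text \<open>A cycle through \<open>x\<close> would need an edge into \<open>x\<close>, and there is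
  none. In the application \<open>x\<close> is the variable of a new input: it depends on the
  variables of the current frame, while nothing depends on it yet.\<close>

lemma acyclic_fresh_source:
  assumes "acyclic r" "x \<notin> Range r" "x \<notin> Y"
  shows "acyclic (r \<union> {x} \<times> Y)"
proof -
  have "(a, b) \<in> (r \<union> {x} \<times> Y)\<^sup>+ \<Longrightarrow> b \<noteq> x \<and> (a = x \<or> (a, b) \<in> r\<^sup>+)" for a b
  proof (induction rule: trancl_induct)
    case (base b)
    then show ?case using assms by auto
  next
    case (step b c)
    then show ?case using assms by (auto intro: trancl_into_trancl)
  qed
  then show ?thesis using assms(1) unfolding acyclic_def by blast
qed

section \<open>Inputs and outputs of action sequences and traces\<close>

definition acts_ins :: "('c, 'w, 'v) act list \<Rightarrow> 'v set" where
  "acts_ins tr = {X. \<exists>c. AIn c X \<in> set tr}"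

definition acts_outs :: "('c, 'w, 'v) act list \<Rightarrow> 'w set" where
  "acts_outs tr = {w. \<exists>c. AOut c w \<in> set tr}"

lemma acts_simps [simp]:
  "acts_ins [] = {}" "acts_outs [] = {}"
  "acts_ins (AIn c X # tr) = insert X (acts_ins tr)" "acts_outs (AIn c X # tr) = acts_outs tr"
  "acts_ins (AOut c w # tr) = acts_ins tr" "acts_outs (AOut c w # tr) = insert w (acts_outs tr)"
  by (auto simp: acts_ins_def acts_outs_def)

abbreviation ins :: "('c, 'w, 'v) block \<Rightarrow> 'v list" where "ins b \<equiv> fst (snd b)"
abbreviation outs :: "('c, 'w, 'v) block \<Rightarrow> 'w list" where "outs b \<equiv> snd (snd b)"

definition tr_ins :: "('c, 'w, 'v) block list \<Rightarrow> 'v set" where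
  "tr_ins tr = (\<Union>b \<in> set tr. set (ins b))"

definition tr_outs :: "('c, 'w, 'v) block list \<Rightarrow> 'w set" where
  "tr_outs tr = (\<Union>b \<in> set tr. set (outs b))"

lemma tr_simps [simp]:
  "tr_ins [] = {}" "tr_outs [] = {}"
  "tr_ins (b # tr) = set (ins b) \<union> tr_ins tr" "tr_outs (b # tr) = set (outs b) \<union> tr_outs tr"
  "tr_ins (tr @ tr') = tr_ins tr \<union> tr_ins tr'" "tr_outs (tr @ tr') = tr_outs tr \<union> tr_outs tr'"
  by (auto simp: tr_ins_def tr_outs_def)

lemma acts_io: "acts_ins (io b) = set (ins b)" "acts_outs (io b) = set (outs b)"
  by (cases b; auto simp: acts_ins_def acts_outs_def io_def)+

section \<open>Traces\<close>

lemma restrict_map_superset: "dom f \<subseteq> D \<Longrightarrow> f |` D = f"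
  by (rule ext) (metis (no_types) domIff restrict_in restrict_out subsetD)

definition chan :: "'c \<Rightarrow> ('c, 'w, 'v) block list \<Rightarrow> ('c, 'w, 'v) block list" where
  "chan c tr = filter (\<lambda>b. fst b = c) tr"

lemma chan_simps [simp]:
  "chan c [] = []" "chan c (b # tr) = (if fst b = c then b # chan c tr else chan c tr)"
  "chan c (tr @ tr') = chan c tr @ chan c tr'"
  by (simp_all add: chan_def)

lemma chan_empty: "c \<notin> fst ` set tr \<Longrightarrow> chan c tr = []"
  by (induction tr) auto

lemma set_chan: "b \<in> set tr \<longleftrightarrow> b \<in> set (chan (fst b) tr)"
  by (simp add: chan_def)

lemma chan_subset: "set (chan c tr) \<subseteq> set tr"
  by (auto simp: chan_def)

lemma tr_ins_mono: "set s \<subseteq> set s' \<Longrightarrow> tr_ins s \<subseteq> tr_ins s'"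
  by (auto simp: tr_ins_def)

lemma tr_outs_mono: "set s \<subseteq> set s' \<Longrightarrow> tr_outs s \<subseteq> tr_outs s'"
  by (auto simp: tr_outs_def)

lemma prefix_chan_subset:
  assumes "\<And>c. prefix (chan c s) (chan c s')"
  shows "set s \<subseteq> set s'"
proof
  fix b assume "b \<in> set s"
  then have "b \<in> set (chan (fst b) s)" using set_chan by fastforce
  then have "b \<in> set (chan (fst b) s')" using assms set_mono_prefix by blast
  then show "b \<in> set s'" using set_chan by fastforce
qed

lemma tr_ins_chan: "X \<in> tr_ins (chan c s) \<Longrightarrow> X \<in> tr_ins s"
  using tr_ins_mono[OF chan_subset, of c s] by blast

lemma tr_outs_chan: "w \<in> tr_outs (chan c s) \<Longrightarrow> w \<in> tr_outs s"
  using tr_outs_mono[OF chan_subset, of c s] by blast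

text \<open>The conditions that an execution imposes on its labels, gathered without reference to an
  execution. Outputs are demanded on \<open>butlast\<close> only, because an improper block may end
  a trace but cannot be followed by another block.\<close>

definition wf_tr :: "'w set \<Rightarrow> ('c, 'w, 'v) block list \<Rightarrow> bool" where
  "wf_tr D tr \<longleftrightarrow> distinct (concat (map ins tr)) \<and> distinct (concat (map outs tr)) \<and>
     tr_outs tr \<inter> D = {} \<and> (\<forall>b \<in> set tr. ins b \<noteq> []) \<and> (\<forall>b \<in> set (butlast tr). outs b \<noteq> [])"

lemma set_concat_ins: "set (concat (map ins tr)) = tr_ins tr"
  by (auto simp: tr_ins_def)

lemma set_concat_outs: "set (concat (map outs tr)) = tr_outs tr"
  by (auto simp: tr_outs_def)

lemma wf_tr_move:
  assumes wf: "wf_tr D (a @ g @ b # s)" and b: "outs b \<noteq> []"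
  shows "wf_tr D (a @ b # g @ s)"
proof -
  have "mset (concat (map f (a @ b # g @ s))) = mset (concat (map f (a @ g @ b # s)))"
    for f :: "_ \<Rightarrow> 'z list" by simp
  then have d: "distinct (concat (map f (a @ b # g @ s))) = distinct (concat (map f (a @ g @ b # s)))"
    for f :: "_ \<Rightarrow> 'z list" by (rule mset_eq_imp_distinct_iff)
  \<comment> \<open>\<open>b\<close> may have been the last block, where empty outputs are allowed,
    and may now be an inner one; this is why its outputs must be non-empty.\<close>
  have "set (butlast (a @ b # g @ s)) \<subseteq> insert b (set (butlast (a @ g @ b # s)))"
    by (auto simp: butlast_append dest: in_set_butlastD)
  then have "\<forall>x \<in> set (butlast (a @ b # g @ s)). outs x \<noteq> []"
    using wf b unfolding wf_tr_def by blast
  moreover have "tr_outs (a @ b # g @ s) = tr_outs (a @ g @ b # s)"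
    "set (a @ b # g @ s) = set (a @ g @ b # s)" by auto
  ultimately show ?thesis using wf unfolding wf_tr_def d by simp
qed

lemma wf_tr_drop:
  assumes "wf_tr D (a @ g @ [b])"
  shows "wf_tr D (a @ [b])"
  using assms unfolding wf_tr_def by (auto simp: butlast_append)

text \<open>\<open>y\<close> is the block at the position of \<open>dep_pos\<close>. Its channel
  lies above \<open>c\<close> and all later ones lie below, so none of them equals \<open>c\<close>:
  a following block on \<open>c\<close> can be exchanged with the whole segment that outputs the
  critical handles without reordering its own channel.\<close>

lemma dep_split:
  assumes "dep tr c \<noteq> {}"
  obtains s1 y s2 where "tr = s1 @ y # s2" "c < fst y" "c \<notin> fst ` set (y # s2)"
    "dep tr c = tr_outs (y # s2)"
proof -
  obtain k where k: "dep_pos tr c k" using assms unfolding dep_def by metis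
  \<comment> \<open>Of two such positions, the later one would have a channel both above and below
    \<open>c\<close>.\<close>
  have "k' = k" if "dep_pos tr c k'" for k'
    using k that unfolding dep_pos_def by (metis linorder_neqE_nat order_less_asym)
  then have "(THE k. dep_pos tr c k) = k" using k by blast
  then have "dep tr c = tr_outs (drop k tr)"
    using k by (auto simp: dep_def tr_outs_def case_prod_unfold)
  moreover have d: "drop k tr = tr ! k # drop (Suc k) tr" "tr = take k tr @ tr ! k # drop (Suc k) tr"
    using k unfolding dep_pos_def by (simp_all add: Cons_nth_drop_Suc id_take_nth_drop)
  moreover have "c \<notin> fst ` set (drop (Suc k) tr)"
  proof
    assume "c \<in> fst ` set (drop (Suc k) tr)"
    then obtain i where "i < length (drop (Suc k) tr)" "c = fst (drop (Suc k) tr ! i)"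
      by (auto simp: in_set_conv_nth)
    then show False using k unfolding dep_pos_def by (auto simp: dest!: spec[of _ "Suc k + i"])
  qed
  moreover have "c < fst (tr ! k)" using k unfolding dep_pos_def by blast
  ultimately show ?thesis
    by (intro that[of "take k tr" "tr ! k" "drop (Suc k) tr"]) auto
qed

lemma dep_subset: "dep tr c \<subseteq> tr_outs tr"
  by (cases "dep tr c = {}") (auto elim!: dep_split)

section \<open>Symbolic executions\<close>

definition ded1 :: "('f, 'n, 'x, 'w, 'v) constr set \<Rightarrow> 'x set" where
  "ded1 S = {x. \<exists>D X. Ded D X x \<in> S}"

definition ded2 :: "('f, 'n, 'x, 'w, 'v) constr set \<Rightarrow> 'v set" where
  "ded2 S = {X. \<exists>D x. Ded D X x \<in> S}"

lemma ded_insert [simp]: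
  "ded1 (insert (Ded D X x) S) = insert x (ded1 S)" "ded2 (insert (Ded D X x) S) = insert X (ded2 S)"
  "ded1 (insert (Eq u v) S) = ded1 S" "ded2 (insert (Eq u v) S) = ded2 S"
  "ded1 (insert (Neq u v) S) = ded1 S" "ded2 (insert (Neq u v) S) = ded2 S"
  "ded1 (insert (Dep Xs W) S) = ded1 S" "ded2 (insert (Dep Xs W) S) = ded2 S"
  by (auto simp: ded1_def ded2_def)

lemma ded_empty [simp]: "ded1 {} = {}" "ded2 {} = {}"
  by (simp_all add: ded1_def ded2_def)

lemma csys_insert [simp]:
  "fv1_csys (F, insert k S) = vars_constr k \<union> fv1_csys (F, S)"
  "fv2_csys (F, insert k S) = vars2_constr k \<union> fv2_csys (F, S)"
  "handles_csys (F, insert k S) = handles_constr k \<union> handles_csys (F, S)"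
  by (auto simp: fv1_csys_def fv2_csys_def handles_csys_def)

lemma depends_on_insert [simp]:
  "depends_on (F, insert (Eq u v) S) = depends_on (F, S)"
  "depends_on (F, insert (Neq u v) S) = depends_on (F, S)"
  "depends_on (F, insert (Dep Xs W) S) = depends_on (F, S)"
  by (auto simp: depends_on_def)

lemma depends_on_Ded:
  "depends_on (F, insert (Ded (dom F) X x) S) =
     depends_on (F, S) \<union> {x} \<times> (\<Union>u \<in> ran F. vars u)"
  by (auto simp: depends_on_def ran_def)

text \<open>Stronger than well-formedness in order to be inductive: every handle in a constraint
  belongs to the frame, hence a handle outside \<open>dom F\<close> is fresh for the whole system;
  and uniqueness of deducibility constraints is stated by pairs, a form that survives the insertion
  of a fresh one.\<close>

definition csys_inv ::
  "('f \<times> nat) set \<Rightarrow> ('f, 'n, 'x, 'w) frame \<Rightarrow> ('f, 'n, 'x, 'w, 'v) constr set \<Rightarrow> bool" where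
  "csys_inv Sig F S \<longleftrightarrow> fv1_csys (F, S) \<subseteq> ded1 S \<and> fv2_csys (F, S) \<subseteq> ded2 S \<and>
     (\<forall>D X x D' X' x'. Ded D X x \<in> S \<longrightarrow> Ded D' X' x' \<in> S \<longrightarrow> X = X' \<or> x = x' \<longrightarrow>
        D = D' \<and> X = X' \<and> x = x') \<and>
     acyclic (depends_on (F, S)) \<and> handles_csys (F, S) \<subseteq> dom F \<and> ran F \<subseteq> messages Sig"

lemma csys_inv_Ded:
  assumes inv: "csys_inv Sig F S" and x: "x \<notin> fv1_csys (F, S)" and X: "X \<notin> fv2_csys (F, S)"
  shows "csys_inv Sig F (insert (Ded (dom F) X x) S)"
proof -
  have x': "x \<notin> ded1 S" and X': "X \<notin> ded2 S"
    using x X by (force simp: ded1_def ded2_def fv1_csys_def fv2_csys_def)+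
  have "acyclic (depends_on (F, S) \<union> {x} \<times> (\<Union>u \<in> ran F. vars u))"
  proof (rule acyclic_fresh_source)
    show "x \<notin> Range (depends_on (F, S))"
      using x by (auto simp: depends_on_def fv1_csys_def ran_def)
    show "x \<notin> (\<Union>u \<in> ran F. vars u)" using x by (auto simp: fv1_csys_def)
  qed (use inv in \<open>simp add: csys_inv_def\<close>)
  then have ac: "acyclic (depends_on (F, insert (Ded (dom F) X x) S))" unfolding depends_on_Ded .
  have uniq: "\<forall>D X1 x1 D' X2 x2. Ded D X1 x1 \<in> insert (Ded (dom F) X x) S \<longrightarrow>
      Ded D' X2 x2 \<in> insert (Ded (dom F) X x) S \<longrightarrow> X1 = X2 \<or> x1 = x2 \<longrightarrow>
      D = D' \<and> X1 = X2 \<and> x1 = x2"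
    using inv x' X' unfolding csys_inv_def ded1_def ded2_def by blast
  have i: "fv1_csys (F, S) \<subseteq> ded1 S" "fv2_csys (F, S) \<subseteq> ded2 S" "handles_csys (F, S) \<subseteq> dom F"
    "ran F \<subseteq> messages Sig"
    using inv unfolding csys_inv_def by blast+
  then have "vars_constr (Ded (dom F) X x) \<union> fv1_csys (F, S) \<subseteq> insert x (ded1 S)"
    "vars2_constr (Ded (dom F) X x) \<union> fv2_csys (F, S) \<subseteq> insert X (ded2 S)"
    "handles_constr (Ded (dom F) X x) \<union> handles_csys (F, S) \<subseteq> dom F" by auto
  then show ?thesis unfolding csys_inv_def csys_insert ded_insert
    by (intro conjI ac uniq i(4))
qed

lemma csys_inv_Out:
  assumes inv: "csys_inv Sig F S" and w: "w \<notin> handles_csys (F, S)"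
    and u: "u \<in> messages Sig" "vars u \<subseteq> ded1 S"
  shows "csys_inv Sig (F(w \<mapsto> u)) S"
proof -
  have F: "F w = None" using w by (auto simp: handles_csys_def)
  then have ran: "ran (F(w \<mapsto> u)) = insert u (ran F)" by (rule ran_map_upd)
  \<comment> \<open>The new handle occurs in no earlier deducibility constraint, so its message adds
    no dependency between variables.\<close>
  have D: "w \<notin> D" if "Ded D X x \<in> S" for D X x
    using w that by (force simp: handles_csys_def)
  have "(\<exists>v \<in> D. \<exists>t. (F(w \<mapsto> u)) v = Some t \<and> y \<in> vars t) \<longleftrightarrow>
      (\<exists>v \<in> D. \<exists>t. F v = Some t \<and> y \<in> vars t)" if "Ded D X x \<in> S" for D X x y
    using D[OF that] by (intro bex_cong) auto
  then have "depends_on (F(w \<mapsto> u), S) = depends_on (F, S)"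
    unfolding depends_on_def fst_conv snd_conv by blast
  moreover have "fv1_csys (F(w \<mapsto> u), S) = vars u \<union> fv1_csys (F, S)"
    "fv2_csys (F(w \<mapsto> u), S) = fv2_csys (F, S)"
    "handles_csys (F(w \<mapsto> u), S) = insert w (handles_csys (F, S))"
    unfolding fv1_csys_def fv2_csys_def handles_csys_def by (auto simp: ran)
  ultimately show ?thesis
    using inv u unfolding csys_inv_def ran by (simp add: le_supI1 subset_insertI2)
qed

lemma csys_inv_cond:
  assumes "csys_inv Sig F S" "u \<in> messages Sig" "v \<in> messages Sig" "vars u \<union> vars v \<subseteq> ded1 S"
  shows "csys_inv Sig F (insert (Eq u v) S)" "csys_inv Sig F (insert (Neq u v) S)"
  using assms handles_messages[of u] handles_messages[of v] by (auto simp: csys_inv_def)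

lemma csys_inv_Dep:
  assumes "csys_inv Sig F S" "set Xs \<subseteq> ded2 S" "W \<subseteq> dom F"
  shows "csys_inv Sig F (insert (Dep Xs W) S)"
  using assms by (auto simp: csys_inv_def)

lemma csys_inv_fv1: "csys_inv Sig F S \<Longrightarrow> fv1_csys (without_deps (F, S)) = ded1 S"
proof
  assume inv: "csys_inv Sig F S"
  have "fv1_csys (without_deps (F, S)) \<subseteq> fv1_csys (F, S)"
    by (auto simp: fv1_csys_def without_deps_def)
  then show "fv1_csys (without_deps (F, S)) \<subseteq> ded1 S" using inv by (auto simp: csys_inv_def)
  show "ded1 S \<subseteq> fv1_csys (without_deps (F, S))"
    by (force simp: fv1_csys_def without_deps_def ded1_def)
qed

lemma csys_inv_fv2: "csys_inv Sig F S \<Longrightarrow> fv2_csys (without_deps (F, S)) = ded2 S"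
proof
  assume inv: "csys_inv Sig F S"
  have "fv2_csys (without_deps (F, S)) \<subseteq> fv2_csys (F, S)"
    by (auto simp: fv2_csys_def without_deps_def)
  then show "fv2_csys (without_deps (F, S)) \<subseteq> ded2 S" using inv by (auto simp: csys_inv_def)
  show "ded2 S \<subseteq> fv2_csys (without_deps (F, S))"
    by (force simp: fv2_csys_def without_deps_def ded2_def)
qed

lemma without_deps_Ded [simp]:
  "Ded D X x \<in> snd (without_deps (F, S)) \<longleftrightarrow> Ded D X x \<in> S"
  "Eq u v \<in> snd (without_deps (F, S)) \<longleftrightarrow> Eq u v \<in> S"
  "Neq u v \<in> snd (without_deps (F, S)) \<longleftrightarrow> Neq u v \<in> S"
  "fst (without_deps (F, S)) = F"
  by (auto simp: without_deps_def)

lemma csys_inv_unique: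
  assumes "csys_inv Sig F S" "Ded D X x \<in> S" "Ded D' X' x' \<in> S" "X = X' \<or> x = x'"
  shows "D = D' \<and> X = X' \<and> x = x'"
  using assms unfolding csys_inv_def by blast

lemma csys_inv_ded_dom:
  assumes "csys_inv Sig F S" "Ded D X x \<in> S"
  shows "ded_dom (without_deps (F, S)) X = D"
  unfolding ded_dom_def
proof (rule the_equality)
  show "\<exists>x. Ded D X x \<in> snd (without_deps (F, S))" using assms(2) by auto
  fix D' assume "\<exists>x. Ded D' X x \<in> snd (without_deps (F, S))"
  then show "D' = D" using csys_inv_unique[OF assms(1) assms(2)] by auto
qed

lemma csys_inv_well_formed:
  assumes inv: "csys_inv Sig F S"
  shows "well_formed (without_deps (F, S))"
proof -
  note uniq = csys_inv_unique[OF inv]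
  have "\<exists>!(D, X). Ded D X x \<in> S" if "x \<in> ded1 S" for x
  proof -
    from that obtain D X where "Ded D X x \<in> S" unfolding ded1_def by blast
    then show ?thesis by (intro ex1I[of _ "(D, X)"]) (auto dest: uniq)
  qed
  moreover have "\<exists>!(D, x). Ded D X x \<in> S" if "X \<in> ded2 S" for X
  proof -
    from that obtain D x where "Ded D X x \<in> S" unfolding ded2_def by blast
    then show ?thesis by (intro ex1I[of _ "(D, x)"]) (auto dest: uniq)
  qed
  moreover have "depends_on (without_deps (F, S)) = depends_on (F, S)"
    by (simp add: depends_on_def)
  ultimately show ?thesis
    using inv by (simp add: well_formed_def csys_inv_fv1[OF inv] csys_inv_fv2[OF inv] csys_inv_def)
qed

lemma step_inv:
  assumes "step (P, F, S) a (P', F', S')" "csys_inv Sig F S" "basic Sig c P" "fv_proc P \<subseteq> ded1 S"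
  shows "csys_inv Sig F' S' \<and> basic Sig c P' \<and> fv_proc P' \<subseteq> ded1 S'"
  using assms
proof (cases rule: step.cases)
  case (In x d y P1 X)
  then show ?thesis
    using assms csys_inv_Ded[of Sig F S x X] basic_rename_proc[of Sig c P1 y x] fv_rename_proc[of y x P1]
    by auto
next
  case (Out w d u)
  then show ?thesis using assms csys_inv_Out[of Sig F S w u] by auto
next
  case (Then u v Q)
  then show ?thesis using assms csys_inv_cond(1)[of Sig F S u v] by auto
next
  case (Else u v Q)
  then show ?thesis using assms csys_inv_cond(2)[of Sig F S u v] by auto
qed

lemma foc_inv:
  assumes "foc \<l> (P, F, S) tr (Q, F', S')" "csys_inv Sig F S" "basic Sig c P" "fv_proc P \<subseteq> ded1 S"
  shows "csys_inv Sig F' S' \<and> (\<forall>Q'. Q = Some Q' \<longrightarrow> basic Sig c Q' \<and> fv_proc Q' \<subseteq> ded1 S')"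
  using assms
proof (induction \<l> "(P, F, S)" tr "(Q, F', S')" arbitrary: P F S rule: foc.induct)
  case (In c' X K' tr \<l> P F S)
  obtain P1 F1 S1 where K: "K' = (P1, F1, S1)" by (cases K')
  show ?case using In.hyps(3)[OF K] step_inv[OF In.hyps(1)[unfolded K] In.prems] by simp
next
  case (Out c' w K' tr \<l> P F S)
  obtain P1 F1 S1 where K: "K' = (P1, F1, S1)" by (cases K')
  show ?case using Out.hyps(3)[OF K] step_inv[OF Out.hyps(1)[unfolded K] Out.prems] by simp
next
  case (Tau K' \<l> tr P F S)
  obtain P1 F1 S1 where K: "K' = (P1, F1, S1)" by (cases K')
  show ?case using Tau.hyps(3)[OF K] step_inv[OF Tau.hyps(1)[unfolded K] Tau.prems] by simp
qed auto

lemma step_basic: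
  assumes "step (P, F, S) a (P', F', S')" "basic Sig c P"
  shows "basic Sig c P' \<and> (\<forall>d X. a = AIn d X \<longrightarrow> d = c)"
  using assms by cases (auto simp: basic_rename_proc)

lemma foc_basic:
  assumes "foc \<l> (P, F, S) tr (Q, F', S')" "basic Sig c P"
  shows "(\<forall>Q'. Q = Some Q' \<longrightarrow> basic Sig c Q') \<and> (\<forall>d X. AIn d X \<in> set tr \<longrightarrow> d = c)"
  using assms
proof (induction \<l> "(P, F, S)" tr "(Q, F', S')" arbitrary: P F S rule: foc.induct)
  case (In c' X K' tr \<l> P F S)
  obtain P1 F1 S1 where K: "K' = (P1, F1, S1)" by (cases K')
  show ?case using In.hyps(3)[OF K] step_basic[OF In.hyps(1)[unfolded K] In.prems] by auto
next
  case (Out c' w K' tr \<l> P F S)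
  obtain P1 F1 S1 where K: "K' = (P1, F1, S1)" by (cases K')
  show ?case using Out.hyps(3)[OF K] step_basic[OF Out.hyps(1)[unfolded K] Out.prems] by auto
next
  case (Tau K' \<l> tr P F S)
  obtain P1 F1 S1 where K: "K' = (P1, F1, S1)" by (cases K')
  show ?case using Tau.hyps(3)[OF K] step_basic[OF Tau.hyps(1)[unfolded K] Tau.prems] by auto
qed auto

text \<open>With focus \<open>IPlus\<close> a phase can only begin with an input, possibly after
  internal steps, and neither closing rule applies. Hence each phase shows up in the trace as a new
  input.\<close>

lemma foc_nonempty:
  assumes "foc IPlus K tr K'"
  shows "\<exists>d X tr'. tr = AIn d X # tr'"
  using assms by (induction IPlus K tr K' rule: foc.induct) auto

text \<open>Lists rather than the sets \<open>acts_ins\<close> and \<open>acts_outs\<close>, because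
  freshness also makes the labels pairwise distinct.\<close>

primrec ins_list :: "('c, 'w, 'v) act list \<Rightarrow> 'v list" where
  "ins_list [] = []"
| "ins_list (a # tr) = (case a of AIn c X \<Rightarrow> [X] | _ \<Rightarrow> []) @ ins_list tr"

primrec outs_list :: "('c, 'w, 'v) act list \<Rightarrow> 'w list" where
  "outs_list [] = []"
| "outs_list (a # tr) = (case a of AOut c w \<Rightarrow> [w] | _ \<Rightarrow> []) @ outs_list tr"

lemma act_lists_append [simp]:
  "ins_list (tr @ tr') = ins_list tr @ ins_list tr'"
  "outs_list (tr @ tr') = outs_list tr @ outs_list tr'"
  by (induction tr) auto

lemma act_lists_map [simp]:
  "ins_list (map (AIn c) Xs) = Xs" "outs_list (map (AIn c) Xs) = []"
  "ins_list (map (AOut c) ws) = []" "outs_list (map (AOut c) ws) = ws"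
  by ((induction Xs; simp), (induction Xs; simp), (induction ws; simp), (induction ws; simp))

lemma act_lists_io [simp]: "ins_list (io b) = ins b" "outs_list (io b) = outs b"
  by (cases b, simp add: io_def)+

lemma set_act_lists: "set (ins_list tr) = acts_ins tr" "set (outs_list tr) = acts_outs tr"
proof -
  show "set (ins_list tr) = acts_ins tr"
    by (induction tr) (auto simp: acts_ins_def split: act.splits)
  show "set (outs_list tr) = acts_outs tr"
    by (induction tr) (auto simp: acts_outs_def split: act.splits)
qed

text \<open>All inputs of a phase carry the domain of the initial frame: the frame does not change
  before the last input, and in focus \<open>OStar\<close> no input is left. The last clause
  recognises improper phases by the absence of outputs; in focus \<open>OStar\<close> a phase can
  only close properly.\<close>

lemma foc_effect:
  assumes "foc \<l> (P, F, S) tr (Q, F', S')"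
  shows "S \<subseteq> S' \<and> F \<subseteq>\<^sub>m F' \<and> dom F' = dom F \<union> set (outs_list tr) \<and> distinct (outs_list tr) \<and>
    set (outs_list tr) \<inter> dom F = {} \<and> distinct (ins_list tr) \<and> set (ins_list tr) \<inter> ded2 S = {} \<and>
    (\<forall>X \<in> set (ins_list tr). \<exists>x. Ded (dom F) X x \<in> S') \<and> ded2 S' = ded2 S \<union> set (ins_list tr) \<and>
    (\<l> = OStar \<longrightarrow> ins_list tr = []) \<and> (\<forall>Xs W. Dep Xs W \<in> S' \<longleftrightarrow> Dep Xs W \<in> S) \<and>
    (Q = None \<longleftrightarrow> \<l> \<noteq> OStar \<and> outs_list tr = [])"
  using assms
proof (induction \<l> "(P, F, S)" tr "(Q, F', S')" arbitrary: P F S rule: foc.induct)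
  case (In c X K' tr \<l> P F S)
  from In.hyps(1) obtain x y P1 where K: "K' = (rename_proc y x P1, F, insert (Ded (dom F) X x) S)"
    "X \<notin> fv2_csys (F, S)"
    by cases auto
  have "X \<notin> ded2 S" using K(2) by (force simp: ded2_def fv2_csys_def)
  then show ?case using In.hyps(3)[OF K(1)] In.hyps(4) by auto
next
  case (Out c w K' tr \<l> P F S)
  from Out.hyps(1) obtain u P1 where K: "K' = (P1, F(w \<mapsto> u), S)" "w \<notin> handles_csys (F, S)"
    by cases auto
  have w: "w \<notin> dom F" using K(2) by (auto simp: handles_csys_def)
  then have "F \<subseteq>\<^sub>m F(w \<mapsto> u)" by (auto simp: map_le_def)
  then show ?case using Out.hyps(3)[OF K(1)] Out.hyps(4) w map_le_trans by auto
next
  case (Tau K' \<l> tr P F S)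
  from Tau.hyps(1) obtain P1 k where K: "K' = (P1, F, insert k S)" "(\<exists>u v. k = Eq u v \<or> k = Neq u v)"
    by cases auto
  then show ?case using Tau.hyps(3)[OF K(1)] by auto
qed auto

lemma io_AOut_AIn:
  assumes "io b = u @ AOut d w # v"
  shows "AIn d' X \<notin> set v"
proof -
  obtain c Xs ws where b: "b = (c, Xs, ws)" by (cases b)
  have "map (AIn c) Xs @ map (AOut c) ws = u @ AOut d w # v \<Longrightarrow> AIn d' X \<notin> set v"
  proof (induction Xs arbitrary: u)
    case Nil
    then have "set (u @ AOut d w # v) = AOut c ` set ws"
      by (metis append_Nil list.set_map list.simps(8))
    then show ?case by auto
  next
    case (Cons Y Xs)
    then show ?case by (cases u) auto
  qed
  then show ?thesis using assms by (simp add: b io_def)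
qed

text \<open>The generators of \<open>csem\<close>, before reflexive and transitive closure.\<close>

inductive cstep ::
  "('c, 'f, 'n, 'x, 'w, 'v) sym_proc \<Rightarrow> ('c, 'w, 'v) act list \<Rightarrow> ('c, 'f, 'n, 'x, 'w, 'v) sym_proc \<Rightarrow> bool"
  where
  proper: "foc IPlus (Q, F, S) tr (Some Q', F', S') \<Longrightarrow>
     cstep ({#Q#} + PP, F, S) tr (singl Q' + PP, F', S')"
| improper: "foc IPlus (Q, F, S) tr (None, F', S') \<Longrightarrow>
     cstep ({#Q#} + PP, F, S) tr ({#}, F', S')"

lemma csem_cstep:
  "csem K tr K' \<Longrightarrow> K' = K \<and> tr = [] \<or> (\<exists>tr1 K1 tr2. cstep K tr1 K1 \<and> csem K1 tr2 K' \<and> tr = tr1 @ tr2)"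
proof (induction rule: csem.induct)
  case (trans K tr K' tr' K'')
  then show ?case by (metis append.assoc append_Nil csem.trans)
next
  case (proper Q F S tr Q' F' S' PP)
  then show ?case using cstep.proper[OF proper.hyps] csem.refl by (metis append_Nil2)
next
  case (improper Q F S tr F' S' PP)
  then show ?case using cstep.improper[OF improper.hyps] csem.refl by (metis append_Nil2)
qed simp

lemma cstep_nonempty: "cstep K tr K' \<Longrightarrow> \<exists>d X tr'. tr = AIn d X # tr'"
  by (induction rule: cstep.induct) (rule foc_nonempty, assumption)+

text \<open>If the block consisted of several phases, the second would start with an input. After a
  proper phase this input would follow an output, which a block does not allow; after an improper
  phase no process is left to perform it.\<close>

lemma csem_io:
  assumes c: "csem K (io b) K'" and b: "ins b \<noteq> []"
  shows "cstep K (io b) K'"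
proof -
  have "io b \<noteq> []" using b by (cases b) (simp add: io_def)
  then obtain tr1 K1 tr2 where 1: "cstep K tr1 K1" "csem K1 tr2 K'" "io b = tr1 @ tr2"
    using csem_cstep[OF c] by blast
  have "tr2 = [] \<and> K' = K1"
  proof (rule ccontr)
    assume "\<not> ?thesis"
    then obtain tr3 K2 tr4 where 2: "cstep K1 tr3 K2" "tr2 = tr3 @ tr4"
      using csem_cstep[OF 1(2)] by blast
    obtain d X tr5 where 3: "tr3 = AIn d X # tr5" using cstep_nonempty[OF 2(1)] by blast
    from 1(1) show False
    proof cases
      case (proper Q F S Q' F' S' PP)
      then have "outs_list tr1 \<noteq> []" using foc_effect[OF proper(3)] by auto
      then obtain c w where "AOut c w \<in> set tr1"
        using set_act_lists(2)[of tr1] by (force simp: acts_outs_def neq_Nil_conv)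
      then obtain u v where "tr1 = u @ AOut c w # v" by (meson split_list)
      then show False using io_AOut_AIn[of b u c w "v @ tr2" d X] 1(3) 2(2) 3 by simp
    next
      case (improper Q F S F' S' PP)
      then show False using 2(1) by (auto elim: cstep.cases)
    qed
  qed
  then show ?thesis using 1 by simp
qed

section \<open>Simple processes as families indexed by channels\<close>

definition mk :: "('c \<Rightarrow> ('c, 'f, 'n, 'x, 'w) proc) \<Rightarrow> ('c, 'f, 'n, 'x, 'w) proc multiset" where
  "mk p = image_mset p (mset_set {c. p c \<noteq> Null})"

text \<open>\<open>mk\<close> skips \<open>Null\<close> just as \<open>singl\<close> does.
  Finiteness matters because \<open>mset_set\<close> of an infinite set is empty.\<close>

lemma mk_upd:
  assumes "finite {c. p c \<noteq> Null}"
  shows "mk (p(c := Q)) = singl Q + mk (p(c := Null))"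
proof -
  let ?C = "{d. p d \<noteq> Null \<and> d \<noteq> c}"
  have fin: "finite ?C" using assms by simp
  have eq: "{d. (p(c := Null)) d \<noteq> Null} = ?C" by auto
  have im: "image_mset (p(c := R)) (mset_set ?C) = image_mset p (mset_set ?C)" for R
    by (rule image_mset_cong) (use fin in auto)
  show ?thesis
  proof (cases "Q = Null")
    case True
    then show ?thesis by (simp add: singl_def)
  next
    case False
    have "{d. (p(c := Q)) d \<noteq> Null} = insert c ?C" using False by auto
    then have "mk (p(c := Q)) = add_mset Q (image_mset (p(c := Q)) (mset_set ?C))"
      using fin by (simp add: mk_def)
    moreover have "mk (p(c := Null)) = image_mset (p(c := Null)) (mset_set ?C)"
      unfolding mk_def eq ..
    ultimately show ?thesis using im False by (simp add: singl_def)
  qed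
qed

lemma mk_remove:
  assumes "finite {c. p c \<noteq> Null}" "p c \<noteq> Null"
  shows "mk p = {#p c#} + mk (p(c := Null))"
  using mk_upd[OF assms(1), of c "p c"] assms(2) by (simp add: singl_def)

lemma in_mk: "finite {c. p c \<noteq> Null} \<Longrightarrow> Q \<in># mk p \<Longrightarrow> \<exists>c. Q = p c \<and> p c \<noteq> Null"
  by (auto simp: mk_def)

text \<open>The reduced semantics with one process per channel; \<open>None\<close> is the empty process that remains
  after an improper block.\<close>

inductive fred ::
  "('c::linorder \<Rightarrow> ('c, 'f, 'n, 'x, 'w) proc) \<Rightarrow> ('f, 'n, 'x, 'w) frame \<Rightarrow> ('c, 'w, 'v) block list
   \<Rightarrow> ('c \<Rightarrow> ('c, 'f, 'n, 'x, 'w) proc) option \<Rightarrow> ('f, 'n, 'x, 'w) frame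
   \<Rightarrow> ('f, 'n, 'x, 'w, 'v) constr set \<Rightarrow> bool"
  for p0 :: "'c \<Rightarrow> ('c, 'f, 'n, 'x, 'w) proc" and F0 :: "('f, 'n, 'x, 'w) frame"
  where
  Nil: "fred p0 F0 [] (Some p0) F0 {}"
| snoc: "fred p0 F0 tr (Some p) F S \<Longrightarrow> foc IPlus (p (fst b), F, S) (io b) (Q, F', S') \<Longrightarrow>
     ins b \<noteq> [] \<Longrightarrow>
     fred p0 F0 (tr @ [b]) (map_option (\<lambda>Q. p(fst b := Q)) Q) F'
       (insert (Dep (ins b) (dep tr (fst b))) S')"

definition sproc :: "('c \<Rightarrow> ('c, 'f, 'n, 'x, 'w) proc) option \<Rightarrow> ('c, 'f, 'n, 'x, 'w) proc multiset" where
  "sproc po = (case po of None \<Rightarrow> {#} | Some p \<Rightarrow> mk p)"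

lemma fred_basic:
  assumes "fred p0 F0 tr po F S" "finite {c. p0 c \<noteq> Null}" "\<And>c. basic Sig c (p0 c)" "po = Some p"
  shows "finite {c. p c \<noteq> Null} \<and> (\<forall>c. basic Sig c (p c))"
  using assms(1,4)
proof (induction arbitrary: p rule: fred.induct)
  case Nil
  then show ?case using assms by simp
next
  case (snoc tr p F S b Q F' S' p')
  then obtain Q' where Q: "Q = Some Q'" "p' = p(fst b := Q')" by auto
  have "{c. p' c \<noteq> Null} \<subseteq> insert (fst b) {c. p c \<noteq> Null}" using Q by auto
  moreover have IH: "finite {c. p c \<noteq> Null}" "\<And>c. basic Sig c (p c)" using snoc.IH by auto
  ultimately have "finite {c. p' c \<noteq> Null}" by (meson finite_insert finite_subset)
  moreover have "basic Sig (fst b) Q'" using foc_basic[OF snoc.hyps(2) IH(2)] Q(1) by blast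
  ultimately show ?case using IH(2) unfolding Q(2) by simp
qed

lemma foc_io_not_Null: "\<not> foc IPlus (Null, F, S) tr K"
proof
  assume "foc IPlus (Null, F, S) tr K"
  then show False
    by cases (erule step.cases; simp)+
qed

lemma fred_red:
  assumes "fred p0 F0 tr po F S" "finite {c. p0 c \<noteq> Null}" "\<And>c. basic Sig c (p0 c)"
  shows "red (mk p0, F0, {}) tr (sproc po, F, S)"
  using assms(1)
proof (induction rule: fred.induct)
  case Nil
  then show ?case by (simp add: sproc_def red.refl)
next
  case (snoc tr p F S b Q F' S')
  obtain c Xs ws where b: "b = (c, Xs, ws)" by (cases b)
  have fin: "finite {c. p c \<noteq> Null}" using fred_basic[OF snoc.hyps(1) assms(2,3)] by blast
  have "p c \<noteq> Null" using foc_io_not_Null snoc.hyps(2) b by (metis fst_conv)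
  then have rem: "mk p = {#p c#} + mk (p(c := Null))" by (rule mk_remove[OF fin])
  have "csem (mk p, F, S) (io b) (sproc (map_option (\<lambda>Q. p(c := Q)) Q), F', S')"
  proof (cases Q)
    case None
    then show ?thesis
      using csem.improper[of "p c" F S "io b" F' S' "mk (p(c := Null))"] snoc.hyps(2) b rem
      by (simp add: sproc_def)
  next
    case (Some Q')
    then show ?thesis
      using csem.proper[of "p c" F S "io b" Q' F' S' "mk (p(c := Null))"] snoc.hyps(2) b rem
        mk_upd[OF fin, of c Q']
      by (simp add: sproc_def)
  qed
  then show ?case
    using red.block[of "mk p0" F0 tr "mk p" F S c Xs ws] snoc.IH snoc.hyps(3)
    by (simp add: b sproc_def)
qed

lemma red_fred:
  assumes "red K tr K'" "K = (mk p0, F0, {})" "finite {c. p0 c \<noteq> Null}" "\<And>c. basic Sig c (p0 c)"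
  shows "\<exists>po. fred p0 F0 tr po (fst (snd K')) (snd (snd K')) \<and> fst K' = sproc po"
  using assms(1,2)
proof (induction rule: red.induct)
  case (refl K)
  then show ?case using fred.Nil[of p0 F0] by (auto simp: sproc_def intro!: exI[of _ "Some p0"])
next
  case (block PP F tr PP' F' S' c Xs ws PP'' F'' S'')
  then obtain po where po: "fred p0 F0 tr po F' S'" "PP' = sproc po" by auto
  have "cstep (PP', F', S') (io (c, Xs, ws)) (PP'', F'', S'')"
    by (rule csem_io) (use block.hyps in auto)
  then obtain Q PP1 Q' where Q: "PP' = {#Q#} + PP1"
    "foc IPlus (Q, F', S') (io (c, Xs, ws)) (Q', F'', S'')"
    "PP'' = (case Q' of None \<Rightarrow> {#} | Some R \<Rightarrow> singl R + PP1)"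
    by cases fastforce+
  have "Q \<in># PP'" using Q(1) by simp
  then obtain p where p: "po = Some p" using po(2) by (cases po) (auto simp: sproc_def)
  have fb: "finite {c. p c \<noteq> Null}" "\<And>c. basic Sig c (p c)"
    using fred_basic[OF po(1) assms(3,4) p] by auto
  have PP': "PP' = mk p" using po(2) p by (simp add: sproc_def)
  obtain d where d: "Q = p d" "p d \<noteq> Null" using in_mk[OF fb(1)] \<open>Q \<in># PP'\<close> PP' by blast
  \<comment> \<open>The multiset does not record channels. The first input of the block does, since
    a basic process acts on its own channel only.\<close>
  have "d = c"
  proof -
    have "AIn c (hd Xs) \<in> set (io (c, Xs, ws))" using block.hyps(3) by (simp add: io_def)
    then show ?thesis using foc_basic[OF Q(2)] fb(2)[of d] d(1) by blast
  qed
  then have "mk p = {#Q#} + mk (p(c := Null))" using mk_remove[OF fb(1) d(2)] d(1) by simp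
  then have PP1: "PP1 = mk (p(c := Null))" using Q(1) PP' by simp
  have "fred p0 F0 (tr @ [(c, Xs, ws)]) (map_option (\<lambda>Q. p(c := Q)) Q') F''
      (insert (Dep Xs (dep tr c)) S'')"
    using fred.snoc[of p0 F0 tr p F' S' "(c, Xs, ws)" Q' F'' S''] po(1) p Q(2) d(1) \<open>d = c\<close> block.hyps(3)
    by simp
  moreover have "PP'' = sproc (map_option (\<lambda>Q. p(c := Q)) Q')"
  proof (cases Q')
    case None
    then show ?thesis using Q(3) by (simp add: sproc_def)
  next
    case (Some R)
    then show ?thesis using Q(3) PP1 mk_upd[OF fb(1), of c R] by (simp add: sproc_def)
  qed
  ultimately show ?case by auto
qed

lemma ground_vars: "u \<in> ground_terms Sig \<Longrightarrow> vars u = {}"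
  using terms_atoms[of u Sig "range Name"] unfolding ground_terms_def vars_def by blast

lemma ground_messages: "u \<in> ground_terms Sig \<Longrightarrow> u \<in> messages Sig"
  using terms_atoms[of u Sig "range Name"] terms_mono_atoms[of u Sig "range Name"]
  unfolding ground_terms_def messages_def by blast

text \<open>Besides freshness, this recovers from the trace alone what a solution has to respect:
  the handles available to each input and the dependency constraint of each block. Conditions on
  recipes and on dependencies can then be stated without a constraint set.\<close>

lemma fred_inv:
  assumes "fred p0 F0 tr po F S" and p0: "\<And>c. basic Sig c (p0 c)" "\<And>c. fv_proc (p0 c) = {}"
    and F0: "ran F0 \<subseteq> ground_terms Sig"
  shows "csys_inv Sig F S \<and> (\<forall>p. po = Some p \<longrightarrow> (\<forall>c. basic Sig c (p c) \<and> fv_proc (p c) \<subseteq> ded1 S)) \<and>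
    F0 \<subseteq>\<^sub>m F \<and> dom F = dom F0 \<union> tr_outs tr \<and> ded2 S = tr_ins tr \<and> wf_tr (dom F0) tr \<and>
    (po \<noteq> None \<longrightarrow> (\<forall>b \<in> set tr. outs b \<noteq> [])) \<and>
    (\<forall>s1 b s2 X. tr = s1 @ b # s2 \<longrightarrow> X \<in> set (ins b) \<longrightarrow>
       (\<exists>x. Ded (dom F0 \<union> tr_outs s1) X x \<in> S)) \<and>
    (\<forall>Xs W. Dep Xs W \<in> S \<longleftrightarrow> (\<exists>s1 b s2. tr = s1 @ b # s2 \<and> Xs = ins b \<and> W = dep s1 (fst b)))"
  using assms(1)
proof (induction rule: fred.induct)
  case Nil
  have "vars u = {}" "u \<in> messages Sig" if "u \<in> ran F0" for u
    using that F0 ground_vars[of u Sig] ground_messages[of u Sig] by auto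
  then have "csys_inv Sig F0 {}"
    unfolding csys_inv_def fv1_csys_def fv2_csys_def handles_csys_def depends_on_def
    by (auto simp: acyclic_def)
  then show ?case using p0 by (simp add: wf_tr_def)
next
  case (snoc tr p F S b Q F' S')
  let ?c = "fst b"
  have IH: "csys_inv Sig F S" "\<And>c. basic Sig c (p c)" "\<And>c. fv_proc (p c) \<subseteq> ded1 S" "F0 \<subseteq>\<^sub>m F"
    "dom F = dom F0 \<union> tr_outs tr" "ded2 S = tr_ins tr" "wf_tr (dom F0) tr"
    "\<And>b. b \<in> set tr \<Longrightarrow> outs b \<noteq> []"
    using snoc.IH by auto
  have IH2: "\<And>s1 b s2 X. tr = s1 @ b # s2 \<Longrightarrow> X \<in> set (ins b) \<Longrightarrow>
       \<exists>x. Ded (dom F0 \<union> tr_outs s1) X x \<in> S" using snoc.IH by blast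
  have IH3: "Dep Xs W \<in> S \<longleftrightarrow> (\<exists>s1 b s2. tr = s1 @ b # s2 \<and> Xs = ins b \<and> W = dep s1 (fst b))" for Xs W
    using snoc.IH by blast
  have f: "csys_inv Sig F' S'" "\<And>Q'. Q = Some Q' \<Longrightarrow> basic Sig ?c Q' \<and> fv_proc Q' \<subseteq> ded1 S'"
    using foc_inv[OF snoc.hyps(2) IH(1) IH(2) IH(3)] by auto
  note e = foc_effect[OF snoc.hyps(2), unfolded act_lists_io]
  have e': "S \<subseteq> S'" "F \<subseteq>\<^sub>m F'" "dom F' = dom F \<union> set (outs b)" "distinct (outs b)"
    "set (outs b) \<inter> dom F = {}" "distinct (ins b)" "set (ins b) \<inter> ded2 S = {}"
    "\<And>X. X \<in> set (ins b) \<Longrightarrow> \<exists>x. Ded (dom F) X x \<in> S'" "ded2 S' = ded2 S \<union> set (ins b)"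
    "\<And>Xs W. Dep Xs W \<in> S' \<longleftrightarrow> Dep Xs W \<in> S" "Q = None \<longleftrightarrow> outs b = []"
    using e by auto
  let ?S = "insert (Dep (ins b) (dep tr ?c)) S'"
  have d1: "ded1 S \<subseteq> ded1 S'" using e'(1) by (auto simp: ded1_def)
  have split: "tr @ [b] = s1 @ x # s2 \<longleftrightarrow> s1 = tr \<and> x = b \<and> s2 = [] \<or>
      (\<exists>s. s2 = s @ [b] \<and> tr = s1 @ x # s)" for s1 x s2
    by (cases s2 rule: rev_cases) auto
  have "csys_inv Sig F' ?S"
    by (rule csys_inv_Dep[OF f(1)]) (use e' IH(5) dep_subset[of tr ?c] in auto)
  moreover have "\<forall>c. basic Sig c (q c) \<and> fv_proc (q c) \<subseteq> ded1 ?S"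
    if q: "map_option (\<lambda>Q. p(?c := Q)) Q = Some q" for q
  proof -
    obtain Q' where Q': "Q = Some Q'" "q = p(?c := Q')" using q by auto
    show ?thesis using f(2)[OF Q'(1)] IH(2,3) d1 unfolding Q'(2) by auto
  qed
  moreover have "F0 \<subseteq>\<^sub>m F'" using IH(4) e'(2) map_le_trans by blast
  moreover have "dom F' = dom F0 \<union> tr_outs (tr @ [b])" using e'(3) IH(5) by auto
  moreover have "ded2 ?S = tr_ins (tr @ [b])" using e'(9) IH(6) by simp
  moreover have "wf_tr (dom F0) (tr @ [b])"
    using IH(5-8) e'(4-7) snoc.hyps(3) unfolding wf_tr_def
    by (auto simp: set_concat_ins[symmetric] set_concat_outs[symmetric])
  moreover have "\<forall>x \<in> set (tr @ [b]). outs x \<noteq> []" if "map_option (\<lambda>Q. p(?c := Q)) Q \<noteq> None"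
    using that e'(11) IH(8) by auto
  moreover have "\<exists>x. Ded (dom F0 \<union> tr_outs s1) X x \<in> ?S"
    if "tr @ [b] = s1 @ b' # s2" "X \<in> set (ins b')" for s1 b' s2 X
  proof -
    from that(1) consider "s1 = tr" "b' = b" | s where "tr = s1 @ b' # s"
      unfolding split by blast
    then show ?thesis
    proof cases
      case 1
      then show ?thesis using e'(8)[of X] that(2) IH(5) by auto
    next
      case 2
      then show ?thesis using IH2[OF 2 that(2)] e'(1) by auto
    qed
  qed
  moreover have "Dep Xs W \<in> ?S \<longleftrightarrow>
      (\<exists>s1 b' s2. tr @ [b] = s1 @ b' # s2 \<and> Xs = ins b' \<and> W = dep s1 (fst b'))" for Xs W
  proof -
    have "Dep Xs W \<in> ?S \<longleftrightarrow> Xs = ins b \<and> W = dep tr ?c \<or> Dep Xs W \<in> S" using e'(10) by simp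
    then show ?thesis unfolding split IH3 by blast
  qed
  ultimately show ?case by blast
qed

text \<open>\<open>\<xi> X\<close> is the first-order variable chosen in advance for the input \<open>X\<close>.\<close>

definition allocated :: "('v \<Rightarrow> 'x) \<Rightarrow> 'v set \<Rightarrow> ('f, 'n, 'x, 'w, 'v) constr set \<Rightarrow> bool" where
  "allocated \<xi> V S \<longleftrightarrow> ded2 S \<subseteq> V \<and> (\<forall>D X x. Ded D X x \<in> S \<longrightarrow> x = \<xi> X)"

lemma ded1_allocated: "allocated \<xi> V S \<Longrightarrow> ded1 S = \<xi> ` ded2 S"
  unfolding allocated_def ded1_def ded2_def by blast

definition ext_state ::
  "('f \<times> nat) set \<Rightarrow> ('c \<Rightarrow> ('c, 'f, 'n, 'x, 'w) proc) \<Rightarrow> ('f, 'n, 'x, 'w) frame \<Rightarrow> bool" where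
  "ext_state Sig p0 F0 \<longleftrightarrow> finite {c. p0 c \<noteq> Null} \<and>
     (\<forall>c. basic Sig c (p0 c) \<and> fv_proc (p0 c) = {}) \<and> ran F0 \<subseteq> ground_terms Sig"

lemma ext_simple_process_state:
  assumes "ext_simple_process Sig A"
  obtains p0 where "fst A = mk p0" "ext_state Sig p0 (snd A)"
proof -
  obtain PP F where A: "A = (PP, F)" by (cases A)
  from assms obtain C p where C: "finite C" "\<forall>c \<in> C. basic Sig c (p c) \<and> p c \<noteq> Null"
    "PP = image_mset p (mset_set C)" "\<forall>P \<in># PP. fv_proc P = {}" "ran F \<subseteq> ground_terms Sig"
    unfolding ext_simple_process_def simple_process_def A by auto
  define q where "q c = (if c \<in> C then p c else Null)" for c
  have q: "{c. q c \<noteq> Null} = C" using C(2) by (auto simp: q_def)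
  have "PP = mk q"
    unfolding mk_def q C(3) by (rule image_mset_cong) (use C(1) in \<open>simp add: q_def\<close>)
  moreover have "ext_state Sig q F"
    unfolding ext_state_def q using C by (auto simp: q_def)
  ultimately show ?thesis using that A by simp
qed

context
  fixes Sig :: "('f \<times> nat) set"
    and E :: "('f, 'n, 'x, 'w) eqs"
begin

section \<open>Concrete runs\<close>

abbreviation eqE (infix "\<approx>" 50) where "s \<approx> t \<equiv> eq_E Sig E s t"

lemma eqE_Fun:
  assumes "list_all2 (\<approx>) ts ts'"
  shows "Fun f (us @ ts) \<approx> Fun f (us @ ts')"
  using assms
proof (induction ts ts' arbitrary: us rule: list_all2_induct)
  case Nil
  show ?case by (rule eq_E.refl)
next
  case (Cons t ts t' ts')
  show ?case
    using eq_E.cong[OF Cons.hyps(1), of f us ts] Cons.IH[of "us @ [t']"] eq_E.trans by fastforce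
qed

lemma eqE_subst: "(\<And>a. a \<in> atoms t \<Longrightarrow> s a \<approx> s' a) \<Longrightarrow> subst s t \<approx> subst s' t"
proof (induction t)
  case (Fun f ts)
  then have "list_all2 (\<approx>) (map (subst s) ts) (map (subst s') ts)"
    by (auto simp: list.rel_map intro!: list.rel_refl_strong)
  then show ?case using eqE_Fun[of _ _ f "[]"] by simp
qed auto

text \<open>Polymorphic in the keys, as it compares environments of variables as well as
  frames.\<close>

definition env_eq :: "('a \<rightharpoonup> ('f, 'n, 'x, 'w) msg) \<Rightarrow> ('a \<rightharpoonup> ('f, 'n, 'x, 'w) msg) \<Rightarrow> bool"
  where "env_eq r r' \<longleftrightarrow> (\<forall>x. rel_option (\<approx>) (r x) (r' x))"

lemma rel_option_eqE_refl: "rel_option (\<approx>) a a"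
  by (cases a) (auto intro: eq_E.refl)

lemma rel_option_eqE_sym: "rel_option (\<approx>) a b \<Longrightarrow> rel_option (\<approx>) b a"
  by (cases a; cases b) (auto intro: eq_E.sym)

lemma env_eq_refl: "env_eq r r"
  by (simp add: env_eq_def rel_option_eqE_refl)

lemma env_eq_upd: "env_eq r r' \<Longrightarrow> t \<approx> t' \<Longrightarrow> env_eq (r(y \<mapsto> t)) (r'(y \<mapsto> t'))"
  by (simp add: env_eq_def)

lemma eqE_xsubst:
  assumes "env_eq r r'"
  shows "xsubst r u \<approx> xsubst r' u"
  unfolding xsubst_def
proof (rule eqE_subst)
  fix a :: "('n, 'x, 'w) atom"
  show "(case a of Var x \<Rightarrow> (case r x of Some t \<Rightarrow> t | None \<Rightarrow> At a) | _ \<Rightarrow> At a)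
      \<approx> (case a of Var x \<Rightarrow> (case r' x of Some t \<Rightarrow> t | None \<Rightarrow> At a) | _ \<Rightarrow> At a)"
  proof (cases a)
    case (Var x)
    have "rel_option (\<approx>) (r x) (r' x)" using assms by (simp add: env_eq_def)
    then show ?thesis using Var by (cases "r x"; cases "r' x") (auto intro: eq_E.refl)
  qed (auto intro: eq_E.refl)
qed

lemma eqE_hsubst:
  assumes "\<And>w. w \<in> handles M \<Longrightarrow> rel_option (\<approx>) (F w) (F' w)"
  shows "hsubst F M \<approx> hsubst F' M"
  unfolding hsubst_def
proof (rule eqE_subst)
  fix a :: "('n, 'x, 'w) atom"
  assume a: "a \<in> atoms M"
  show "(case a of Handle w \<Rightarrow> (case F w of Some t \<Rightarrow> t | None \<Rightarrow> At a) | _ \<Rightarrow> At a)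
      \<approx> (case a of Handle w \<Rightarrow> (case F' w of Some t \<Rightarrow> t | None \<Rightarrow> At a) | _ \<Rightarrow> At a)"
  proof (cases a)
    case (Handle w)
    have "rel_option (\<approx>) (F w) (F' w)" using assms[of w] a Handle by (simp add: handles_def)
    then show ?thesis using Handle by (cases "F w"; cases "F' w") (auto intro: eq_E.refl)
  qed (auto intro: eq_E.refl)
qed

lemma eqE_iff: "s \<approx> s' \<Longrightarrow> t \<approx> t' \<Longrightarrow> (s \<approx> t) = (s' \<approx> t')"
  by (meson eq_E.sym eq_E.trans)

text \<open>Substitutions associated to a solution, and hence their frames, are determined only
  modulo \<open>E\<close>; static equivalence has to be insensitive to the choice.\<close>

lemma static_equiv_env_eq:
  assumes "static_equiv Sig E F G" "env_eq F F'" "env_eq G G'"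
  shows "static_equiv Sig E F' G'"
proof -
  have d: "dom F' = dom F" "dom G' = dom G"
    using assms(2,3) unfolding env_eq_def
    by (auto simp: dom_def) (metis option.rel_distinct(1,2) not_None_eq)+
  have "hsubst F M \<approx> hsubst F' M" "hsubst G M \<approx> hsubst G' M" for M
    using assms(2,3) by (auto simp: env_eq_def intro!: eqE_hsubst)
  then show ?thesis
    using assms(1) eqE_iff unfolding static_equiv_def d by (smt (verit, best))
qed

text \<open>Bound variables are not renamed: the environment \<open>r\<close> records the values of the inputs, so that the
  run of a channel does not interfere with the other channels.\<close>

inductive frun ::
  "('f, 'n, 'x, 'w) frame \<Rightarrow> ('f, 'n, 'x, 'w, 'v) soln \<Rightarrow> focus \<Rightarrow> ('x \<rightharpoonup> ('f, 'n, 'x, 'w) msg)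
   \<Rightarrow> ('c, 'f, 'n, 'x, 'w) proc \<Rightarrow> ('c, 'w, 'v) act list
   \<Rightarrow> ('x \<rightharpoonup> ('f, 'n, 'x, 'w) msg) \<Rightarrow> ('c, 'f, 'n, 'x, 'w) proc option \<Rightarrow> bool"
  for F :: "('f, 'n, 'x, 'w) frame" and \<theta> :: "('f, 'n, 'x, 'w, 'v) soln"
  where
  In: "frun F \<theta> IStar (r(y \<mapsto> hsubst F (the (\<theta> X)))) P tr r' Q \<Longrightarrow> \<l> \<in> {IStar, IPlus} \<Longrightarrow>
       frun F \<theta> \<l> r (In c y P) (AIn c X # tr) r' Q"
| Out: "F w = Some t \<Longrightarrow> xsubst r u \<approx> t \<Longrightarrow> frun F \<theta> OStar r P tr r' Q \<Longrightarrow>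
       \<l> \<in> {IStar, OStar} \<Longrightarrow> frun F \<theta> \<l> r (Out c u P) (AOut c w # tr) r' Q"
| Then: "xsubst r u \<approx> xsubst r v \<Longrightarrow> frun F \<theta> \<l> r P tr r' Q \<Longrightarrow>
       frun F \<theta> \<l> r (If u v P P') tr r' Q"
| Else: "\<not> xsubst r u \<approx> xsubst r v \<Longrightarrow> frun F \<theta> \<l> r P' tr r' Q \<Longrightarrow>
       frun F \<theta> \<l> r (If u v P P') tr r' Q"
| Proper: "P = Null \<or> (\<exists>c x P'. P = proc.In c x P') \<Longrightarrow> frun F \<theta> OStar r P [] r (Some P)"
| Improper: "frun F \<theta> IStar r Null [] r None"

text \<open>A run looks at its recipes and its frame only through the values of its inputs and
  outputs modulo \<open>E\<close>. This allows both the exchange of recipes of equal value and the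
  passage to another frame.\<close>

lemma frun_env_eq:
  assumes "frun F \<theta> \<l> r P tr r' Q" "env_eq r r1"
    and "\<And>X. X \<in> acts_ins tr \<Longrightarrow> hsubst F (the (\<theta> X)) \<approx> hsubst F1 (the (\<theta>1 X))"
    and "\<And>w. w \<in> acts_outs tr \<Longrightarrow> rel_option (\<approx>) (F w) (F1 w)"
  shows "\<exists>r1'. env_eq r' r1' \<and> frun F1 \<theta>1 \<l> r1 P tr r1' Q"
  using assms
proof (induction arbitrary: r1 rule: frun.induct)
  case (In r y X P tr r' Q \<l> c)
  have "env_eq (r(y \<mapsto> hsubst F (the (\<theta> X)))) (r1(y \<mapsto> hsubst F1 (the (\<theta>1 X))))"
    using In.prems by (intro env_eq_upd) auto
  from In.IH[OF this] In.prems(2,3) obtain r1' where r1':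
    "env_eq r' r1'" "frun F1 \<theta>1 IStar (r1(y \<mapsto> hsubst F1 (the (\<theta>1 X)))) P tr r1' Q"
    by (auto simp del: fun_upd_apply)
  then show ?case using frun.In[OF r1'(2) In.hyps(2)] by blast
next
  case (Out w t r u P tr r' Q \<l> c)
  obtain t1 where t1: "F1 w = Some t1" "t \<approx> t1"
    using Out.prems(3)[of w] Out.hyps(1) by (cases "F1 w") auto
  have u: "xsubst r1 u \<approx> t1"
    using Out.hyps(2) t1(2) eqE_xsubst[OF Out.prems(1)] eq_E.sym eq_E.trans by metis
  obtain r1' where r1': "env_eq r' r1'" "frun F1 \<theta>1 OStar r1 P tr r1' Q"
    using Out.IH[OF Out.prems(1)] Out.prems(2,3) by auto
  show ?case using r1'(1) frun.Out[OF t1(1) u r1'(2) Out.hyps(4)] by blast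
next
  case (Then r u v \<l> P tr r' Q P')
  then obtain r1' where r1': "env_eq r' r1'" "frun F1 \<theta>1 \<l> r1 P tr r1' Q" by blast
  have "xsubst r1 u \<approx> xsubst r1 v"
    using Then.hyps(1) eqE_iff[OF eqE_xsubst eqE_xsubst, OF Then.prems(1) Then.prems(1)] by blast
  then show ?case using r1'(1) frun.Then[OF _ r1'(2)] by blast
next
  case (Else r u v \<l> P' tr r' Q P)
  then obtain r1' where r1': "env_eq r' r1'" "frun F1 \<theta>1 \<l> r1 P' tr r1' Q" by blast
  have "\<not> xsubst r1 u \<approx> xsubst r1 v"
    using Else.hyps(1) eqE_iff[OF eqE_xsubst eqE_xsubst, OF Else.prems(1) Else.prems(1)] by blast
  then show ?case using r1'(1) frun.Else[OF _ r1'(2)] by blast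
next
  case (Proper P r)
  then show ?case using frun.Proper[OF Proper.hyps] by blast
next
  case (Improper r)
  then show ?case using frun.Improper by blast
qed

text \<open>The labels decide between input and output, and the two branches of a test exclude each
  other, so equal input values force equal results. Agreement of the frames on the output handles is
  a conclusion here, not a hypothesis as in \<open>frun_env_eq\<close>.\<close>

lemma frun_determ:
  assumes "frun F \<theta> \<l> r P tr r' Q" "frun F1 \<theta>1 \<l> r1 P tr r1' Q1" "env_eq r r1"
    and "\<And>X. X \<in> acts_ins tr \<Longrightarrow> hsubst F (the (\<theta> X)) \<approx> hsubst F1 (the (\<theta>1 X))"
  shows "env_eq r' r1' \<and> Q = Q1 \<and> (\<forall>w \<in> acts_outs tr. rel_option (\<approx>) (F w) (F1 w))"
  using assms
proof (induction arbitrary: r1 rule: frun.induct)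
  case (In r y X P tr r' Q \<l> c)
  from In.prems(1) have "frun F1 \<theta>1 IStar (r1(y \<mapsto> hsubst F1 (the (\<theta>1 X)))) P tr r1' Q1"
    by (auto elim: frun.cases)
  moreover have "env_eq (r(y \<mapsto> hsubst F (the (\<theta> X)))) (r1(y \<mapsto> hsubst F1 (the (\<theta>1 X))))"
    using In.prems by (intro env_eq_upd) auto
  ultimately show ?case using In.IH In.prems(3) by (simp del: fun_upd_apply)
next
  case (Out w t r u P tr r' Q \<l> c)
  from Out.prems(1) obtain t1 where t1: "F1 w = Some t1" "xsubst r1 u \<approx> t1"
    "frun F1 \<theta>1 OStar r1 P tr r1' Q1"
    by (auto elim: frun.cases)
  have "t \<approx> t1" using t1(2) Out.hyps(2) eqE_xsubst[OF Out.prems(2)] eq_E.sym eq_E.trans by metis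
  then show ?case using Out.IH[OF t1(3)] Out.prems Out.hyps t1 by auto
next
  case (Then r u v \<l> P tr r' Q P')
  have "xsubst r1 u \<approx> xsubst r1 v"
    using Then.hyps(1) eqE_iff[OF eqE_xsubst eqE_xsubst, OF Then.prems(2) Then.prems(2)] by blast
  then have "frun F1 \<theta>1 \<l> r1 P tr r1' Q1"
    using Then.prems(1) by (auto elim: frun.cases)
  then show ?case using Then.IH Then.prems by auto
next
  case (Else r u v \<l> P' tr r' Q P)
  have "\<not> xsubst r1 u \<approx> xsubst r1 v"
    using Else.hyps(1) eqE_iff[OF eqE_xsubst eqE_xsubst, OF Else.prems(2) Else.prems(2)] by blast
  then have "frun F1 \<theta>1 \<l> r1 P' tr r1' Q1"
    using Else.prems(1) by (auto elim: frun.cases)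
  then show ?case using Else.IH Else.prems by auto
next
  case (Proper P r)
  then show ?case by (auto elim: frun.cases)
next
  case (Improper r)
  then show ?case by (auto elim: frun.cases)
qed

inductive brun ::
  "('f, 'n, 'x, 'w) frame \<Rightarrow> ('f, 'n, 'x, 'w, 'v) soln \<Rightarrow> ('c, 'f, 'n, 'x, 'w) proc
   \<Rightarrow> ('c, 'w, 'v) block list
   \<Rightarrow> ('x \<rightharpoonup> ('f, 'n, 'x, 'w) msg) \<Rightarrow> ('c, 'f, 'n, 'x, 'w) proc option \<Rightarrow> bool"
  for F :: "('f, 'n, 'x, 'w) frame" and \<theta> :: "('f, 'n, 'x, 'w, 'v) soln"
    and P :: "('c, 'f, 'n, 'x, 'w) proc"
  where
  Nil: "brun F \<theta> P [] Map.empty (Some P)"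
| snoc: "brun F \<theta> P bs r (Some Q) \<Longrightarrow> frun F \<theta> IPlus r Q (io b) r' Q' \<Longrightarrow>
     brun F \<theta> P (bs @ [b]) r' Q'"

lemma brun_Nil [simp]: "brun F \<theta> P [] r Q \<longleftrightarrow> r = Map.empty \<and> Q = Some P"
  by (subst brun.simps) auto

lemma brun_snoc [simp]: "brun F \<theta> P (bs @ [b]) r' Q' \<longleftrightarrow>
    (\<exists>r Q. brun F \<theta> P bs r (Some Q) \<and> frun F \<theta> IPlus r Q (io b) r' Q')"
  by (subst brun.simps) auto

lemma brun_prefix: "brun F \<theta> P (bs @ bs') r Q \<Longrightarrow> \<exists>r Q. brun F \<theta> P bs r Q"
proof (induction bs' arbitrary: r Q rule: rev_induct)
  case (snoc b bs')
  then show ?case by (metis append_assoc brun_snoc)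
qed auto

lemma brun_env_eq:
  assumes "brun F \<theta> P bs r Q"
    and "\<And>X. X \<in> tr_ins bs \<Longrightarrow> hsubst F (the (\<theta> X)) \<approx> hsubst F1 (the (\<theta>1 X))"
    and "\<And>w. w \<in> tr_outs bs \<Longrightarrow> rel_option (\<approx>) (F w) (F1 w)"
  shows "\<exists>r1. env_eq r r1 \<and> brun F1 \<theta>1 P bs r1 Q"
  using assms
proof (induction rule: brun.induct)
  case Nil
  then show ?case by (simp add: env_eq_refl)
next
  case (snoc bs r Q b r' Q')
  from snoc.IH snoc.prems obtain r1 where r1: "env_eq r r1" "brun F1 \<theta>1 P bs r1 (Some Q)"
    by auto
  obtain r1' where "env_eq r' r1'" "frun F1 \<theta>1 IPlus r1 Q (io b) r1' Q'"
    using frun_env_eq[OF snoc.hyps(2) r1(1), of F1 \<theta>1] snoc.prems by (auto simp: acts_io)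
  then show ?case using r1 by auto
qed

lemma brun_determ:
  assumes "brun F \<theta> P bs r Q" "brun F1 \<theta>1 P bs r1 Q1"
    and "\<And>X. X \<in> tr_ins bs \<Longrightarrow> hsubst F (the (\<theta> X)) \<approx> hsubst F1 (the (\<theta>1 X))"
  shows "env_eq r r1 \<and> Q = Q1 \<and> (\<forall>w \<in> tr_outs bs. rel_option (\<approx>) (F w) (F1 w))"
  using assms
proof (induction arbitrary: r1 Q1 rule: brun.induct)
  case Nil
  then show ?case by (auto simp: env_eq_refl)
next
  case (snoc bs r Q b r' Q')
  from snoc.prems(1) obtain r2 Q2 where 2: "brun F1 \<theta>1 P bs r2 (Some Q2)"
    "frun F1 \<theta>1 IPlus r2 Q2 (io b) r1 Q1" by auto
  from snoc.IH[OF 2(1)] snoc.prems have 3: "env_eq r r2" "Q = Q2"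
    "\<forall>w \<in> tr_outs bs. rel_option (\<approx>) (F w) (F1 w)" by auto
  show ?case
    using frun_determ[OF snoc.hyps(2) 2(2)[folded 3(2)] 3(1)] snoc.prems 3 by (auto simp: acts_io)
qed

section \<open>Rearranging concrete executions\<close>

primrec recs :: "('f, 'n, 'x, 'w, 'v) soln \<Rightarrow> 'w set \<Rightarrow> ('c, 'w, 'v) block list \<Rightarrow> bool" where
  "recs \<theta> D [] \<longleftrightarrow> True"
| "recs \<theta> D (b # tr) \<longleftrightarrow>
     (\<forall>X \<in> set (ins b). the (\<theta> X) \<in> recipes Sig D) \<and> recs \<theta> (D \<union> set (outs b)) tr"

lemma recs_append [simp]:
  "recs \<theta> D (tr @ tr') \<longleftrightarrow> recs \<theta> D tr \<and> recs \<theta> (D \<union> tr_outs tr) tr'"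
  by (induction tr arbitrary: D) (auto simp: Un_assoc)

lemma recs_mono: "recs \<theta> D tr \<Longrightarrow> D \<subseteq> D' \<Longrightarrow> recs \<theta> D' tr"
proof (induction tr arbitrary: D D')
  case (Cons b tr)
  have "recs \<theta> (D' \<union> set (outs b)) tr"
    by (rule Cons.IH[of "D \<union> set (outs b)"]) (use Cons.prems in auto)
  then show ?case using Cons.prems recipes_mono[OF _ Cons.prems(2)] by auto
qed simp

lemma recs_cong: "(\<And>X. X \<in> tr_ins tr \<Longrightarrow> \<theta> X = \<theta>' X) \<Longrightarrow> recs \<theta> D tr = recs \<theta>' D tr"
  by (induction tr arbitrary: D) auto

lemma recs_in: "recs \<theta> D tr \<Longrightarrow> X \<in> tr_ins tr \<Longrightarrow> the (\<theta> X) \<in> recipes Sig (D \<union> tr_outs tr)"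
proof (induction tr arbitrary: D)
  case (Cons b tr)
  then show ?case
    using recipes_mono[of "the (\<theta> X)" Sig D "D \<union> tr_outs (b # tr)"]
      Cons.IH[of "D \<union> set (outs b)"] by (auto simp: Un_assoc)
qed simp

text \<open>Only \<open>recs\<close> and \<open>wf_tr\<close> depend on the order of the blocks of different channels.\<close>

definition conc ::
  "('c \<Rightarrow> ('c, 'f, 'n, 'x, 'w) proc) \<Rightarrow> ('f, 'n, 'x, 'w) frame \<Rightarrow> ('c, 'w, 'v) block list
   \<Rightarrow> ('f, 'n, 'x, 'w, 'v) soln \<Rightarrow> ('f, 'n, 'x, 'w) frame \<Rightarrow> bool" where
  "conc p0 F0 tr \<theta> F \<longleftrightarrow>
     wf_tr (dom F0) tr \<and> dom \<theta> = tr_ins tr \<and> recs \<theta> (dom F0) tr \<and>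
     dom F = dom F0 \<union> tr_outs tr \<and> (\<forall>w \<in> dom F0. F w = F0 w) \<and> ran F \<subseteq> ground_terms Sig \<and>
     (\<forall>c. \<exists>r Q. brun F \<theta> (p0 c) (chan c tr) r Q)"

text \<open>First-order satisfaction for a concrete execution: \<open>D \<union> tr_outs s1\<close>
  is the domain of the frame when block \<open>b\<close> starts, so it bounds the competing recipes
  \<open>M\<close>.\<close>

definition deps1 ::
  "('f, 'n, 'x, 'w, 'v) soln \<Rightarrow> ('f, 'n, 'x, 'w) frame \<Rightarrow> 'w set
   \<Rightarrow> ('c::linorder, 'w, 'v) block list \<Rightarrow> bool" where
  "deps1 \<theta> F D tr \<longleftrightarrow> (\<forall>s1 b s2. tr = s1 @ b # s2 \<longrightarrow> dep s1 (fst b) \<noteq> {} \<longrightarrow>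
     (\<exists>X \<in> set (ins b). \<forall>M \<in> recipes Sig (D \<union> tr_outs s1).
        hsubst F M \<approx> hsubst F (the (\<theta> X)) \<longrightarrow> handles M \<inter> dep s1 (fst b) \<noteq> {}))"

lemma hsubst_restrict: "M \<in> recipes Sig D \<Longrightarrow> D \<subseteq> D' \<Longrightarrow> hsubst (F |` D') M = hsubst F M"
  by (rule hsubst_eq) (use recipes_handles in \<open>fastforce simp: restrict_map_def\<close>)

lemma brun_ex:
  assumes "brun F \<theta> P bs r Q"
    and "\<And>X. X \<in> tr_ins bs \<Longrightarrow> hsubst F (the (\<theta> X)) \<approx> hsubst F1 (the (\<theta>1 X))"
    and "\<And>w. w \<in> tr_outs bs \<Longrightarrow> rel_option (\<approx>) (F w) (F1 w)"
  shows "\<exists>r Q. brun F1 \<theta>1 P bs r Q"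
  using brun_env_eq[OF assms] by blast

text \<open>Runs are kept per channel, so a trace whose channel projections are prefixes of the
  given ones can reuse them as long as the input values stay equal. The order-sensitive conditions
  therefore appear as hypotheses.\<close>

lemma conc_transfer:
  assumes c: "conc p0 F0 s \<theta> F" and p: "\<And>c. prefix (chan c s') (chan c s)"
    and r: "recs \<theta>' (dom F0) s'" and d: "dom \<theta>' = tr_ins s'" and wf: "wf_tr (dom F0) s'"
    and v: "\<And>X. X \<in> tr_ins s' \<Longrightarrow> hsubst F (the (\<theta> X)) \<approx> hsubst F (the (\<theta>' X))"
  shows "conc p0 F0 s' \<theta>' (F |` (dom F0 \<union> tr_outs s'))"
proof -
  let ?F = "F |` (dom F0 \<union> tr_outs s')"
  have sub: "tr_outs s' \<subseteq> tr_outs s" using prefix_chan_subset[OF p] by (rule tr_outs_mono)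
  have "\<exists>r Q. brun ?F \<theta>' (p0 c) (chan c s') r Q" for c
  proof -
    obtain r Q where br: "brun F \<theta> (p0 c) (chan c s') r Q"
      using c p[of c] brun_prefix unfolding conc_def prefix_def by metis
    have "hsubst F (the (\<theta> X)) \<approx> hsubst ?F (the (\<theta>' X))" if "X \<in> tr_ins (chan c s')" for X
    proof -
      have X: "X \<in> tr_ins s'" using that by (rule tr_ins_chan)
      \<comment> \<open>By \<open>recs\<close>, the new recipes use no handle outside the restricted
        frame.\<close>
      then show ?thesis using v[OF X] hsubst_restrict[OF recs_in[OF r X] subset_refl] by simp
    qed
    moreover have "rel_option (\<approx>) (F w) (?F w)" if "w \<in> tr_outs (chan c s')" for w
      using tr_outs_chan[OF that] by (simp add: rel_option_eqE_refl)
    ultimately show ?thesis by (rule brun_ex[OF br])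
  qed
  moreover have "dom ?F = dom F0 \<union> tr_outs s'" using c sub unfolding conc_def by auto
  moreover have "ran ?F \<subseteq> ground_terms Sig"
  proof -
    have "ran ?F \<subseteq> ran F" by (auto simp: ran_def restrict_map_def)
    then show ?thesis using c unfolding conc_def by blast
  qed
  moreover have "\<forall>w \<in> dom F0. ?F w = F0 w" using c unfolding conc_def by auto
  ultimately show ?thesis using r d wf unfolding conc_def by blast
qed

text \<open>A channel run is determined only once its input values are, and these depend on outputs
  of other channels. The order of the trace breaks the circle: by \<open>recs\<close> a block reads
  only handles output earlier, on which the frames agree by induction.\<close>

lemma conc_determ:
  assumes "wf_tr D s" and r: "recs \<theta> D s" and D: "\<And>w. w \<in> D \<Longrightarrow> rel_option (\<approx>) (F w) (G w)"
    and F: "\<And>c. \<exists>r Q. brun F \<theta> (p0 c) (chan c s) r Q"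
    and G: "\<And>c. \<exists>r Q. brun G \<theta> (p0 c) (chan c s) r Q"
    and w: "w \<in> D \<union> tr_outs s"
  shows "rel_option (\<approx>) (F w) (G w)"
  using r F G w
proof (induction s arbitrary: w rule: rev_induct)
  case Nil
  then show ?case using D by simp
next
  case (snoc b s)
  have IH: "rel_option (\<approx>) (F w) (G w)" if "w \<in> D \<union> tr_outs s" for w
  proof (rule snoc.IH[OF _ _ _ that])
    show "recs \<theta> D s" using snoc.prems by simp
    show "\<exists>r Q. brun F \<theta> (p0 c) (chan c s) r Q" for c
      using snoc.prems(2)[of c] brun_prefix by (metis chan_simps(3))
    show "\<exists>r Q. brun G \<theta> (p0 c) (chan c s) r Q" for c
      using snoc.prems(3)[of c] brun_prefix by (metis chan_simps(3))
  qed
  have eq: "hsubst F (the (\<theta> X)) \<approx> hsubst G (the (\<theta> X))" if X: "X \<in> tr_ins (s @ [b])" for X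
  proof (rule eqE_hsubst)
    fix w assume w: "w \<in> handles (the (\<theta> X))"
    have "the (\<theta> X) \<in> recipes Sig (D \<union> tr_outs s)"
      using X snoc.prems(1) recs_in[of \<theta> D s] by auto
    then show "rel_option (\<approx>) (F w) (G w)" using IH w recipes_handles by fastforce
  qed
  show ?case
  proof (cases "w \<in> D \<union> tr_outs s")
    case False
    then have w: "w \<in> set (outs b)" using snoc.prems(4) by simp
    obtain r Q where 1: "brun F \<theta> (p0 (fst b)) (chan (fst b) (s @ [b])) r Q"
      using snoc.prems(2) by blast
    obtain r' Q' where 2: "brun G \<theta> (p0 (fst b)) (chan (fst b) (s @ [b])) r' Q'"
      using snoc.prems(3) by blast
    have "\<forall>w \<in> tr_outs (chan (fst b) (s @ [b])). rel_option (\<approx>) (F w) (G w)"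
      using brun_determ[OF 1 2] eq[OF tr_ins_chan] by blast
    then show ?thesis using w by simp
  qed (rule IH)
qed

lemma static_equiv_hsubst:
  assumes "static_equiv Sig E F G" "dom F = D" "M \<in> recipes Sig D" "N \<in> recipes Sig D"
  shows "hsubst F M \<approx> hsubst F N \<longleftrightarrow> hsubst G M \<approx> hsubst G N"
  using assms unfolding static_equiv_def by blast

text \<open>The channels in \<open>C\<close> keep all their blocks, the others may lose their last ones.\<close>

definition rearrangement ::
  "'c set \<Rightarrow> ('c \<Rightarrow> ('c, 'f, 'n, 'x, 'w) proc) \<Rightarrow> ('f, 'n, 'x, 'w) frame \<Rightarrow> ('c, 'w, 'v) block list
   \<Rightarrow> ('f, 'n, 'x, 'w, 'v) soln \<Rightarrow> ('f, 'n, 'x, 'w) frame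
   \<Rightarrow> ('c, 'w, 'v) block list \<Rightarrow> ('f, 'n, 'x, 'w, 'v) soln \<Rightarrow> bool" where
  "rearrangement C p0 F0 tr \<theta> F s \<theta>' \<longleftrightarrow>
     conc p0 F0 s \<theta>' (F |` (dom F0 \<union> tr_outs s)) \<and>
     (\<forall>X \<in> tr_ins s. hsubst F (the (\<theta>' X)) \<approx> hsubst F (the (\<theta> X))) \<and>
     (\<forall>c. prefix (chan c s) (chan c tr)) \<and> (\<forall>c \<in> C. chan c s = chan c tr)"

text \<open>Since \<open>g\<close> has no block on the channel of \<open>b\<close>, the block
  \<open>b\<close> either jumps over \<open>g\<close> or, when it is last, makes \<open>g\<close>
  disappear. The second option serves improper blocks; the condition on \<open>C\<close> ensures
  that no protected channel loses a block.\<close>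

lemma rearrangement_step:
  assumes re: "rearrangement C p0 F0 tr \<theta> F s \<theta>'"
    and s: "s = s1 @ b # s3" and s1: "s1 = a @ g" and g: "fst b \<notin> fst ` set g"
    and m: "\<And>X. X \<in> set (ins b) \<Longrightarrow> m X \<in> recipes Sig (dom F0 \<union> tr_outs a) \<and>
              hsubst F (m X) \<approx> hsubst F (the (\<theta>' X))"
    and s': "outs b \<noteq> [] \<and> s' = a @ b # g @ s3 \<or> C \<subseteq> {fst b} \<and> s3 = [] \<and> s' = a @ [b]"
  shows "\<exists>\<theta>''. rearrangement C p0 F0 tr \<theta> F s' \<theta>''"
proof -
  let ?F = "F |` (dom F0 \<union> tr_outs s)"
  have c: "conc p0 F0 s \<theta>' ?F" using re by (simp add: rearrangement_def)
  then have wf: "wf_tr (dom F0) s" and r: "recs \<theta>' (dom F0) s" by (simp_all add: conc_def)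
  have p: "prefix (chan c s') (chan c s)" for c
    using s' s s1 chan_empty[OF g] by (auto simp: prefix_def)
  have C: "chan c s' = chan c s" if "c \<in> C" for c
    using s' s s1 chan_empty[OF g] that by auto
  have sub: "tr_outs s' \<subseteq> tr_outs s" "tr_ins s' \<subseteq> tr_ins s"
    using prefix_chan_subset[OF p] by (simp_all add: tr_outs_mono tr_ins_mono)
  \<comment> \<open>Only the recipes of \<open>b\<close> change. \<open>\<theta>2\<close> then
    forgets the inputs of dropped blocks, since the domain must consist of exactly the inputs of the
    trace.\<close>
  define \<theta>1 where "\<theta>1 = (\<lambda>X. if X \<in> set (ins b) then Some (m X) else \<theta>' X)"
  define \<theta>2 where "\<theta>2 = \<theta>1 |` tr_ins s'"
  have eq2: "\<theta>2 X = \<theta>1 X" if "X \<in> tr_ins s'" for X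
    using that by (simp add: \<theta>2_def)
  have disj: "set (ins b) \<inter> tr_ins (a @ g @ s3) = {}"
    using wf s s1 unfolding wf_tr_def by (auto simp: set_concat_ins[symmetric])
  have eq1: "\<theta>1 X = \<theta>' X" if "X \<in> tr_ins (a @ g @ s3)" for X
    using that disj by (auto simp: \<theta>1_def)
  have "recs \<theta>1 (dom F0) s'"
  proof -
    have "recs \<theta>1 (dom F0) a"
      using r s s1 recs_cong[of a \<theta>1 \<theta>'] eq1 by auto
    moreover have "\<forall>X \<in> set (ins b). the (\<theta>1 X) \<in> recipes Sig (dom F0 \<union> tr_outs a)"
      using m by (simp add: \<theta>1_def)
    \<comment> \<open>The blocks that are jumped over now also have the outputs of \<open>b\<close>
      at their disposal, which only enlarges the choice of recipes.\<close>
    moreover have "recs \<theta>1 (dom F0 \<union> tr_outs a \<union> set (outs b)) g"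
      using r s s1 recs_cong[of g \<theta>1 \<theta>'] eq1
        recs_mono[of \<theta>' "dom F0 \<union> tr_outs a" g "dom F0 \<union> tr_outs a \<union> set (outs b)"] by auto
    moreover have "recs \<theta>1 (dom F0 \<union> tr_outs a \<union> set (outs b) \<union> tr_outs g) s3"
      using r s s1 recs_cong[of s3 \<theta>1 \<theta>'] eq1 by (auto simp: Un_ac)
    ultimately show ?thesis using s' by auto
  qed
  then have r2: "recs \<theta>2 (dom F0) s'" using recs_cong[of s' \<theta>2 \<theta>1] eq2 by auto
  have v: "hsubst F (the (\<theta>2 X)) \<approx> hsubst F (the (\<theta>' X))" if "X \<in> tr_ins s'" for X
    using eq2[OF that] m[of X] by (auto simp: \<theta>1_def eq_E.refl)
  have "conc p0 F0 s' \<theta>2 (?F |` (dom F0 \<union> tr_outs s'))"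
  proof (rule conc_transfer[OF c p r2])
    have "dom \<theta>' = tr_ins s" using c by (simp add: conc_def)
    moreover have "dom \<theta>1 = dom \<theta>' \<union> set (ins b)" by (auto simp: \<theta>1_def split: if_splits)
    ultimately have "dom \<theta>1 = tr_ins s" using s by auto
    then show "dom \<theta>2 = tr_ins s'" using sub by (auto simp: \<theta>2_def)
    show "wf_tr (dom F0) s'"
      using wf s' s s1 wf_tr_move[of "dom F0" a g b s3] wf_tr_drop[of "dom F0" a g b] by auto
    fix X assume X: "X \<in> tr_ins s'"
    have "hsubst ?F (the (\<theta>' X)) = hsubst F (the (\<theta>' X))"
      using recs_in[OF r] X sub hsubst_restrict by blast
    moreover have "hsubst ?F (the (\<theta>2 X)) = hsubst F (the (\<theta>2 X))"
      using recs_in[OF r2 X] sub hsubst_restrict by blast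
    ultimately show "hsubst ?F (the (\<theta>' X)) \<approx> hsubst ?F (the (\<theta>2 X))"
      using v[OF X] eq_E.sym by metis
  qed
  moreover have "?F |` (dom F0 \<union> tr_outs s') = F |` (dom F0 \<union> tr_outs s')"
    using sub by (intro ext) (auto simp: restrict_map_def)
  moreover have "hsubst F (the (\<theta>2 X)) \<approx> hsubst F (the (\<theta> X))" if "X \<in> tr_ins s'" for X
    using v[OF that] re sub that unfolding rearrangement_def by (meson eq_E.trans subsetD)
  moreover have "prefix (chan c s') (chan c tr)" for c
    using re p[of c] prefix_order.trans unfolding rearrangement_def by blast
  moreover have "chan c s' = chan c tr" if "c \<in> C" for c
    using re C that unfolding rearrangement_def by simp
  ultimately have "rearrangement C p0 F0 tr \<theta> F s' \<theta>2" unfolding rearrangement_def by simp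
  then show ?thesis by blast
qed

text \<open>Minimality comes from well-founded induction. In the length-first lexicographic order, a
  move keeps the length and puts a smaller channel in the place of \<open>y\<close>, while a drop
  shortens the trace. Drops happen only in front of an improper block, where the hypothesis on
  \<open>C\<close> confines the protected channels to that of the block.\<close>

lemma rearrangement_deps1:
  fixes tr :: "('c::linorder, 'w, 'v) block list"
  assumes imp: "\<And>b. b \<in> set tr \<Longrightarrow> outs b = [] \<Longrightarrow> C \<subseteq> {fst b}"
    and "rearrangement C p0 F0 tr \<theta> F s \<theta>'"
  shows "\<exists>s \<theta>'. rearrangement C p0 F0 tr \<theta> F s \<theta>' \<and>
    deps1 \<theta>' (F |` (dom F0 \<union> tr_outs s)) (dom F0) s"
proof -
  \<comment> \<open>The order on channels need not be well-founded; counting the smaller channels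
    that occur in \<open>tr\<close> maps it to natural numbers and stays strictly monotone on the
    channels of \<open>tr\<close>.\<close>
  define rank where "rank b = card {d \<in> fst ` set tr. d < fst b}" for b :: "('c, 'w, 'v) block"
  have rank: "rank b < rank y" if "fst b < fst y" "b \<in> set tr" for b y
    unfolding rank_def by (rule psubset_card_mono) (use that in force)+
  have "wf (inv_image (lenlex less_than) (map rank))" by (intro wf_inv_image wf_lenlex wf_less_than)
  then show ?thesis using assms(2)
  proof (induction s arbitrary: \<theta>' rule: wf_induct_rule)
    case (less s)
    let ?F = "F |` (dom F0 \<union> tr_outs s)"
    show ?case
    proof (cases "deps1 \<theta>' ?F (dom F0) s")
      case True
      then show ?thesis using less.prems by blast
    next
      case False
      then obtain s1 b s3 where s: "s = s1 @ b # s3" and dep: "dep s1 (fst b) \<noteq> {}"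
        and ex: "\<forall>X \<in> set (ins b). \<exists>M \<in> recipes Sig (dom F0 \<union> tr_outs s1).
          hsubst ?F M \<approx> hsubst ?F (the (\<theta>' X)) \<and> handles M \<inter> dep s1 (fst b) = {}"
        unfolding deps1_def by blast
      from ex obtain m where m: "\<And>X. X \<in> set (ins b) \<Longrightarrow> m X \<in> recipes Sig (dom F0 \<union> tr_outs s1) \<and>
          hsubst ?F (m X) \<approx> hsubst ?F (the (\<theta>' X)) \<and> handles (m X) \<inter> dep s1 (fst b) = {}"
        by metis
      obtain a y g where g: "s1 = a @ y # g" "fst b < fst y" "fst b \<notin> fst ` set (y # g)"
        "dep s1 (fst b) = tr_outs (y # g)"
        using dep_split[OF dep] by metis
      have c: "conc p0 F0 s \<theta>' ?F" using less.prems by (simp add: rearrangement_def)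
      \<comment> \<open>Avoiding the critical handles means avoiding all outputs from
        \<open>y\<close> on, so the new recipe is already available in front of
        \<open>y\<close>.\<close>
      have m': "m X \<in> recipes Sig (dom F0 \<union> tr_outs a) \<and> hsubst F (m X) \<approx> hsubst F (the (\<theta>' X))"
        if X: "X \<in> set (ins b)" for X
      proof
        show "m X \<in> recipes Sig (dom F0 \<union> tr_outs a)"
          by (rule recipes_restrict[where W = "tr_outs (y # g)"]) (use m[OF X] g in auto)
        have "hsubst ?F (m X) = hsubst F (m X)"
          using m[OF X] s by (intro hsubst_restrict) auto
        moreover have "hsubst ?F (the (\<theta>' X)) = hsubst F (the (\<theta>' X))"
          using c X s recs_in[of \<theta>' "dom F0" s X] unfolding conc_def
          by (intro hsubst_restrict) auto
        ultimately show "hsubst F (m X) \<approx> hsubst F (the (\<theta>' X))" using m[OF X] by simp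
      qed
      have set: "set s \<subseteq> set tr"
        using less.prems prefix_chan_subset unfolding rearrangement_def by blast
      then have b: "b \<in> set tr" using s by auto
      define s' where "s' = (if outs b \<noteq> [] then a @ b # (y # g) @ s3 else a @ [b])"
      \<comment> \<open>Only the last block of a well-formed trace can be improper.\<close>
      have "outs b \<noteq> [] \<or> s3 = []"
        using c s unfolding conc_def wf_tr_def by (auto simp: butlast_append)
      then have "outs b \<noteq> [] \<and> s' = a @ b # (y # g) @ s3 \<or> C \<subseteq> {fst b} \<and> s3 = [] \<and> s' = a @ [b]"
        using imp[OF b] by (auto simp: s'_def)
      from rearrangement_step[OF less.prems s g(1,3) m' this]
      obtain \<theta>2 where "rearrangement C p0 F0 tr \<theta> F s' \<theta>2" by blast
      moreover have "(s', s) \<in> inv_image (lenlex less_than) (map rank)"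
      proof (cases "outs b = []")
        case True
        then show ?thesis using s g by (simp add: s'_def lenlex_conv)
      next
        case False
        have "(map rank s', map rank s) \<in> lex less_than"
          unfolding lex_conv using rank[OF g(2) b] False s g(1)
          by (simp add: s'_def) (rule exI[of _ "map rank a"], simp)
        then show ?thesis using False s g(1) by (simp add: lenlex_conv s'_def)
      qed
      ultimately show ?thesis using less.IH by blast
    qed
  qed
qed

lemma rearrangement_refl:
  assumes "conc p0 F0 tr \<theta> F"
  shows "rearrangement C p0 F0 tr \<theta> F tr \<theta>"
proof -
  have "F |` (dom F0 \<union> tr_outs tr) = F"
    using assms unfolding conc_def by (intro restrict_map_superset) simp
  then show ?thesis using assms by (simp add: rearrangement_def eq_E.refl)
qed

text \<open>The handles of the trace are new for both initial frames, so removing them from the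
  common final domain leaves the initial domains.\<close>

lemma conc_static_dom:
  assumes "conc p0 F0 tr \<theta> F" "conc q0 G0 tr \<theta>' G" "static_equiv Sig E F G"
  shows "dom G0 = dom F0"
proof -
  have "dom F0 \<union> tr_outs tr = dom G0 \<union> tr_outs tr" "tr_outs tr \<inter> dom F0 = {}" "tr_outs tr \<inter> dom G0 = {}"
    using assms unfolding conc_def wf_tr_def static_equiv_def by simp_all
  then show ?thesis by blast
qed

section \<open>Lifting the inclusion from constrained to all concrete executions\<close>

context
  fixes p0 q0 :: "'c::linorder \<Rightarrow> ('c, 'f, 'n, 'x, 'w) proc"
    and F0 G0 :: "('f, 'n, 'x, 'w) frame"
  assumes incl: "\<And>tr (\<theta> :: ('f, 'n, 'x, 'w, 'v) soln) F. conc p0 F0 tr \<theta> F \<Longrightarrow>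
    deps1 \<theta> F (dom F0) tr \<Longrightarrow> \<exists>G. conc q0 G0 tr \<theta> G \<and> static_equiv Sig E F G"
begin

text \<open>Protecting all channels makes the rearrangement \<open>s\<close> a mere change of
  interleaving with the same final frame. Static equivalence over that frame carries the equality of
  old and new recipes to the other process, so its run for \<open>s\<close> serves for
  \<open>tr\<close>.\<close>

lemma incl_proper:
  fixes \<theta> :: "('f, 'n, 'x, 'w, 'v) soln"
  assumes c: "conc p0 F0 tr \<theta> F" and proper: "\<And>b. b \<in> set tr \<Longrightarrow> outs b \<noteq> []"
  shows "\<exists>G. conc q0 G0 tr \<theta> G \<and> static_equiv Sig E F G"
proof -
  obtain s \<theta>' where s: "rearrangement UNIV p0 F0 tr \<theta> F s \<theta>'"
    and dep: "deps1 \<theta>' (F |` (dom F0 \<union> tr_outs s)) (dom F0) s"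
    using rearrangement_deps1[OF _ rearrangement_refl[OF c, of UNIV]] proper by blast
  have chan: "chan d s = chan d tr" for d using s by (simp add: rearrangement_def)
  then have sets: "set s = set tr"
    by (intro equalityI prefix_chan_subset) auto
  then have outs: "tr_outs s = tr_outs tr" "tr_ins s = tr_ins tr"
    by (auto simp: tr_outs_def tr_ins_def)
  have dF: "dom F = dom F0 \<union> tr_outs tr" and r: "recs \<theta> (dom F0) tr" using c by (simp_all add: conc_def)
  from dF have F: "F |` (dom F0 \<union> tr_outs s) = F" using outs(1) by (intro restrict_map_superset) simp
  have s': "conc p0 F0 s \<theta>' F" using s F by (simp add: rearrangement_def)
  obtain G where G: "conc q0 G0 s \<theta>' G" "static_equiv Sig E F G"
    using incl[OF s'] dep F by metis
  have dom: "dom G0 = dom F0" using conc_static_dom[OF s' G] .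
  have "conc q0 G0 tr \<theta> (G |` (dom G0 \<union> tr_outs tr))"
  proof (rule conc_transfer[OF G(1)])
    show "recs \<theta> (dom G0) tr" "dom \<theta> = tr_ins tr" "wf_tr (dom G0) tr"
      using c dom by (simp_all add: conc_def)
    fix X assume X: "X \<in> tr_ins tr"
    have "the (\<theta>' X) \<in> recipes Sig (dom F0 \<union> tr_outs tr)"
      using s' X outs recs_in[of \<theta>' "dom F0" s X] by (simp add: conc_def)
    moreover have "hsubst F (the (\<theta>' X)) \<approx> hsubst F (the (\<theta> X))"
      using s X outs by (simp add: rearrangement_def)
    ultimately show "hsubst G (the (\<theta>' X)) \<approx> hsubst G (the (\<theta> X))"
      using static_equiv_hsubst[OF G(2) dF] recs_in[OF r X] by blast
  qed (simp add: chan)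
  moreover have "G |` (dom G0 \<union> tr_outs tr) = G"
    using G(1) outs unfolding conc_def by (intro restrict_map_superset) simp
  ultimately show ?thesis using G(2) by metis
qed

text \<open>Two matching runs are combined. The one for \<open>tr0\<close> has the whole frame
  \<open>G\<close> but lacks the improper block \<open>b\<close>; the one for the rearranged trace
  has every block on the channel of \<open>b\<close>, but possibly fewer handles. Both belong to the
  same process and agree on the handles of \<open>s0\<close>, so the missing run on that channel can
  be read in \<open>G\<close>.\<close>

lemma incl_all:
  fixes \<theta> :: "('f, 'n, 'x, 'w, 'v) soln"
  assumes c: "conc p0 F0 tr \<theta> F"
  shows "\<exists>G. conc q0 G0 tr \<theta> G \<and> static_equiv Sig E F G"
proof (cases "\<forall>b \<in> set tr. outs b \<noteq> []")
  case True
  then show ?thesis using incl_proper[OF c] by blast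
next
  case False
  then have "tr \<noteq> []" by auto
  then obtain tr0 b where tr: "tr = tr0 @ [b]" by (meson rev_exhaust)
  have wf: "wf_tr (dom F0) tr" and dF: "dom F = dom F0 \<union> tr_outs tr" and r: "recs \<theta> (dom F0) tr"
    using c by (simp_all add: conc_def)
  have proper: "\<forall>b \<in> set tr0. outs b \<noteq> []" using wf tr by (simp add: wf_tr_def)
  have b: "outs b = []" using False proper tr by auto
  \<comment> \<open>\<open>b\<close> outputs nothing, so the frame after \<open>tr0\<close> is
    already the final one.\<close>
  have F: "F |` (dom F0 \<union> tr_outs tr0) = F" using dF tr b by (intro restrict_map_superset) simp
  have wf0: "wf_tr (dom F0) tr0"
    using wf tr unfolding wf_tr_def by (auto dest: in_set_butlastD)
  have c0: "conc p0 F0 tr0 (\<theta> |` tr_ins tr0) F"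
  proof (subst F[symmetric], rule conc_transfer[OF c _ _ _ wf0])
    show "prefix (chan d tr0) (chan d tr)" for d using tr by simp
    show "recs (\<theta> |` tr_ins tr0) (dom F0) tr0"
      using r tr recs_cong[of tr0 "\<theta> |` tr_ins tr0" \<theta>] by simp
    show "dom (\<theta> |` tr_ins tr0) = tr_ins tr0" using c tr by (auto simp: conc_def)
  qed (simp add: eq_E.refl)
  obtain G where G: "conc q0 G0 tr0 (\<theta> |` tr_ins tr0) G" "static_equiv Sig E F G"
    using incl_proper[OF c0] proper by blast
  have dom: "dom G0 = dom F0" using conc_static_dom[OF c0 G] .
  obtain s \<theta>' where s: "rearrangement {fst b} p0 F0 tr \<theta> F s \<theta>'"
    and dep: "deps1 \<theta>' (F |` (dom F0 \<union> tr_outs s)) (dom F0) s"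
    using rearrangement_deps1[OF _ rearrangement_refl[OF c, of "{fst b}"]] proper tr by fastforce
  let ?F = "F |` (dom F0 \<union> tr_outs s)"
  have s': "conc p0 F0 s \<theta>' ?F" using s by (simp add: rearrangement_def)
  obtain G' where G': "conc q0 G0 s \<theta>' G'" "static_equiv Sig E ?F G'"
    using incl[OF s' dep] by blast
  have pre: "prefix (chan d s) (chan d tr)" for d using s by (simp add: rearrangement_def)
  have subs: "tr_outs s \<subseteq> tr_outs tr" "tr_ins s \<subseteq> tr_ins tr"
    using prefix_chan_subset[OF pre] by (simp_all add: tr_outs_mono tr_ins_mono)
  have chb: "chan (fst b) s = chan (fst b) tr" using s by (simp add: rearrangement_def)
  have rs: "recs \<theta>' (dom F0) s" using s' by (simp add: conc_def)
  have bs: "b \<in> set s" using set_chan[of b s] chb tr by simp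
  \<comment> \<open>Being improper, \<open>b\<close> cannot lie in \<open>butlast s\<close>.\<close>
  obtain s0 where ss: "s = s0 @ [b]"
  proof -
    have "b \<notin> set (butlast s)" using s' b unfolding conc_def wf_tr_def by blast
    moreover have "s \<noteq> []" using bs by auto
    then obtain s0 x where "s = s0 @ [x]" by (meson rev_exhaust)
    ultimately show ?thesis using that bs by auto
  qed
  \<comment> \<open>The equality of exchanged recipes is transferred between the full frames
    \<open>F\<close> and \<open>G\<close>; \<open>G'\<close> may lack handles of the original
    recipes.\<close>
  have eqX: "hsubst G (the (\<theta>' X)) \<approx> hsubst G (the (\<theta> X))" if X: "X \<in> tr_ins s" for X
  proof -
    have "the (\<theta>' X) \<in> recipes Sig (dom F0 \<union> tr_outs tr)"
      using recs_in[OF rs X] by (rule recipes_mono) (use subs in auto)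
    moreover have "hsubst F (the (\<theta>' X)) \<approx> hsubst F (the (\<theta> X))"
      using s X by (simp add: rearrangement_def)
    ultimately show ?thesis
      using static_equiv_hsubst[OF G(2) dF] recs_in[OF r] X subs by blast
  qed
  have pre0: "prefix (chan d s0) (chan d tr0)" for d
    using pre[of d] chb ss tr by (auto split: if_splits)
  have subs0: "tr_ins s0 \<subseteq> tr_ins tr0"
    using prefix_chan_subset[OF pre0] by (simp add: tr_ins_mono)
  have brG: "\<exists>r Q. brun G \<theta>' (q0 d) (chan d s0) r Q" for d
  proof -
    obtain r Q where br: "brun G (\<theta> |` tr_ins tr0) (q0 d) (chan d s0) r Q"
      using G(1) pre0[of d] brun_prefix unfolding conc_def prefix_def by metis
    have "hsubst G (the ((\<theta> |` tr_ins tr0) X)) \<approx> hsubst G (the (\<theta>' X))"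
      if "X \<in> tr_ins (chan d s0)" for X
    proof -
      have "X \<in> tr_ins s0" using that by (rule tr_ins_chan)
      then show ?thesis using eqX[of X] subs0 ss eq_E.sym by (auto simp: subset_iff)
    qed
    then show ?thesis by (rule brun_ex[OF br _ rel_option_eqE_refl])
  qed
  \<comment> \<open>Both frames support runs of \<open>s0\<close> with the recipes
    \<open>\<theta>'\<close> in the same process, so determinism applies.\<close>
  have eqw: "rel_option (\<approx>) (G w) (G' w)" if "w \<in> dom G0 \<union> tr_outs s0" for w
  proof (rule conc_determ[OF _ _ _ brG _ that])
    show "wf_tr (dom G0) s0" "recs \<theta>' (dom G0) s0"
      using G'(1) ss unfolding conc_def wf_tr_def by (auto dest: in_set_butlastD)
    show "\<exists>r Q. brun G' \<theta>' (q0 d) (chan d s0) r Q" for d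
      using G'(1) ss brun_prefix unfolding conc_def by (metis chan_simps(3))
    show "rel_option (\<approx>) (G w) (G' w)" if "w \<in> dom G0" for w
      using G(1) G'(1) that unfolding conc_def by (simp add: rel_option_eqE_refl)
  qed
  have outs0: "tr_outs s0 = tr_outs s" using ss b by simp
  have "\<exists>r Q. brun G \<theta> (q0 d) (chan d tr) r Q" for d
  proof (cases "d = fst b")
    case True
    obtain r Q where br: "brun G' \<theta>' (q0 d) (chan d tr) r Q"
      using G'(1) chb True unfolding conc_def by metis
    have "hsubst G' (the (\<theta>' X)) \<approx> hsubst G (the (\<theta> X))"
      if "X \<in> tr_ins (chan d tr)" for X
    proof -
      have X: "X \<in> tr_ins s" using that chb True tr_ins_chan by metis
      have "hsubst G (the (\<theta>' X)) \<approx> hsubst G' (the (\<theta>' X))"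
        by (rule eqE_hsubst) (use recs_in[OF rs X] recipes_handles eqw dom outs0 in blast)
      then show ?thesis using eqX[OF X] eq_E.sym eq_E.trans by metis
    qed
    moreover have "rel_option (\<approx>) (G' w) (G w)" if "w \<in> tr_outs (chan d tr)" for w
      using that chb True tr_outs_chan[of w d s] eqw[of w] outs0 rel_option_eqE_sym
      by auto
    ultimately show ?thesis by (rule brun_ex[OF br])
  next
    case False
    then have ch: "chan d tr = chan d tr0" using tr by simp
    obtain r Q where br: "brun G (\<theta> |` tr_ins tr0) (q0 d) (chan d tr0) r Q"
      using G(1) unfolding conc_def by metis
    have "hsubst G (the ((\<theta> |` tr_ins tr0) X)) \<approx> hsubst G (the (\<theta> X))"
      if "X \<in> tr_ins (chan d tr0)" for X
      using tr_ins_chan[OF that] by (simp add: eq_E.refl)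
    then show ?thesis unfolding ch by (rule brun_ex[OF br _ rel_option_eqE_refl])
  qed
  moreover have "wf_tr (dom G0) tr" "recs \<theta> (dom G0) tr" "dom \<theta> = tr_ins tr"
    using c dom by (simp_all add: conc_def)
  moreover have "dom G = dom G0 \<union> tr_outs tr" "\<forall>w \<in> dom G0. G w = G0 w" "ran G \<subseteq> ground_terms Sig"
    using G(1) tr b by (simp_all add: conc_def)
  ultimately show ?thesis using G(2) unfolding conc_def by blast
qed

end

section \<open>Symbolic and concrete executions\<close>

text \<open>Relates a process of a concrete run, whose inputs are bound in the environment
  \<open>r\<close>, to a symbolic one, whose inputs were renamed to variables valued by
  \<open>l\<close>. Messages are compared modulo \<open>E\<close>; the quantifier over
  \<open>t\<close> in the input clause keeps the relation usable for whatever value is read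
  later.\<close>

primrec sim ::
  "('c, 'f, 'n, 'x, 'w) proc \<Rightarrow> ('x \<rightharpoonup> ('f, 'n, 'x, 'w) msg) \<Rightarrow> ('x \<rightharpoonup> ('f, 'n, 'x, 'w) msg)
   \<Rightarrow> ('c, 'f, 'n, 'x, 'w) proc \<Rightarrow> bool" where
  "sim Null r l P \<longleftrightarrow> P = Null"
| "sim (If u v P1 P2) r l P \<longleftrightarrow> (\<exists>u' v' P1' P2'. P = If u' v' P1' P2' \<and>
     xsubst r u \<approx> xsubst l u' \<and> xsubst r v \<approx> xsubst l v' \<and> sim P1 r l P1' \<and> sim P2 r l P2')"
| "sim (In c y P1) r l P \<longleftrightarrow> (\<exists>P1'. P = In c y P1' \<and> (\<forall>t. sim P1 (r(y \<mapsto> t)) (l(y \<mapsto> t)) P1'))"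
| "sim (Out c u P1) r l P \<longleftrightarrow> (\<exists>u' P1'. P = Out c u' P1' \<and> xsubst r u \<approx> xsubst l u' \<and> sim P1 r l P1')"

lemma sim_env_eq: "sim P0 r l P \<Longrightarrow> env_eq l l' \<Longrightarrow> sim P0 r l' P"
proof (induction P0 arbitrary: r l l' P)
  case Null
  then show ?case by simp
next
  case (If u v P1 P2)
  from If.prems(1) obtain u' v' P1' P2' where P: "P = If u' v' P1' P2'"
    "xsubst r u \<approx> xsubst l u'" "xsubst r v \<approx> xsubst l v'" "sim P1 r l P1'" "sim P2 r l P2'" by auto
  have "xsubst r u \<approx> xsubst l' u'" "xsubst r v \<approx> xsubst l' v'"
    using P(2,3) eqE_xsubst[OF If.prems(2)] eq_E.trans by blast+
  then show ?case using P If.IH(1)[OF P(4) If.prems(2)] If.IH(2)[OF P(5) If.prems(2)] by simp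
next
  case (In c y P1)
  from In.prems(1) obtain P1' where P: "P = In c y P1'" "\<And>t. sim P1 (r(y \<mapsto> t)) (l(y \<mapsto> t)) P1'"
    by auto
  have "sim P1 (r(y \<mapsto> t)) (l'(y \<mapsto> t)) P1'" for t
    by (rule In.IH[OF P(2)]) (rule env_eq_upd[OF In.prems(2) eq_E.refl])
  then show ?case using P by simp
next
  case (Out c u P1)
  from Out.prems(1) obtain u' P1' where P: "P = Out c u' P1'"
    "xsubst r u \<approx> xsubst l u'" "sim P1 r l P1'" by auto
  have "xsubst r u \<approx> xsubst l' u'"
    using P(2) eqE_xsubst[OF Out.prems(2)] eq_E.trans by blast
  then show ?case using P Out.IH[OF P(3) Out.prems(2)] by simp
qed

text \<open>The bridge between binding \<open>y\<close> in the environment and replacing it by a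
  fresh variable of the same value. Below an inner input that binds \<open>y\<close> again, neither
  has an effect.\<close>

lemma sim_rename:
  "sim P0 r (l(y \<mapsto> t)) P \<Longrightarrow> x \<notin> allvars_proc P \<Longrightarrow> l x = Some t \<Longrightarrow> sim P0 r l (rename_proc y x P)"
proof (induction P0 arbitrary: r l P)
  case Null
  then show ?case by simp
next
  case (If u v P1 P2)
  then show ?case by (auto simp: xsubst_rename simp del: fun_upd_apply)
next
  case (In c z P1)
  from In.prems(1) obtain P1' where P: "P = In c z P1'"
    "\<And>t'. sim P1 (r(z \<mapsto> t')) (l(y \<mapsto> t, z \<mapsto> t')) P1'" by (auto simp del: fun_upd_apply)
  show ?case
  proof (cases "z = y")
    case True
    then show ?thesis using P by simp
  next
    case False
    have "sim P1 (r(z \<mapsto> t')) (l(z \<mapsto> t')) (rename_proc y x P1')" for t'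
    proof (rule In.IH)
      show "sim P1 (r(z \<mapsto> t')) (l(z \<mapsto> t', y \<mapsto> t)) P1'"
        using P(2)[of t'] False by (simp add: fun_upd_twist)
      show "x \<notin> allvars_proc P1'" "(l(z \<mapsto> t')) x = Some t" using In.prems P(1) by auto
    qed
    then show ?thesis using P(1) False by simp
  qed
next
  case (Out c u P1)
  then show ?case by (auto simp: xsubst_rename simp del: fun_upd_apply)
qed

lemma sim_refl: "(\<And>x. x \<in> fv_proc P \<Longrightarrow> r x = l x) \<Longrightarrow> sim P r l P"
proof (induction P arbitrary: r l)
  case Null
  then show ?case by simp
next
  case (If u v P1 P2)
  then have "xsubst r u = xsubst l u" "xsubst r v = xsubst l v"
    by (auto intro!: xsubst_eq)
  then show ?case using If by (auto simp: eq_E.refl)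
next
  case (In c y P)
  then show ?case by auto
next
  case (Out c u P)
  then have "xsubst r u = xsubst l u" by (auto intro!: xsubst_eq)
  then show ?case using Out by (auto simp: eq_E.refl)
qed

lemma sim_Null_or_In:
  assumes "sim P0 r l P"
  shows "P0 = Null \<or> (\<exists>c x P'. P0 = In c x P') \<longleftrightarrow> P = Null \<or> (\<exists>c x P'. P = In c x P')"
  using assms by (cases P0) auto

text \<open>Unlike in \<open>is_lambda\<close>, recipes are evaluated in a fixed final frame
  \<open>G\<close>, with which the instantiated current frame has to agree modulo \<open>E\<close>.
  The condition thus passes from a state to all earlier ones.\<close>

definition satisfies ::
  "('x \<rightharpoonup> ('f, 'n, 'x, 'w) msg) \<Rightarrow> ('f, 'n, 'x, 'w, 'v) soln \<Rightarrow> ('f, 'n, 'x, 'w) frame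
   \<Rightarrow> ('f, 'n, 'x, 'w) frame \<Rightarrow> ('f, 'n, 'x, 'w, 'v) constr set \<Rightarrow> bool" where
  "satisfies l \<theta> G F S \<longleftrightarrow>
     (\<forall>D X x. Ded D X x \<in> S \<longrightarrow> (\<exists>t. l x = Some t \<and> hsubst G (the (\<theta> X)) \<approx> t)) \<and>
     (\<forall>u v. Eq u v \<in> S \<longrightarrow> xsubst l u \<approx> xsubst l v) \<and>
     (\<forall>u v. Neq u v \<in> S \<longrightarrow> \<not> xsubst l u \<approx> xsubst l v) \<and>
     (\<forall>w u. F w = Some u \<longrightarrow> (\<exists>t. G w = Some t \<and> xsubst l u \<approx> t))"

lemma satisfies_mono:
  assumes "satisfies l \<theta> G F' S'" "S \<subseteq> S'" "F \<subseteq>\<^sub>m F'"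
  shows "satisfies l \<theta> G F S"
proof -
  have "F' w = Some u" if "F w = Some u" for w u
    using that assms(3) by (metis domI map_le_def)
  then show ?thesis using assms(1,2) unfolding satisfies_def by blast
qed

lemma satisfies_Dep [simp]: "satisfies l \<theta> G F (insert (Dep Xs W) S) = satisfies l \<theta> G F S"
  by (simp add: satisfies_def)

text \<open>Constraints and frame entries persist, so whatever a step adds is still present in the
  final state, where \<open>satisfies\<close> gives its truth.\<close>

lemma foc_sound:
  assumes "foc \<l> (P, F, S) tr (Q, F', S')" "satisfies l \<theta> G F' S'" "sim P0 r l P"
  shows "\<exists>r' Q0. frun G \<theta> \<l> r P0 tr r' Q0 \<and> rel_option (\<lambda>q0 q. sim q0 r' l q) Q0 Q"
  using assms
proof (induction \<l> "(P, F, S)" tr "(Q, F', S')" arbitrary: P F S P0 r rule: foc.induct)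
  case (In c X K' tr \<l> P F S)
  from In.hyps(1) obtain x y P1 where K: "P = In c y P1" "x \<notin> allvars_proc P1"
    "K' = (rename_proc y x P1, F, insert (Ded (dom F) X x) S)"
    by cases auto
  from In.prems(2) K(1) obtain P1' where P0: "P0 = In c y P1'"
    "\<And>t. sim P1' (r(y \<mapsto> t)) (l(y \<mapsto> t)) P1"
    by (cases P0) auto
  have "Ded (dom F) X x \<in> S'" using foc_effect[OF In.hyps(2)[unfolded K(3)]] by blast
  then obtain t where t: "l x = Some t" "hsubst G (the (\<theta> X)) \<approx> t"
    using In.prems(1) unfolding satisfies_def by blast
  have "sim P1' (r(y \<mapsto> hsubst G (the (\<theta> X)))) (l(y \<mapsto> t)) P1"
    by (rule sim_env_eq[OF P0(2)]) (rule env_eq_upd[OF env_eq_refl t(2)])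
  from In.hyps(3)[OF K(3) In.prems(1) sim_rename[OF this K(2) t(1)]]
  obtain r' Q0 where f: "frun G \<theta> IStar (r(y \<mapsto> hsubst G (the (\<theta> X)))) P1' tr r' Q0"
    "rel_option (\<lambda>q0 q. sim q0 r' l q) Q0 Q" by blast
  then show ?case using frun.In[OF f(1) In.hyps(4)] f(2) P0(1) by blast
next
  case (Out c w K' tr \<l> P F S)
  from Out.hyps(1) obtain u P1 where K: "P = Out c u P1" "w \<notin> handles_csys (F, S)"
    "K' = (P1, F(w \<mapsto> u), S)"
    by cases auto
  from Out.prems(2) K(1) obtain u' P1' where P0: "P0 = Out c u' P1'" "xsubst r u' \<approx> xsubst l u"
    "sim P1' r l P1"
    by (cases P0) auto
  have "F(w \<mapsto> u) \<subseteq>\<^sub>m F'" using foc_effect[OF Out.hyps(2)[unfolded K(3)]] by blast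
  then have "F' w = Some u" by (metis domI fun_upd_same map_le_def)
  then obtain t where t: "G w = Some t" "xsubst l u \<approx> t"
    using Out.prems(1) unfolding satisfies_def by blast
  obtain r' Q0 where f: "frun G \<theta> OStar r P1' tr r' Q0" "rel_option (\<lambda>q0 q. sim q0 r' l q) Q0 Q"
    using Out.hyps(3)[OF K(3) Out.prems(1) P0(3)] by blast
  then show ?case
    using frun.Out[OF t(1) eq_E.trans[OF P0(2) t(2)] f(1) Out.hyps(4)] f(2) P0(1) by blast
next
  case (Tau K' \<l> tr P F S)
  from Tau.hyps(1) obtain u v P1 P2 P' k where K: "P = If u v P1 P2" "K' = (P', F, insert k S)"
    "k = Eq u v \<and> P' = P1 \<or> k = Neq u v \<and> P' = P2"
    by cases auto
  from Tau.prems(2) K(1) obtain u' v' P1' P2' where P0: "P0 = If u' v' P1' P2'"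
    "xsubst r u' \<approx> xsubst l u" "xsubst r v' \<approx> xsubst l v" "sim P1' r l P1" "sim P2' r l P2"
    by (cases P0) auto
  have k: "k \<in> S'" using foc_effect[OF Tau.hyps(2)[unfolded K(2)]] by blast
  from K(3) show ?case
  proof
    assume 1: "k = Eq u v \<and> P' = P1"
    then have "xsubst l u \<approx> xsubst l v" using Tau.prems(1) k unfolding satisfies_def by blast
    then have "xsubst r u' \<approx> xsubst r v'" using eqE_iff[OF P0(2,3)] by blast
    then show ?thesis
      using Tau.hyps(3)[OF K(2) Tau.prems(1)] 1 P0(1,4) frun.Then by blast
  next
    assume 1: "k = Neq u v \<and> P' = P2"
    then have "\<not> xsubst l u \<approx> xsubst l v" using Tau.prems(1) k unfolding satisfies_def by blast
    then have "\<not> xsubst r u' \<approx> xsubst r v'" using eqE_iff[OF P0(2,3)] by blast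
    then show ?thesis
      using Tau.hyps(3)[OF K(2) Tau.prems(1)] 1 P0(1,5) frun.Else by blast
  qed
next
  case (Proper P P0 r)
  have "P0 = Null \<or> (\<exists>c x P'. P0 = In c x P')"
    using sim_Null_or_In[OF Proper.prems(2)] Proper.hyps(1) by blast
  then have "frun G \<theta> OStar r P0 [] r (Some P0)" by (rule frun.Proper)
  then show ?case using Proper by (auto intro!: exI[of _ r] exI[of _ "Some P0"])
next
  case (Improper P0 r)
  then have "P0 = Null" by (cases P0) auto
  then show ?case
    using frun.Improper[of G \<theta> r] Improper.prems Improper.hyps
    by (intro exI[of _ r] exI[of _ None]) auto
qed

lemma fred_sound:
  assumes "fred p0 F0 tr po F S" "satisfies l \<theta> G F S" "\<And>c. fv_proc (p0 c) = {}"
  shows "\<exists>r Q. brun G \<theta> (p0 c) (chan c tr) r Q \<and>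
    (\<forall>p. po = Some p \<longrightarrow> (\<exists>q. Q = Some q \<and> sim q r l (p c)))"
  using assms(1,2)
proof (induction arbitrary: c rule: fred.induct)
  case Nil
  have "sim (p0 c) Map.empty l (p0 c)" by (rule sim_refl) (simp add: assms(3))
  then show ?case by simp
next
  case (snoc tr p F S b Q F' S')
  have sat: "satisfies l \<theta> G F' S'" using snoc.prems by simp
  have sat': "satisfies l \<theta> G F S"
    using satisfies_mono[OF sat] foc_effect[OF snoc.hyps(2)] by blast
  obtain r q where q: "brun G \<theta> (p0 c) (chan c tr) r (Some q)" "sim q r l (p c)"
    using snoc.IH[OF sat', of c] by auto
  show ?case
  proof (cases "c = fst b")
    case False
    then show ?thesis using q by (intro exI[of _ r] exI[of _ "Some q"]) auto
  next
    case True
    obtain r' Q0 where f: "frun G \<theta> IPlus r q (io b) r' Q0"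
      "rel_option (\<lambda>q0 q. sim q0 r' l q) Q0 Q"
      using foc_sound[OF snoc.hyps(2) sat] q(2) True by blast
    have "brun G \<theta> (p0 c) (chan c (tr @ [b])) r' Q0"
      using q(1) f(1) True by auto
    moreover have "\<exists>q. Q0 = Some q \<and> sim q r' l (p' c)"
      if p': "map_option (\<lambda>Q. p(fst b := Q)) Q = Some p'" for p'
      using that f(2) True by (cases Q; cases Q0) auto
    ultimately show ?thesis by blast
  qed
qed

section \<open>Symbolic executions from concrete runs, with variables allocated in advance\<close>

context
  fixes \<xi> :: "'v \<Rightarrow> 'x" and V :: "'v set" and U :: "'x set"
    and l :: "'x \<rightharpoonup> ('f, 'n, 'x, 'w) msg" and \<theta> :: "('f, 'n, 'x, 'w, 'v) soln"
    and G :: "('f, 'n, 'x, 'w) frame"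
  assumes inj: "inj_on \<xi> V" and U: "\<xi> ` V \<inter> U = {}"
    and l: "\<And>X. X \<in> V \<Longrightarrow> l (\<xi> X) = Some (hsubst G (the (\<theta> X)))"
begin

text \<open>The variables of the current process lie in \<open>U\<close> or were allocated for
  earlier inputs, so \<open>\<xi> X\<close> is fresh for a new \<open>X\<close> by injectivity.
  Fixing \<open>\<xi>\<close> beforehand lets one substitution \<open>l\<close> serve the whole
  execution.\<close>

lemma frun_complete:
  assumes "frun G \<theta> \<l> r P0 tr r' Q0" "sim P0 r l P" "satisfies l \<theta> G F S"
    and "csys_inv Sig F S" "basic Sig c P" "fv_proc P \<subseteq> ded1 S" "allocated \<xi> V S"
    and "allvars_proc P \<subseteq> U \<union> \<xi> ` ded2 S" "set (ins_list tr) \<subseteq> V - ded2 S" "distinct (ins_list tr)"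
    and "set (outs_list tr) \<inter> dom F = {}" "distinct (outs_list tr)"
  shows "\<exists>Q F' S'. foc \<l> (P, F, S) tr (Q, F', S') \<and> rel_option (\<lambda>q0 q. sim q0 r' l q) Q0 Q \<and>
    satisfies l \<theta> G F' S' \<and> allocated \<xi> V S' \<and>
    (\<forall>q. Q = Some q \<longrightarrow> allvars_proc q \<subseteq> U \<union> \<xi> ` ded2 S')"
  using assms
proof (induction arbitrary: P F S rule: frun.induct)
  case (In r y X P1' tr r' Q0 \<l> d)
  from In.prems(1) obtain P1 where P: "P = In d y P1"
    "\<And>t. sim P1' (r(y \<mapsto> t)) (l(y \<mapsto> t)) P1" by (auto simp del: fun_upd_apply)
  let ?x = "\<xi> X"
  have X: "X \<in> V" "X \<notin> ded2 S" using In.prems by auto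
  have x: "?x \<notin> U \<union> \<xi> ` ded2 S"
    using X inj U In.prems(6) unfolding allocated_def by (auto dest: inj_onD)
  then have fresh: "?x \<notin> allvars_proc P"  "?x \<notin> fv1_csys (F, S)"
    using In.prems(3,7) ded1_allocated[OF In.prems(6)] unfolding csys_inv_def by auto
  have "X \<notin> fv2_csys (F, S)" using In.prems(3) X unfolding csys_inv_def by auto
  then have st: "step (P, F, S) (AIn d X) (rename_proc y ?x P1, F, insert (Ded (dom F) X ?x) S)"
    using fresh step.In[of ?x d y P1 F S X] by (simp add: P(1))
  let ?S = "insert (Ded (dom F) X ?x) S"
  have "sim P1' (r(y \<mapsto> hsubst G (the (\<theta> X)))) l (rename_proc y ?x P1)"
    by (rule sim_rename[OF P(2)]) (use fresh P(1) l[OF X(1)] in auto)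
  moreover have "satisfies l \<theta> G F ?S"
    using In.prems(2) l[OF X(1)] unfolding satisfies_def by (auto simp: eq_E.refl)
  moreover note step_inv[OF st In.prems(3,4,5)]
  moreover have "allocated \<xi> V ?S" using In.prems(6) X unfolding allocated_def by auto
  moreover have "allvars_proc (rename_proc y ?x P1) \<subseteq> U \<union> \<xi> ` ded2 ?S"
    using allvars_rename_proc[of y ?x P1] In.prems(7) P(1) by auto
  moreover have "set (ins_list tr) \<subseteq> V - ded2 ?S" "distinct (ins_list tr)"
    "set (outs_list tr) \<inter> dom F = {}" "distinct (outs_list tr)"
    using In.prems(8-11) by auto
  ultimately obtain Q F' S' where "foc IStar (rename_proc y ?x P1, F, ?S) tr (Q, F', S')"
    "rel_option (\<lambda>q0 q. sim q0 r' l q) Q0 Q" "satisfies l \<theta> G F' S'" "allocated \<xi> V S'"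
    "\<forall>q. Q = Some q \<longrightarrow> allvars_proc q \<subseteq> U \<union> \<xi> ` ded2 S'"
    using In.IH[of "rename_proc y ?x P1" F ?S] by blast
  then show ?case using foc.In[OF st _ In.hyps(2)] by blast
next
  case (Out w t r u' P1' tr r' Q0 \<l> d)
  from Out.prems(1) obtain u P1 where P: "P = Out d u P1" "xsubst r u' \<approx> xsubst l u" "sim P1' r l P1"
    by auto
  have w: "w \<notin> dom F" using Out.prems(10) by simp
  then have "w \<notin> handles_csys (F, S)" using Out.prems(3) unfolding csys_inv_def by auto
  then have st: "step (P, F, S) (AOut d w) (P1, F(w \<mapsto> u), S)"
    unfolding P(1) by (rule step.Out)
  have "xsubst l u \<approx> t" using P(2) Out.hyps(2) eq_E.sym eq_E.trans by blast
  then have "satisfies l \<theta> G (F(w \<mapsto> u)) S"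
    using Out.prems(2) Out.hyps(1) unfolding satisfies_def by auto
  moreover note step_inv[OF st Out.prems(3,4,5)]
  moreover have "allvars_proc P1 \<subseteq> U \<union> \<xi> ` ded2 S" using Out.prems(7) P(1) by auto
  moreover have "set (ins_list tr) \<subseteq> V - ded2 S" "distinct (ins_list tr)"
    "set (outs_list tr) \<inter> dom (F(w \<mapsto> u)) = {}" "distinct (outs_list tr)"
    using Out.prems(8-11) by auto
  ultimately obtain Q F' S' where "foc OStar (P1, F(w \<mapsto> u), S) tr (Q, F', S')"
    "rel_option (\<lambda>q0 q. sim q0 r' l q) Q0 Q" "satisfies l \<theta> G F' S'" "allocated \<xi> V S'"
    "\<forall>q. Q = Some q \<longrightarrow> allvars_proc q \<subseteq> U \<union> \<xi> ` ded2 S'"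
    using Out.IH[OF P(3), of "F(w \<mapsto> u)" S] Out.prems(6) by blast
  then show ?case using foc.Out[OF st _ Out.hyps(4)] by blast
next
  case (Then r u' v' \<l> P1' tr r' Q0 P2')
  from Then.prems(1) obtain u v P1 P2 where P: "P = If u v P1 P2"
    "xsubst r u' \<approx> xsubst l u" "xsubst r v' \<approx> xsubst l v" "sim P1' r l P1" by auto
  have st: "step (P, F, S) Tau (P1, F, insert (Eq u v) S)" unfolding P(1) by (rule step.Then)
  have "xsubst l u \<approx> xsubst l v" using Then.hyps(1) eqE_iff[OF P(2,3)] by blast
  then have "satisfies l \<theta> G F (insert (Eq u v) S)"
    using Then.prems(2) unfolding satisfies_def by auto
  moreover note step_inv[OF st Then.prems(3,4,5)]
  moreover have "allocated \<xi> V (insert (Eq u v) S)" using Then.prems(6) unfolding allocated_def by simp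
  moreover have "allvars_proc P1 \<subseteq> U \<union> \<xi> ` ded2 (insert (Eq u v) S)" using Then.prems(7) P(1) by auto
  moreover have "set (ins_list tr) \<subseteq> V - ded2 (insert (Eq u v) S)" using Then.prems(8) by simp
  ultimately obtain Q F' S' where "foc \<l> (P1, F, insert (Eq u v) S) tr (Q, F', S')"
    "rel_option (\<lambda>q0 q. sim q0 r' l q) Q0 Q" "satisfies l \<theta> G F' S'" "allocated \<xi> V S'"
    "\<forall>q. Q = Some q \<longrightarrow> allvars_proc q \<subseteq> U \<union> \<xi> ` ded2 S'"
    using Then.IH[OF P(4), of F "insert (Eq u v) S"] Then.prems(9-11) by blast
  then show ?case using foc.Tau[OF st] by blast
next
  case (Else r u' v' \<l> P2' tr r' Q0 P1')
  from Else.prems(1) obtain u v P1 P2 where P: "P = If u v P1 P2"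
    "xsubst r u' \<approx> xsubst l u" "xsubst r v' \<approx> xsubst l v" "sim P2' r l P2" by auto
  have st: "step (P, F, S) Tau (P2, F, insert (Neq u v) S)" unfolding P(1) by (rule step.Else)
  have "\<not> xsubst l u \<approx> xsubst l v" using Else.hyps(1) eqE_iff[OF P(2,3)] by blast
  then have "satisfies l \<theta> G F (insert (Neq u v) S)"
    using Else.prems(2) unfolding satisfies_def by auto
  moreover note step_inv[OF st Else.prems(3,4,5)]
  moreover have "allocated \<xi> V (insert (Neq u v) S)" using Else.prems(6) unfolding allocated_def by simp
  moreover have "allvars_proc P2 \<subseteq> U \<union> \<xi> ` ded2 (insert (Neq u v) S)" using Else.prems(7) P(1) by auto
  moreover have "set (ins_list tr) \<subseteq> V - ded2 (insert (Neq u v) S)" using Else.prems(8) by simp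
  ultimately obtain Q F' S' where "foc \<l> (P2, F, insert (Neq u v) S) tr (Q, F', S')"
    "rel_option (\<lambda>q0 q. sim q0 r' l q) Q0 Q" "satisfies l \<theta> G F' S'" "allocated \<xi> V S'"
    "\<forall>q. Q = Some q \<longrightarrow> allvars_proc q \<subseteq> U \<union> \<xi> ` ded2 S'"
    using Else.IH[OF P(4), of F "insert (Neq u v) S"] Else.prems(9-11) by blast
  then show ?case using foc.Tau[OF st] by blast
next
  case (Proper P0 r)
  have "P = Null \<or> (\<exists>c x P'. P = In c x P')"
    using sim_Null_or_In[OF Proper.prems(1)] Proper.hyps by blast
  then have "foc OStar (P, F, S) [] (Some P, F, S)" by (rule foc.Proper)
  moreover have "rel_option (\<lambda>q0 q. sim q0 r l q) (Some P0) (Some P)" using Proper.prems(1) by simp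
  ultimately show ?case using Proper.prems(2,6,7) by blast
next
  case (Improper r)
  then have "P = Null" by simp
  then have "foc IStar (P, F, S) [] (None, F, S)" by (simp add: foc.Improper)
  moreover have "rel_option (\<lambda>q0 q. sim q0 r l q) None None" by simp
  ultimately show ?case using Improper.prems(2,6) by blast
qed

lemma fred_complete:
  assumes p0: "\<And>c. basic Sig c (p0 c)" "\<And>c. fv_proc (p0 c) = {}" "\<And>c. allvars_proc (p0 c) \<subseteq> U"
    and F0: "ran F0 \<subseteq> ground_terms Sig" "\<And>w. w \<in> dom F0 \<Longrightarrow> G w = F0 w"
    and "wf_tr (dom F0) tr" "tr_ins tr \<subseteq> V"
    and "\<And>c. \<exists>r Q. brun G \<theta> (p0 c) (chan c tr) r Q"
  shows "\<exists>po F S. fred p0 F0 tr po F S \<and> satisfies l \<theta> G F S \<and> allocated \<xi> V S \<and>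
    (po = None \<longrightarrow> (\<exists>b \<in> set tr. outs b = [])) \<and>
    (\<forall>p. po = Some p \<longrightarrow> (\<forall>c. allvars_proc (p c) \<subseteq> U \<union> \<xi> ` ded2 S \<and>
       (\<exists>r q. brun G \<theta> (p0 c) (chan c tr) r (Some q) \<and> sim q r l (p c))))"
  using assms(6-8)
proof (induction tr rule: rev_induct)
  case Nil
  have "sim (p0 c) Map.empty l (p0 c)" for c by (rule sim_refl) (simp add: p0(2))
  moreover have "satisfies l \<theta> G F0 {}"
  proof -
    have "\<exists>t. G w = Some t \<and> xsubst l u \<approx> t" if w: "F0 w = Some u" for w u
    proof -
      have "vars u = {}" using w F0(1) ground_vars[of u Sig] by (auto simp: ran_def)
      then have "xsubst l u = xsubst Map.empty u" by (intro xsubst_eq) simp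
      moreover have "xsubst Map.empty u = u"
        unfolding xsubst_def by (induction u) (auto split: atom.split intro: map_idI)
      ultimately show ?thesis using F0(2)[OF domI[of F0, OF w]] w by (simp add: eq_E.refl)
    qed
    then show ?thesis by (simp add: satisfies_def)
  qed
  ultimately show ?case
    using fred.Nil[of p0 F0] p0(3)
    by (intro exI[of _ "Some p0"] exI[of _ F0] exI[of _ "{}"]) (auto simp: allocated_def)
next
  case (snoc b tr)
  let ?c = "fst b"
  have proper: "\<forall>b \<in> set tr. outs b \<noteq> []" using snoc.prems(1) by (simp add: wf_tr_def)
  have wf: "wf_tr (dom F0) tr"
    using snoc.prems(1) unfolding wf_tr_def by (auto dest: in_set_butlastD)
  have br: "\<exists>r Q. brun G \<theta> (p0 c) (chan c tr) r Q" for c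
    using snoc.prems(3)[of c] brun_prefix by (metis chan_simps(3))
  obtain po F S where IH: "fred p0 F0 tr po F S" "satisfies l \<theta> G F S" "allocated \<xi> V S"
    "po = None \<longrightarrow> (\<exists>b \<in> set tr. outs b = [])"
    "\<forall>p. po = Some p \<longrightarrow> (\<forall>c. allvars_proc (p c) \<subseteq> U \<union> \<xi> ` ded2 S \<and>
       (\<exists>r q. brun G \<theta> (p0 c) (chan c tr) r (Some q) \<and> sim q r l (p c)))"
    using snoc.IH[OF wf _ br] snoc.prems(2) unfolding tr_simps Un_subset_iff by blast
  \<comment> \<open>Only an improper block leaves \<open>None\<close>, and no block of
    \<open>tr\<close> is improper because \<open>b\<close> follows.\<close>
  obtain p where p: "po = Some p" using IH(4) proper by auto
  have av: "allvars_proc (p c) \<subseteq> U \<union> \<xi> ` ded2 S" for c using IH(5) p by blast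
  have sm: "\<exists>r q. brun G \<theta> (p0 c) (chan c tr) r (Some q) \<and> sim q r l (p c)" for c
    using IH(5) p by blast
  note inv = fred_inv[OF IH(1) p0(1,2) F0(1)]
  have inv': "csys_inv Sig F S" "basic Sig ?c (p ?c)" "fv_proc (p ?c) \<subseteq> ded1 S"
    "dom F = dom F0 \<union> tr_outs tr" "ded2 S = tr_ins tr"
    using inv p by auto
  obtain r1 q1 r1' Q0 where q1: "brun G \<theta> (p0 ?c) (chan ?c tr) r1 (Some q1)"
    "frun G \<theta> IPlus r1 q1 (io b) r1' Q0"
    using snoc.prems(3)[of ?c] by auto
  obtain r q where q: "brun G \<theta> (p0 ?c) (chan ?c tr) r (Some q)" "sim q r l (p ?c)"
    using sm by blast
  \<comment> \<open>The given run on this channel need not be the one that simulates the symbolic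
    process; determinism identifies their states, modulo \<open>E\<close> for the
    environments.\<close>
  have "env_eq r1 r \<and> Some q1 = Some q"
    using brun_determ[OF q1(1) q(1)] eq_E.refl by blast
  then obtain r' where r': "frun G \<theta> IPlus r q (io b) r' Q0"
    using frun_env_eq[OF q1(2), of r G \<theta>] eq_E.refl rel_option_eqE_refl by blast
  have "set (ins_list (io b)) \<subseteq> V - ded2 S" "distinct (ins_list (io b))"
    "set (outs_list (io b)) \<inter> dom F = {}" "distinct (outs_list (io b))"
    using snoc.prems(1,2) inv'(4,5) unfolding wf_tr_def set_concat_ins[symmetric] set_concat_outs[symmetric]
    by auto
  then obtain Q F' S' where Q: "foc IPlus (p ?c, F, S) (io b) (Q, F', S')"
    "satisfies l \<theta> G F' S'" "allocated \<xi> V S'" "\<forall>q. Q = Some q \<longrightarrow> allvars_proc q \<subseteq> U \<union> \<xi> ` ded2 S'"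
    "rel_option (\<lambda>q0 q. sim q0 r' l q) Q0 Q"
    using frun_complete[OF r' q(2) IH(2) inv'(1-3) IH(3) av] by blast
  let ?po = "map_option (\<lambda>Q. p(?c := Q)) Q" and ?S = "insert (Dep (ins b) (dep tr ?c)) S'"
  note e = foc_effect[OF Q(1)]
  have "ins b \<noteq> []" using snoc.prems(1) by (simp add: wf_tr_def)
  then have "fred p0 F0 (tr @ [b]) ?po F' ?S" using fred.snoc[of p0 F0 tr p F S b] IH(1) p Q(1) by blast
  moreover have "satisfies l \<theta> G F' ?S" using Q(2) by simp
  moreover have "allocated \<xi> V ?S" using Q(3) by (simp add: allocated_def)
  moreover have "?po = None \<longrightarrow> (\<exists>b \<in> set (tr @ [b]). outs b = [])"
    using e by simp
  moreover have "allvars_proc (p' c) \<subseteq> U \<union> \<xi> ` ded2 ?S" if p': "?po = Some p'" for p' c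
  proof -
    have "ded2 S \<subseteq> ded2 S'" using e by blast
    then have "U \<union> \<xi> ` ded2 S \<subseteq> U \<union> \<xi> ` ded2 S'" by blast
    then have "allvars_proc (p c) \<subseteq> U \<union> \<xi> ` ded2 S'" using av[of c] by (rule order_trans[rotated])
    then show ?thesis using p' Q(4) by (cases "c = ?c") auto
  qed
  moreover have "\<exists>r q. brun G \<theta> (p0 c) (chan c (tr @ [b])) r (Some q) \<and> sim q r l (p' c)"
    if p': "?po = Some p'" for p' c
  proof (cases "c = ?c")
    case False
    then have "p' c = p c" using p' by auto
    then show ?thesis using sm[of c] False by simp
  next
    case True
    obtain Q' where Q': "Q = Some Q'" "p' = p(?c := Q')" using p' by auto
    obtain q' where q': "Q0 = Some q'" "sim q' r' l Q'"
      using Q(5) Q'(1) by (cases Q0) auto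
    have "brun G \<theta> (p0 ?c) (chan ?c (tr @ [b])) r' (Some q')"
      using q(1) r' q'(1) by auto
    then show ?thesis using q'(2) Q'(2) True by auto
  qed
  ultimately show ?case by blast
qed

end

section \<open>Reduced inclusions as inclusions of concrete executions\<close>

lemma recs_iff:
  "recs \<theta> D tr \<longleftrightarrow> (\<forall>s1 b s2. tr = s1 @ b # s2 \<longrightarrow>
     (\<forall>X \<in> set (ins b). the (\<theta> X) \<in> recipes Sig (D \<union> tr_outs s1)))"
proof
  assume r: "recs \<theta> D tr"
  show "\<forall>s1 b s2. tr = s1 @ b # s2 \<longrightarrow>
     (\<forall>X \<in> set (ins b). the (\<theta> X) \<in> recipes Sig (D \<union> tr_outs s1))"
  proof (intro allI impI)
    fix s1 b s2 assume "tr = s1 @ b # s2"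
    then show "\<forall>X \<in> set (ins b). the (\<theta> X) \<in> recipes Sig (D \<union> tr_outs s1)" using r by simp
  qed
next
  assume a: "\<forall>s1 b s2. tr = s1 @ b # s2 \<longrightarrow>
     (\<forall>X \<in> set (ins b). the (\<theta> X) \<in> recipes Sig (D \<union> tr_outs s1))"
  have "recs \<theta> (D \<union> tr_outs s) s'" if "tr = s @ s'" for s s'
    using that
  proof (induction s' arbitrary: s)
    case (Cons b s')
    moreover have "\<forall>X \<in> set (ins b). the (\<theta> X) \<in> recipes Sig (D \<union> tr_outs s)"
      using a Cons.prems by blast
    ultimately show ?case using Cons.IH[of "s @ [b]"] by (simp add: Un_assoc)
  qed simp
  from this[of "[]" tr] show "recs \<theta> D tr" by simp
qed

definition deps2 :: "('f, 'n, 'x, 'w, 'v) soln \<Rightarrow> ('c::linorder, 'w, 'v) block list \<Rightarrow> bool" where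
  "deps2 \<theta> tr \<longleftrightarrow> (\<forall>s1 b s2. tr = s1 @ b # s2 \<longrightarrow> dep s1 (fst b) = {} \<or>
     (\<exists>X \<in> set (ins b). \<exists>w \<in> dep s1 (fst b). w \<in> handles (the (\<theta> X))))"

abbreviation lframe ::
  "('f, 'n, 'x, 'w) frame \<Rightarrow> ('f, 'n, 'x, 'w, 'v) constr set \<Rightarrow> ('f, 'n, 'x, 'w, 'v) soln
   \<Rightarrow> ('f, 'n, 'x, 'w) frame" where
  "lframe F S \<theta> \<equiv> inst_frame F (lambda_of Sig E (F, S) \<theta>)"

lemma xsubst_ground_id: "u \<in> ground_terms Sig \<Longrightarrow> xsubst l u = u"
  unfolding ground_terms_def xsubst_def
  by (induction u rule: terms.induct) (auto intro: map_idI)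

lemma fred_facts:
  assumes "ext_state Sig p0 F0" "fred p0 F0 tr po F S"
  shows "csys_inv Sig F S" "F0 \<subseteq>\<^sub>m F" "dom F = dom F0 \<union> tr_outs tr" "ded2 S = tr_ins tr"
    "wf_tr (dom F0) tr"
    "\<And>s1 b s2 X. tr = s1 @ b # s2 \<Longrightarrow> X \<in> set (ins b) \<Longrightarrow>
       ded_dom (without_deps (F, S)) X = dom F0 \<union> tr_outs s1"
    "\<And>Xs W. Dep Xs W \<in> S \<longleftrightarrow> (\<exists>s1 b s2. tr = s1 @ b # s2 \<and> Xs = ins b \<and> W = dep s1 (fst b))"
proof -
  note inv = fred_inv[OF assms(2), of Sig]
  have p0: "\<And>c. basic Sig c (p0 c)" "\<And>c. fv_proc (p0 c) = {}" "ran F0 \<subseteq> ground_terms Sig"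
    using assms(1) by (auto simp: ext_state_def)
  note i = inv[OF p0]
  show c: "csys_inv Sig F S" using i by (elim conjE)
  show "F0 \<subseteq>\<^sub>m F" using i by (elim conjE)
  show "dom F = dom F0 \<union> tr_outs tr" using i by (elim conjE)
  show "ded2 S = tr_ins tr" using i by (elim conjE)
  show "wf_tr (dom F0) tr" using i by (elim conjE)
  show "ded_dom (without_deps (F, S)) X = dom F0 \<union> tr_outs s1"
    if X: "tr = s1 @ b # s2" "X \<in> set (ins b)" for s1 b s2 X
  proof -
    have "\<forall>s1 b s2 X. tr = s1 @ b # s2 \<longrightarrow> X \<in> set (ins b) \<longrightarrow>
        (\<exists>x. Ded (dom F0 \<union> tr_outs s1) X x \<in> S)" using i by (elim conjE)
    then obtain x where "Ded (dom F0 \<union> tr_outs s1) X x \<in> S" using X by blast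
    then show ?thesis by (rule csys_inv_ded_dom[OF c])
  qed
  show "Dep Xs W \<in> S \<longleftrightarrow> (\<exists>s1 b s2. tr = s1 @ b # s2 \<and> Xs = ins b \<and> W = dep s1 (fst b))" for Xs W
  proof -
    have "\<forall>Xs W. Dep Xs W \<in> S \<longleftrightarrow> (\<exists>s1 b s2. tr = s1 @ b # s2 \<and> Xs = ins b \<and> W = dep s1 (fst b))"
      using i by (elim conjE)
    then show ?thesis by blast
  qed
qed

lemma recs_ded_dom:
  assumes "ext_state Sig p0 F0" "fred p0 F0 tr po F S"
  shows "recs \<theta> (dom F0) tr \<longleftrightarrow>
    (\<forall>X \<in> tr_ins tr. the (\<theta> X) \<in> recipes Sig (ded_dom (without_deps (F, S)) X))"
proof -
  have "(\<forall>s1 b s2. tr = s1 @ b # s2 \<longrightarrow>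
      (\<forall>X \<in> set (ins b). the (\<theta> X) \<in> recipes Sig (dom F0 \<union> tr_outs s1))) \<longleftrightarrow>
    (\<forall>s1 b s2. tr = s1 @ b # s2 \<longrightarrow>
      (\<forall>X \<in> set (ins b). the (\<theta> X) \<in> recipes Sig (ded_dom (without_deps (F, S)) X)))"
    by (intro iff_allI imp_cong ball_cong HOL.refl) (drule (1) fred_facts(6)[OF assms], simp only:)
  also have "\<dots> \<longleftrightarrow> (\<forall>b \<in> set tr. \<forall>X \<in> set (ins b). the (\<theta> X) \<in> recipes Sig (ded_dom (without_deps (F, S)) X))"
    by (intro iffI ballI allI impI) (drule split_list, blast, simp)
  finally show ?thesis by (simp add: recs_iff tr_ins_def)
qed

text \<open>The symbolic frame instantiated by the associated substitution can itself play the final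
  frame in \<open>satisfies\<close>, which is what \<open>fred_sound\<close> asks for.\<close>

lemma fred_conc:
  assumes p0: "ext_state Sig p0 F0" and f: "fred p0 F0 tr po F S"
    and sol: "\<theta> \<in> Sol Sig E (without_deps (F, S))"
  shows "conc p0 F0 tr \<theta> (lframe F S \<theta>)"
proof -
  note facts = fred_facts[OF p0 f]
  let ?l = "lambda_of Sig E (F, S) \<theta>"
  have l: "is_lambda Sig E (without_deps (F, S)) \<theta> ?l"
    using sol someI_ex[of "is_lambda Sig E (without_deps (F, S)) \<theta>"]
    by (simp add: Sol_def lambda_of_def)
  then have dl: "dom ?l = ded1 S" and rl: "ran ?l \<subseteq> ground_terms Sig"
    by (auto simp: is_lambda_def csys_inv_fv1[OF facts(1)])
  have dF: "dom (lframe F S \<theta>) = dom F" by (auto simp: inst_frame_def)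
  have "satisfies ?l \<theta> (lframe F S \<theta>) F S"
  proof -
    have "\<exists>t. ?l x = Some t \<and> hsubst (lframe F S \<theta>) (the (\<theta> X)) \<approx> t" if D: "Ded D X x \<in> S" for D X x
    proof -
      have "x \<in> dom ?l" unfolding dl using D by (auto simp: ded1_def)
      then obtain t where "?l x = Some t" by blast
      moreover have "hsubst (lframe F S \<theta>) (the (\<theta> X)) \<approx> the (?l x)"
        using l D by (simp add: is_lambda_def)
      ultimately show ?thesis by simp
    qed
    then show ?thesis
      using l unfolding satisfies_def is_lambda_def by (simp add: inst_frame_def eq_E.refl)
  qed
  then have "\<exists>r Q. brun (lframe F S \<theta>) \<theta> (p0 c) (chan c tr) r Q" for c
    using fred_sound[OF f, of ?l \<theta> "lframe F S \<theta>" c] p0 by (auto simp: ext_state_def)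
  moreover have "dom \<theta> = tr_ins tr"
    using sol csys_inv_fv2[OF facts(1)] facts(4) by (simp add: Sol_def)
  moreover have "recs \<theta> (dom F0) tr"
    unfolding recs_ded_dom[OF p0 f]
    using sol csys_inv_fv2[OF facts(1)] facts(4) by (simp add: Sol_def)
  moreover have "lframe F S \<theta> w = F0 w" if w: "w \<in> dom F0" for w
  proof -
    have "F w = F0 w" using facts(2) w by (auto simp: map_le_def)
    moreover obtain u where u: "F0 w = Some u" using w by auto
    moreover have "u \<in> ground_terms Sig" using p0 u by (auto simp: ext_state_def ran_def)
    ultimately show ?thesis using xsubst_ground_id by (simp add: inst_frame_def)
  qed
  moreover have "ran (lframe F S \<theta>) \<subseteq> ground_terms Sig"
  proof
    fix t assume "t \<in> ran (lframe F S \<theta>)"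
    then obtain w u where u: "F w = Some u" "t = xsubst ?l u"
      by (auto simp: ran_def inst_frame_def)
    have "u \<in> messages Sig" "vars u \<subseteq> ded1 S"
      using facts(1) u unfolding csys_inv_def fv1_csys_def by (auto simp: ran_def)
    then show "t \<in> ground_terms Sig" unfolding u(2) using dl rl by (intro xsubst_ground) auto
  qed
  ultimately show ?thesis using facts dF unfolding conc_def by simp
qed

text \<open>Makes the arbitrary choice in \<open>lambda_of\<close> harmless: the frame it yields can
  be compared with any other one for the same trace and recipes.\<close>

lemma conc_unique:
  assumes "conc p0 F0 tr \<theta> F" "conc p0 F0 tr \<theta> G"
  shows "env_eq F G"
  unfolding env_eq_def
proof
  fix w
  show "rel_option (\<approx>) (F w) (G w)"
  proof (cases "w \<in> dom F0 \<union> tr_outs tr")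
    case True
    show ?thesis
    proof (rule conc_determ[OF _ _ _ _ _ True])
      show "wf_tr (dom F0) tr" "recs \<theta> (dom F0) tr" using assms(1) by (simp_all add: conc_def)
      show "\<exists>r Q. brun F \<theta> (p0 c) (chan c tr) r Q"
        "\<exists>r Q. brun G \<theta> (p0 c) (chan c tr) r Q" for c
        using assms by (simp_all add: conc_def)
      show "rel_option (\<approx>) (F w) (G w)" if "w \<in> dom F0" for w
        using assms that unfolding conc_def by (simp add: rel_option_eqE_refl)
    qed
  next
    case False
    then have "F w = None" "G w = None" using assms unfolding conc_def by blast+
    then show ?thesis by simp
  qed
qed

lemma conc_fred:
  fixes \<theta> :: "('f, 'n, 'x, 'w, 'v) soln"
  assumes inf: "infinite (UNIV :: 'x set)" and p0: "ext_state Sig p0 F0"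
    and c: "conc p0 F0 tr \<theta> G"
  shows "\<exists>po F S. fred p0 F0 tr po F S \<and> \<theta> \<in> Sol Sig E (without_deps (F, S))"
proof -
  let ?V = "tr_ins tr" and ?U = "\<Union>c \<in> {c. p0 c \<noteq> Null}. allvars_proc (p0 c)"
  have bas: "\<And>c. basic Sig c (p0 c)" "\<And>c. fv_proc (p0 c) = {}" and F0: "ran F0 \<subseteq> ground_terms Sig"
    and fin: "finite {c. p0 c \<noteq> Null}"
    using p0 by (auto simp: ext_state_def)
  have av: "allvars_proc (p0 c) \<subseteq> ?U" for c by (cases "p0 c = Null") auto
  have "finite ?U" using fin finite_allvars_proc by blast
  then have "infinite (- ?U)" using inf by (simp add: Compl_eq_Diff_UNIV)
  moreover have "finite ?V" by (simp add: tr_ins_def)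
  \<comment> \<open>One variable per input, away from the finitely many variables of the initial
    processes.\<close>
  ultimately obtain W where "finite W" "card W = card ?V" "W \<subseteq> - ?U"
    using infinite_arbitrarily_large by metis
  then obtain \<xi> where "bij_betw \<xi> ?V W"
    using finite_same_card_bij \<open>finite ?V\<close> by metis
  then have inj: "inj_on \<xi> ?V" and im: "\<xi> ` ?V \<inter> ?U = {}"
    using \<open>W \<subseteq> - ?U\<close> unfolding bij_betw_def by auto
  \<comment> \<open>Forced by the deducibility constraints: each allocated variable takes the value
    of its recipe in the final frame.\<close>
  define l where "l x = (if x \<in> \<xi> ` ?V then Some (hsubst G (the (\<theta> (the_inv_into ?V \<xi> x)))) else None)" for x
  have l: "l (\<xi> X) = Some (hsubst G (the (\<theta> X)))" if "X \<in> ?V" for X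
    using that the_inv_into_f_f[OF inj that] by (simp add: l_def)
  have wf: "wf_tr (dom F0) tr" and G0: "\<And>w. w \<in> dom F0 \<Longrightarrow> G w = F0 w" and rc: "recs \<theta> (dom F0) tr"
    and br: "\<And>c. \<exists>r Q. brun G \<theta> (p0 c) (chan c tr) r Q"
    and dG: "dom G = dom F0 \<union> tr_outs tr" and rG: "ran G \<subseteq> ground_terms Sig" and d\<theta>: "dom \<theta> = ?V"
    using c by (auto simp: conc_def)
  obtain po F S where f: "fred p0 F0 tr po F S" and sat: "satisfies l \<theta> G F S" and al: "allocated \<xi> ?V S"
    using fred_complete[OF inj im l bas av F0 G0 wf subset_refl br] by blast
  note facts = fred_facts[OF p0 f]
  have d1: "dom l = ded1 S"
  proof -
    have "dom l = \<xi> ` ?V" by (auto simp: l_def split: if_splits)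
    then show ?thesis using ded1_allocated[OF al] facts(4) by simp
  qed
  have hs: "hsubst (inst_frame F l) M \<approx> hsubst G M" if M: "handles M \<subseteq> dom F" for M
  proof (rule eqE_hsubst)
    fix w assume "w \<in> handles M"
    then obtain u where u: "F w = Some u" using M by auto
    then obtain t where "G w = Some t" "xsubst l u \<approx> t" using sat unfolding satisfies_def by blast
    then show "rel_option (\<approx>) (inst_frame F l w) (G w)" using u by (simp add: inst_frame_def)
  qed
  have rec: "the (\<theta> X) \<in> recipes Sig (dom F)" if "X \<in> ?V" for X
    using recs_in[OF rc that] facts(3) by simp
  have "is_lambda Sig E (without_deps (F, S)) \<theta> l"
    unfolding is_lambda_def without_deps_Ded csys_inv_fv1[OF facts(1)]
  proof (intro conjI allI impI)
    show "dom l = ded1 S" by (rule d1)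
    show "ran l \<subseteq> ground_terms Sig"
    proof
      fix t assume "t \<in> ran l"
      then obtain X where X: "X \<in> ?V" "t = hsubst G (the (\<theta> X))"
        using l by (auto simp: ran_def l_def split: if_splits)
      then show "t \<in> ground_terms Sig"
        using hsubst_ground[OF recs_in[OF rc X(1)] _ rG] dG by simp
    qed
    fix D X x assume D: "Ded D X x \<in> S"
    then have X: "X \<in> ?V" using facts(4) by (auto simp: ded2_def)
    have "the (l x) = hsubst G (the (\<theta> X))" using al D l[OF X] unfolding allocated_def by auto
    then show "hsubst (inst_frame F l) (the (\<theta> X)) \<approx> the (l x)"
      using hs[OF recipes_handles[OF rec[OF X]]] by simp
  qed (use sat in \<open>auto simp: satisfies_def\<close>)
  then have "\<theta> \<in> Sol Sig E (without_deps (F, S))"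
    unfolding Sol_def using csys_inv_well_formed[OF facts(1)] csys_inv_fv2[OF facts(1)] facts(4) d\<theta>
      rc[unfolded recs_ded_dom[OF p0 f]] by auto
  then show ?thesis using f by blast
qed

lemma Sol1_deps1:
  assumes p0: "ext_state Sig p0 F0" and f: "fred p0 F0 tr po F S"
  shows "\<theta> \<in> Sol1 Sig E (F, S) \<longleftrightarrow> \<theta> \<in> Sol Sig E (without_deps (F, S)) \<and>
    deps1 \<theta> (lframe F S \<theta>) (dom F0) tr"
proof -
  note facts = fred_facts[OF p0 f]
  have "(\<forall>Xs W. Dep Xs W \<in> S \<and> W \<noteq> {} \<longrightarrow>
       (\<exists>X \<in> set Xs. \<forall>M \<in> recipes Sig (ded_dom (without_deps (F, S)) X).
          hsubst (lframe F S \<theta>) M \<approx> hsubst (lframe F S \<theta>) (the (\<theta> X)) \<longrightarrow> handles M \<inter> W \<noteq> {})) \<longleftrightarrow>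
    (\<forall>s1 b s2. tr = s1 @ b # s2 \<longrightarrow> dep s1 (fst b) \<noteq> {} \<longrightarrow>
       (\<exists>X \<in> set (ins b). \<forall>M \<in> recipes Sig (ded_dom (without_deps (F, S)) X).
          hsubst (lframe F S \<theta>) M \<approx> hsubst (lframe F S \<theta>) (the (\<theta> X)) \<longrightarrow> handles M \<inter> dep s1 (fst b) \<noteq> {}))"
    unfolding facts(7) by blast
  also have "\<dots> \<longleftrightarrow> deps1 \<theta> (lframe F S \<theta>) (dom F0) tr"
    unfolding deps1_def using facts(6) by (smt (verit, ccfv_SIG))
  finally show ?thesis by (simp add: Sol1_def)
qed

lemma Sol2_deps2:
  assumes p0: "ext_state Sig p0 F0" and f: "fred p0 F0 tr po F S"
  shows "\<theta> \<in> Sol2 Sig E (F, S) \<longleftrightarrow> \<theta> \<in> Sol Sig E (without_deps (F, S)) \<and> deps2 \<theta> tr"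
proof -
  have "(\<forall>Xs W. Dep Xs W \<in> S \<longrightarrow> W = {} \<or> (\<exists>X \<in> set Xs. \<exists>w \<in> W. w \<in> handles (the (\<theta> X)))) \<longleftrightarrow>
      deps2 \<theta> tr"
    unfolding deps2_def fred_facts(7)[OF p0 f] by blast
  then show ?thesis by (simp add: Sol2_def)
qed

lemma deps1_env_eq:
  assumes "env_eq F G" "deps1 \<theta> F D tr"
  shows "deps1 \<theta> G D tr"
proof -
  have eq: "hsubst F M \<approx> hsubst G M" for M
    by (rule eqE_hsubst) (use assms(1) in \<open>simp add: env_eq_def\<close>)
  have "hsubst F M \<approx> hsubst F N \<longleftrightarrow> hsubst G M \<approx> hsubst G N" for M N by (rule eqE_iff[OF eq eq])
  then show ?thesis using assms(2) unfolding deps1_def by simp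
qed

text \<open>All recipes compared range over the domain of the final frame, so static equivalence
  decides their equality alike on both sides.\<close>

lemma deps1_static_equiv:
  assumes "conc p0 F0 tr \<theta> F" "static_equiv Sig E F G" "deps1 \<theta> F (dom F0) tr"
  shows "deps1 \<theta> G (dom F0) tr"
proof -
  have dF: "dom F = dom F0 \<union> tr_outs tr" and rc: "recs \<theta> (dom F0) tr"
    using assms(1) by (simp_all add: conc_def)
  have "hsubst F M \<approx> hsubst F (the (\<theta> X)) \<longleftrightarrow> hsubst G M \<approx> hsubst G (the (\<theta> X))"
    if tr: "tr = s1 @ b # s2" and X: "X \<in> set (ins b)" and M: "M \<in> recipes Sig (dom F0 \<union> tr_outs s1)"
    for s1 b s2 X M
  proof (rule static_equiv_hsubst[OF assms(2) dF])
    show "M \<in> recipes Sig (dom F0 \<union> tr_outs tr)" using M by (rule recipes_mono) (use tr in auto)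
    show "the (\<theta> X) \<in> recipes Sig (dom F0 \<union> tr_outs tr)" using rc X tr by (intro recs_in) auto
  qed
  then show ?thesis using assms(3) unfolding deps1_def by (smt (verit, ccfv_SIG))
qed

text \<open>The competitor \<open>M\<close> may be the chosen recipe itself.\<close>

lemma deps1_deps2:
  assumes "recs \<theta> D tr" "deps1 \<theta> F D tr"
  shows "deps2 \<theta> tr"
  unfolding deps2_def
proof (intro allI impI)
  fix s1 b s2 assume tr: "tr = s1 @ b # s2"
  show "dep s1 (fst b) = {} \<or> (\<exists>X \<in> set (ins b). \<exists>w \<in> dep s1 (fst b). w \<in> handles (the (\<theta> X)))"
  proof (cases "dep s1 (fst b) = {}")
    case False
    then obtain X where "X \<in> set (ins b)" "\<forall>M \<in> recipes Sig (D \<union> tr_outs s1).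
        hsubst F M \<approx> hsubst F (the (\<theta> X)) \<longrightarrow> handles M \<inter> dep s1 (fst b) \<noteq> {}"
      using assms(2) tr unfolding deps1_def by blast
    moreover have "the (\<theta> X) \<in> recipes Sig (D \<union> tr_outs s1)"
      using assms(1) tr calculation(1) by simp
    ultimately show ?thesis using eq_E.refl by blast
  qed simp
qed

text \<open>\<open>D\<close> constrains only the execution to be matched; in both uses the matching
  one inherits the condition.\<close>

definition conc_incl ::
  "(('c, 'w, 'v) block list \<Rightarrow> ('f, 'n, 'x, 'w, 'v) soln \<Rightarrow> ('f, 'n, 'x, 'w) frame \<Rightarrow> bool)
   \<Rightarrow> ('c \<Rightarrow> ('c, 'f, 'n, 'x, 'w) proc) \<Rightarrow> ('f, 'n, 'x, 'w) frame
   \<Rightarrow> ('c \<Rightarrow> ('c, 'f, 'n, 'x, 'w) proc) \<Rightarrow> ('f, 'n, 'x, 'w) frame \<Rightarrow> bool" where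
  "conc_incl D p0 F0 q0 G0 \<longleftrightarrow> (\<forall>tr \<theta> F. conc p0 F0 tr \<theta> F \<longrightarrow> D tr \<theta> F \<longrightarrow>
     (\<exists>G. conc q0 G0 tr \<theta> G \<and> static_equiv Sig E F G))"

text \<open>Treats both notions of satisfaction at once: \<open>SA\<close> gives the solutions and
  \<open>D\<close> the dependency condition on concrete executions. Hypothesis \<open>B\<close>
  expresses that the right side inherits the condition from a statically equivalent left execution.
  \<open>D\<close> must respect \<open>env_eq\<close>, as frames are determined only modulo
  \<open>E\<close>.\<close>

lemma red_incl_conc:
  assumes inf: "infinite (UNIV :: 'x set)"
    and p0: "ext_state Sig p0 F0" and q0: "ext_state Sig q0 G0"
    and D: "\<And>tr \<theta> F F'. env_eq F F' \<Longrightarrow> D tr \<theta> F \<Longrightarrow> D tr \<theta> F'"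
    and A: "\<And>tr po F S \<theta>. fred p0 F0 tr po F S \<Longrightarrow>
      \<theta> \<in> SA F S \<longleftrightarrow> \<theta> \<in> Sol Sig E (without_deps (F, S)) \<and> D tr \<theta> (lframe F S \<theta>)"
    and B: "\<And>tr po G S \<theta> F. fred q0 G0 tr po G S \<Longrightarrow> conc p0 F0 tr \<theta> F \<Longrightarrow> D tr \<theta> F \<Longrightarrow>
      static_equiv Sig E F (lframe G S \<theta>) \<Longrightarrow>
      \<theta> \<in> SA G S \<longleftrightarrow> \<theta> \<in> Sol Sig E (without_deps (G, S))"
    and sub: "\<And>F S. SA F S \<subseteq> Sol Sig E (without_deps (F, S))"
  shows "(\<forall>(tr :: ('c::linorder, 'w, 'v) block list) PP' F' S \<theta>.
        red (mk p0, F0, {}) tr (PP', F', S) \<and> \<theta> \<in> SA F' S \<longrightarrow>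
        (\<exists>QQ' G' T. red (mk q0, G0, {}) tr (QQ', G', T) \<and> \<theta> \<in> SA G' T \<and>
           static_equiv Sig E (lframe F' S \<theta>) (lframe G' T \<theta>))) \<longleftrightarrow>
    conc_incl D p0 F0 q0 G0" (is "?L \<longleftrightarrow> ?R")
proof
  have fp: "finite {c. p0 c \<noteq> Null}" "\<And>c. basic Sig c (p0 c)"
    and fq: "finite {c. q0 c \<noteq> Null}" "\<And>c. basic Sig c (q0 c)"
    using p0 q0 by (auto simp: ext_state_def)
  {
    assume L: ?L
    show ?R unfolding conc_incl_def
    proof (intro allI impI)
      fix tr and \<theta> :: "('f, 'n, 'x, 'w, 'v) soln" and F
      assume c: "conc p0 F0 tr \<theta> F" and d: "D tr \<theta> F"
      obtain po F1 S where f: "fred p0 F0 tr po F1 S" "\<theta> \<in> Sol Sig E (without_deps (F1, S))"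
        using conc_fred[OF inf p0 c] by blast
      have eq: "env_eq F (lframe F1 S \<theta>)" by (rule conc_unique[OF c fred_conc[OF p0 f]])
      then have "\<theta> \<in> SA F1 S" using A[OF f(1)] f(2) D d by blast
      then obtain QQ G T where G: "red (mk q0, G0, {}) tr (QQ, G, T)" "\<theta> \<in> SA G T"
        "static_equiv Sig E (lframe F1 S \<theta>) (lframe G T \<theta>)"
        using L fred_red[OF f(1) fp] by blast
      obtain qo where q: "fred q0 G0 tr qo G T" using red_fred[OF G(1) HOL.refl fq] by auto
      have "conc q0 G0 tr \<theta> (lframe G T \<theta>)" using fred_conc[OF q0 q] G(2) sub by blast
      moreover have "static_equiv Sig E F (lframe G T \<theta>)"
        by (rule static_equiv_env_eq[OF G(3) conc_unique[OF fred_conc[OF p0 f] c] env_eq_refl])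
      ultimately show "\<exists>G. conc q0 G0 tr \<theta> G \<and> static_equiv Sig E F G" by blast
    qed
  }
  {
    assume R: ?R
    show ?L
    proof (intro allI impI, elim conjE)
      fix tr PP F S and \<theta> :: "('f, 'n, 'x, 'w, 'v) soln"
      assume r: "red (mk p0, F0, {}) tr (PP, F, S)" and s: "\<theta> \<in> SA F S"
      obtain po where f: "fred p0 F0 tr po F S" using red_fred[OF r HOL.refl fp] by auto
      have c: "conc p0 F0 tr \<theta> (lframe F S \<theta>)" using fred_conc[OF p0 f] s sub by blast
      have d: "D tr \<theta> (lframe F S \<theta>)" using A[OF f] s by blast
      obtain G where G: "conc q0 G0 tr \<theta> G" "static_equiv Sig E (lframe F S \<theta>) G"
        using R c d unfolding conc_incl_def by blast
      obtain qo G1 T where q: "fred q0 G0 tr qo G1 T" "\<theta> \<in> Sol Sig E (without_deps (G1, T))"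
        using conc_fred[OF inf q0 G(1)] by blast
      have st: "static_equiv Sig E (lframe F S \<theta>) (lframe G1 T \<theta>)"
        by (rule static_equiv_env_eq[OF G(2) env_eq_refl conc_unique[OF G(1) fred_conc[OF q0 q]]])
      then have "\<theta> \<in> SA G1 T" using B[OF q(1) c d] q(2) by blast
      then show "\<exists>QQ' G' T. red (mk q0, G0, {}) tr (QQ', G', T) \<and> \<theta> \<in> SA G' T \<and>
           static_equiv Sig E (lframe F S \<theta>) (lframe G' T \<theta>)"
        using fred_red[OF q(1) fq] st by blast
    qed
  }
qed

end

theorem theorem4:
  fixes Sig :: "('f \<times> nat) set"
    and E :: "('f, 'n, 'x, 'w) eqs"
    and A B :: "('c::linorder, 'f, 'n, 'x, 'w) ext_process"
  assumes "infinite (UNIV :: 'x set)"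
    and "infinite (UNIV :: 'w set)"
    and "finite Sig"
    and "E \<subseteq> messages Sig \<times> messages Sig"
    and "ext_simple_process Sig A"
    and "ext_simple_process Sig B"
  shows "red_incl2 TYPE('v) Sig E A B \<longleftrightarrow> red_incl1 TYPE('v) Sig E A B"
proof -
  obtain p0 where A: "fst A = mk p0" and p0: "ext_state Sig p0 (snd A)"
    by (rule ext_simple_process_state[OF assms(5)])
  obtain q0 where B: "fst B = mk q0" and q0: "ext_state Sig q0 (snd B)"
    by (rule ext_simple_process_state[OF assms(6)])
  let ?D1 = "\<lambda>tr (\<theta> :: ('f, 'n, 'x, 'w, 'v) soln) F. deps1 Sig E \<theta> F (dom (snd A)) tr"
  let ?D2 = "\<lambda>tr (\<theta> :: ('f, 'n, 'x, 'w, 'v) soln) (F :: ('f, 'n, 'x, 'w) frame). deps2 \<theta> tr"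
  have 1: "red_incl1 TYPE('v) Sig E A B \<longleftrightarrow> conc_incl Sig E ?D1 p0 (snd A) q0 (snd B)"
    unfolding red_incl1_def A B
  proof (rule red_incl_conc[OF assms(1) p0 q0, where SA = "\<lambda>F S. Sol1 Sig E (F, S)"])
    fix tr qo G T and \<theta> :: "('f, 'n, 'x, 'w, 'v) soln" and F
    assume q: "fred q0 (snd B) tr qo G T" and c: "conc Sig E p0 (snd A) tr \<theta> F"
      and d: "deps1 Sig E \<theta> F (dom (snd A)) tr"
      and st: "static_equiv Sig E F (inst_frame G (lambda_of Sig E (G, T) \<theta>))"
    \<comment> \<open>\<open>?D1\<close> refers to the initial domain of the left process, the
      constraints in \<open>T\<close> to that of the right one; static equivalence of the final
      frames makes the two equal.\<close>
    have "deps1 Sig E \<theta> (inst_frame G (lambda_of Sig E (G, T) \<theta>)) (dom (snd B)) tr"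
      if s: "\<theta> \<in> Sol Sig E (without_deps (G, T))"
      using deps1_static_equiv[OF c st d] conc_static_dom[OF c fred_conc[OF q0 q s] st] by simp
    then show "\<theta> \<in> Sol1 Sig E (G, T) \<longleftrightarrow> \<theta> \<in> Sol Sig E (without_deps (G, T))"
      using Sol1_deps1[OF q0 q, of \<theta> E] by blast
  next
    fix tr po F and S :: "('f, 'n, 'x, 'w, 'v) constr set" and \<theta> :: "('f, 'n, 'x, 'w, 'v) soln"
    assume "fred p0 (snd A) tr po F S"
    then show "\<theta> \<in> Sol1 Sig E (F, S) \<longleftrightarrow> \<theta> \<in> Sol Sig E (without_deps (F, S)) \<and>
        deps1 Sig E \<theta> (inst_frame F (lambda_of Sig E (F, S) \<theta>)) (dom (snd A)) tr"
      by (rule Sol1_deps1[OF p0])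
  qed (auto simp: Sol1_def intro: deps1_env_eq)
  have 2: "red_incl2 TYPE('v) Sig E A B \<longleftrightarrow> conc_incl Sig E ?D2 p0 (snd A) q0 (snd B)"
    unfolding red_incl2_def A B
  proof (rule red_incl_conc[OF assms(1) p0 q0, where SA = "\<lambda>F S. Sol2 Sig E (F, S)"])
    fix tr po F and S :: "('f, 'n, 'x, 'w, 'v) constr set" and \<theta> :: "('f, 'n, 'x, 'w, 'v) soln"
    assume "fred p0 (snd A) tr po F S"
    then show "\<theta> \<in> Sol2 Sig E (F, S) \<longleftrightarrow> \<theta> \<in> Sol Sig E (without_deps (F, S)) \<and> deps2 \<theta> tr"
      by (rule Sol2_deps2[OF p0])
  next
    fix tr po G and S :: "('f, 'n, 'x, 'w, 'v) constr set" and \<theta> :: "('f, 'n, 'x, 'w, 'v) soln"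
    assume "fred q0 (snd B) tr po G S" "deps2 \<theta> tr"
    then show "\<theta> \<in> Sol2 Sig E (G, S) \<longleftrightarrow> \<theta> \<in> Sol Sig E (without_deps (G, S))"
      using Sol2_deps2[OF q0] by blast
  qed (auto simp: Sol2_def)
  \<comment> \<open>On concrete executions \<open>?D1\<close> implies \<open>?D2\<close>, which
    settles one implication; for the other, \<open>incl_all\<close> removes the condition
    \<open>?D1\<close> altogether.\<close>
  show ?thesis unfolding 1 2
  proof
    assume i: "conc_incl Sig E ?D2 p0 (snd A) q0 (snd B)"
    show "conc_incl Sig E ?D1 p0 (snd A) q0 (snd B)"
      unfolding conc_incl_def
    proof (intro allI impI)
      fix tr :: "('c, 'w, 'v) block list" and \<theta> F
      assume c: "conc Sig E p0 (snd A) tr \<theta> F" and d: "deps1 Sig E \<theta> F (dom (snd A)) tr"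
      have "recs Sig \<theta> (dom (snd A)) tr" using c by (simp add: conc_def)
      then have "deps2 \<theta> tr" using d by (rule deps1_deps2)
      then show "\<exists>G. conc Sig E q0 (snd B) tr \<theta> G \<and> static_equiv Sig E F G"
        using i c unfolding conc_incl_def by blast
    qed
  next
    assume i: "conc_incl Sig E ?D1 p0 (snd A) q0 (snd B)"
    show "conc_incl Sig E ?D2 p0 (snd A) q0 (snd B)"
      unfolding conc_incl_def
    proof (intro allI impI)
      fix tr :: "('c, 'w, 'v) block list" and \<theta> F
      assume "conc Sig E p0 (snd A) tr \<theta> F"
      then show "\<exists>G. conc Sig E q0 (snd B) tr \<theta> G \<and> static_equiv Sig E F G"
        by (rule incl_all[rotated]) (use i in \<open>unfold conc_incl_def, blast\<close>)
    qed
  qed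
qed

end
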